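(* Let $d\ge2$ be an integer and let $\Omega\subseteq\mathbb{R}^d$ be a bounded Lebesgue measurable set with nonempty interior and $Per(\Omega)<\infty$. Then there exists a constant $\gamma_d(\Omega)>0$ such that for all $0<t<\min\{\operatorname{diam}(\Omega),e^{-1}\}$, where $\operatorname{diam}(\Omega)=\sup\{|x-y|:x,y\in\Omega\}$, $$\Psi^{(1)}_\Omega(t)+t\left(\tfrac t2-1\right)|\Omega|\le \gamma_d(\Omega)\,t^3+\frac{Per(\Omega)}{3!\,\pi}\,t^3\ln\!\left(\frac1t\right).$$ Consequently, $$\limsup_{t\to0^+}\frac{\Psi^{(1)}_\Omega(t)+t\left(\tfrac t2-1\right)|\Omega|}{t^3\ln(1/t)}\le\frac{Per(\Omega)}{3!\,\pi}.$$
   Context: $\mathbf X$ is the Cauchy process in $\mathbb{R}^d$ (the rotationally invariant $1$-stable process), with transition densities $p^{(1)}_t(x,y)=\dfrac{k_d\,t}{(t^2+|x-y|^2)^{(d+1)/2}}$, $k_d=\Gamma(\frac{d+1}{2})\pi^{-\frac{d+1}{2}}$, whose Fourier transform is $e^{-t|\xi|}$. For $x,y\in\mathbb{R}^d$, $t>0$, $\mathbb{E}^t_{x,y}$ denotes expectation for the bridge of this process from $x$ to $y$ of length $t$, i.e. the process whose finite-dimensional distributions for $0<s_1<\dots<s_k<t$ are $$\mathbb{P}^t_{x,y}(X_{s_1}\in dz_1,\dots,X_{s_k}\in dz_k)=\frac{p^{(1)}_{s_1}(x,z_1)\prod_{j=1}^{k-1}p^{(1)}_{s_{j+1}-s_j}(z_j,z_{j+1})\,p^{(1)}_{t-s_k}(z_k,y)}{p^{(1)}_t(x,y)}\,dz_1\cdots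 dz_k.$$ $\Psi^{(1)}_\Omega(t)=\int_{\mathbb{R}^d}dx\int_{\mathbb{R}^d}dy\,p^{(1)}_t(x,y)\big(1-\mathbb{E}^t_{x,y}[e^{-\int_0^t\mathbb{1}_\Omega(X_s)ds}]\big)$. $|\Omega|$ is Lebesgue measure and $Per(\Omega)=\sup\{\int_\Omega\operatorname{div}\varphi\,dx:\varphi\in C^1_c(\mathbb{R}^d,\mathbb{R}^d),\|\varphi\|_\infty\le1\}$. *)

theory Defs
  imports "HOL-Analysis.Analysis" "HOL-Probability.Probability"
begin

definition cauchy_const :: "'a::euclidean_space itself \<Rightarrow> real" where
  "cauchy_const _ = Gamma ((real DIM('a) + 1) / 2) * pi powr (- (real DIM('a) + 1) / 2)"

definition cauchy_kernel :: "real \<Rightarrow> 'a::euclidean_space \<Rightarrow> 'a \<Rightarrow> real" where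
  "cauchy_kernel t x y =
     cauchy_const TYPE('a) * t / (t\<^sup>2 + (norm (x - y))\<^sup>2) powr ((real DIM('a) + 1) / 2)"

text \<open>Unnormalised joint density of (X_{s_0},...,X_{s_{k-1}}) for the bridge from x to y
  of length t (times s_0 < ... < s_{k-1}, k \<ge> 1).\<close>
definition bridge_chain ::
  "'a::euclidean_space \<Rightarrow> 'a \<Rightarrow> real \<Rightarrow> nat \<Rightarrow> (nat \<Rightarrow> real) \<Rightarrow> (nat \<Rightarrow> 'a) \<Rightarrow> real" where
  "bridge_chain x y t k s z =
     cauchy_kernel (s 0) x (z 0)
     * (\<Prod>j<k - 1. cauchy_kernel (s (Suc j) - s j) (z j) (z (Suc j)))
     * cauchy_kernel (t - s (k - 1)) (z (k - 1)) y"

definition is_cauchy_bridge ::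
  "'a::euclidean_space \<Rightarrow> 'a \<Rightarrow> real \<Rightarrow> 'w measure \<Rightarrow> (real \<Rightarrow> 'w \<Rightarrow> 'a) \<Rightarrow> bool" where
  "is_cauchy_bridge x y t M X \<longleftrightarrow>
     prob_space M \<and>
     (\<lambda>(s, \<omega>). X s \<omega>) \<in> borel_measurable (lborel \<Otimes>\<^sub>M M) \<and>
     (\<forall>(k::nat) (s::nat \<Rightarrow> real) (A::nat \<Rightarrow> 'a set).
        1 \<le> k \<and> (\<forall>i<k. A i \<in> sets borel) \<and> 0 < s 0 \<and>
        (\<forall>i. Suc i < k \<longrightarrow> s i < s (Suc i)) \<and> s (k - 1) < t \<longrightarrow>
        ennreal (cauchy_kernel t x y) * emeasure M {\<omega> \<in> space M. \<forall>i<k. X (s i) \<omega> \<in> A i}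
        = (\<integral>\<^sup>+ z. ennreal ((\<Prod>i<k. indicator (A i) (z i)) * bridge_chain x y t k s z)
             \<partial>(PiM {..<k} (\<lambda>_. lborel))))"

text \<open>E^t_{x,y}[exp(- \<integral>_0^t 1_\<Omega>(X_s) ds)] computed on a realisation (M, X).
  The completion of M is used since \<Omega> is only Lebesgue measurable.\<close>
definition bridge_expect ::
  "'w measure \<Rightarrow> (real \<Rightarrow> 'w \<Rightarrow> 'a::euclidean_space) \<Rightarrow> real \<Rightarrow> 'a set \<Rightarrow> real" where
  "bridge_expect M X t \<Omega> =
     (\<integral>\<omega>. exp (- (LINT s:{0..t}|lebesgue. indicator \<Omega> (X s \<omega>))) \<partial>(completion M))"

definition Psi ::
  "('a::euclidean_space \<Rightarrow> 'a \<Rightarrow> real \<Rightarrow> 'w measure \<times> (real \<Rightarrow> 'w \<Rightarrow> 'a)) \<Rightarrow> 'a set \<Rightarrow> real \<Rightarrow> real" where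
  "Psi B \<Omega> t =
     (\<integral>x. \<integral>y. cauchy_kernel t x y * (1 - bridge_expect (fst (B x y t)) (snd (B x y t)) t \<Omega>)
        \<partial>lborel \<partial>lborel)"

definition divergence :: "('a::euclidean_space \<Rightarrow> 'a) \<Rightarrow> 'a \<Rightarrow> real" where
  "divergence \<phi> x = (\<Sum>b\<in>Basis. frechet_derivative \<phi> (at x) b \<bullet> b)"

definition C1c_unit_fields :: "('a::euclidean_space \<Rightarrow> 'a) set" where
  "C1c_unit_fields = {\<phi>. \<phi> differentiable_on UNIV \<and>
      (\<forall>b\<in>Basis. continuous_on UNIV (\<lambda>x. frechet_derivative \<phi> (at x) b)) \<and>
      compact (closure {x. \<phi> x \<noteq> 0}) \<and> (\<forall>x. norm (\<phi> x) \<le> 1)}"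

definition Per :: "'a::euclidean_space set \<Rightarrow> ereal" where
  "Per \<Omega> = (SUP \<phi>\<in>C1c_unit_fields. ereal (LINT x:\<Omega>|lebesgue. divergence \<phi> x))"

end

theory Submission
  imports Defs
begin

text \<open>
  Let A be the occupation time of \<open>\<Omega>\<close> up to time t. From
  \<open>1 - exp (- a) \<le> (1 + t\<^sup>2 / 6) * a - a\<^sup>2 / 2\<close> for \<open>0 \<le> a \<le> t\<close> only the first two moments
  of A are needed, and these are read off the one- and two-time distributions of the bridge:
  integrated against \<open>p_t(x, y) dx dy\<close> the first moment is \<open>t \<bar>\<Omega>\<bar>\<close>, and the second is twice the
  integral of \<open>H (u - s)\<close> over \<open>0 < s < u < t\<close>, where H is the heat content \<open>\<langle>1_\<Omega>, P_r 1_\<Omega>\<rangle>\<close>.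
  The deficit \<open>\<bar>\<Omega>\<bar> - H r\<close> is half the integral of \<open>p_r(0, h)\<close> times the L1 modulus
  \<open>\<bar>\<Omega> \<triangle> (\<Omega> - h)\<bar>\<close>. For \<open>norm h < 1\<close> mollification of the indicator bounds this by the perimeter times
  the first absolute moment of \<open>p_r\<close> in a fixed direction; the one-dimensional marginals of
  \<open>p_r\<close> are Cauchy (by Gaussian subordination), so this moment is \<open>r / pi * ln (1 + 1 / r\<^sup>2)\<close>,
  which produces the sharp constant. The part \<open>norm h \<ge> 1\<close> contributes O(r).
\<close>

subsection \<open>The Cauchy kernel and its marginals\<close>

text \<open>The inequality for \<open>1 - exp (- a)\<close> is the cubic Taylor bound combined with
  \<open>a ^ 3 \<le> t\<^sup>2 * a\<close>. The first moment and the leading part of the second give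
  |\<Omega>| (t - t^2/2), which is what the statement removes, so everything rests on the deficit of
  the heat content. It is at most Per(\<Omega>) (r/pi) ln(1/r) + O(r) for r \<le> 1, and the
  integral of (t - r) r over 0 < r < t is t^3/6; hence the constant 1/(3! pi). The constant stays
  sharp because a translation by h is charged with |h . grad| rather than |h| |grad|, and because h
  is integrated before x: for fixed x the moment of |h . v| depends on the length of v only, so the
  direction of the gradient at x is irrelevant. Two obstacles shape the formal side. The
  realisations of the bridges need not depend measurably on the end points, so integrals containing
  the bridge expectation cannot be split additively. And \<Omega> is only Lebesgue measurable, so
  the finite-dimensional distributions apply to a Borel set \<open>A\<close> that differs from it by
  a null set.\<close>

lemma nn_integral_lborel_translate:
  fixes f :: "'a::euclidean_space \<Rightarrow> ennreal"
  assumes [measurable]: "f \<in> borel_measurable borel"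
  shows "(\<integral>\<^sup>+x. f (c + x) \<partial>lborel) = (\<integral>\<^sup>+x. f x \<partial>lborel)"
proof -
  have "(\<integral>\<^sup>+x. f x \<partial>lborel) = (\<integral>\<^sup>+x. f x \<partial>distr lborel borel ((+) c))" by (simp add: lborel_distr_plus)
  also have "\<dots> = (\<integral>\<^sup>+x. f (c + x) \<partial>lborel)" by (rule nn_integral_distr) auto
  finally show ?thesis ..
qed


text \<open>The coordinates of a standard Gaussian vector scaled by \<sigma> are independent, so its
  inner product with \<open>e\<close> is normal with variance \<sigma>^2 times the sum of
  \<open>(e \<bullet> b)\<^sup>2\<close>, and that sum is 1.\<close>

lemma gaussian_projection:
  fixes e :: "'a::euclidean_space" and F :: "real \<Rightarrow> ennreal"
  assumes \<sigma>: "0 < \<sigma>" and e: "norm e = 1" and F[measurable]: "F \<in> borel_measurable borel"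
  shows "(\<integral>\<^sup>+(h::'a). ennreal (\<Prod>b\<in>Basis. normal_density 0 \<sigma> (h \<bullet> b)) * F (h \<bullet> e) \<partial>lborel)
    = (\<integral>\<^sup>+u. ennreal (normal_density 0 \<sigma> u) * F u \<partial>lborel)"
proof -
  define N where "N = density lborel (\<lambda>x. ennreal (normal_density 0 \<sigma> x))"
  have sN[measurable_cong]: "sets N = sets borel" by (simp add: N_def)
  interpret N: prob_space N unfolding N_def by (rule prob_space_normal_density[OF \<sigma>])
  define P where "P = PiM (Basis::'a set) (\<lambda>_. N)"
  interpret pp: product_prob_space "\<lambda>_::'a. N" "Basis" by standard
  interpret P: prob_space P unfolding P_def by (rule prob_space_PiM) (rule N.prob_space_axioms)
  interpret lb: product_sigma_finite "\<lambda>_::'a. lborel::real measure" by standard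
  \<comment> \<open>Needed to return from the probabilistic statement to Lebesgue integrals: the
    product of the one-dimensional laws has the product density. It suffices to compare both
    measures on boxes.\<close>
  have P_eq: "P = density (PiM (Basis::'a set) (\<lambda>_. lborel)) (\<lambda>\<omega>. \<Prod>b\<in>Basis. ennreal (normal_density 0 \<sigma> (\<omega> b)))"
    unfolding P_def
  proof (rule pp.PiM_eqI[symmetric])
    show "sets (density (Pi\<^sub>M Basis (\<lambda>_. lborel)) (\<lambda>\<omega>. \<Prod>b\<in>Basis. ennreal (normal_density 0 \<sigma> (\<omega> b)))) = sets (Pi\<^sub>M Basis (\<lambda>_::'a. N))"
      by (simp add: N_def cong: sets_PiM_cong)
    fix A :: "'a \<Rightarrow> real set" assume "\<And>i. i \<in> Basis \<Longrightarrow> A i \<in> sets N"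
    then have A[measurable]: "i \<in> Basis \<Longrightarrow> A i \<in> sets borel" for i by (simp add: N_def)
    have S[measurable]: "Pi\<^sub>E Basis A \<in> sets (Pi\<^sub>M Basis (\<lambda>_. lborel))"
      by (rule sets_PiM_I_finite) (auto simp: A)
    have "emeasure (density (Pi\<^sub>M Basis (\<lambda>_. lborel)) (\<lambda>\<omega>. \<Prod>b\<in>Basis. ennreal (normal_density 0 \<sigma> (\<omega> b)))) (Pi\<^sub>E Basis A)
       = (\<integral>\<^sup>+\<omega>. (\<Prod>b\<in>Basis. ennreal (normal_density 0 \<sigma> (\<omega> b))) * indicator (Pi\<^sub>E Basis A) \<omega> \<partial>Pi\<^sub>M Basis (\<lambda>_. lborel))"
      by (rule emeasure_density) auto
    also have "\<dots> = (\<integral>\<^sup>+\<omega>. (\<Prod>b\<in>Basis. ennreal (normal_density 0 \<sigma> (\<omega> b)) * indicator (A b) (\<omega> b)) \<partial>Pi\<^sub>M Basis (\<lambda>_. lborel))"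
    proof (rule nn_integral_cong)
      fix \<omega> :: "'a \<Rightarrow> real" assume "\<omega> \<in> space (Pi\<^sub>M Basis (\<lambda>_. lborel))"
      then have ex: "\<omega> \<in> extensional Basis" by (simp add: space_PiM PiE_def)
      show "(\<Prod>b\<in>Basis. ennreal (normal_density 0 \<sigma> (\<omega> b))) * indicator (Pi\<^sub>E Basis A) \<omega>
        = (\<Prod>b\<in>Basis. ennreal (normal_density 0 \<sigma> (\<omega> b)) * indicator (A b) (\<omega> b))"
        unfolding prod.distrib
      proof (cases "\<omega> \<in> Pi\<^sub>E Basis A")
        case True
        then have "(\<Prod>b\<in>Basis. indicator (A b) (\<omega> b)) = (1::ennreal)"
          by (intro prod.neutral) (auto simp: PiE_def Pi_def)
        then show "(\<Prod>b\<in>Basis. ennreal (normal_density 0 \<sigma> (\<omega> b))) * indicator (Pi\<^sub>E Basis A) \<omega> =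
          (\<Prod>b\<in>Basis. ennreal (normal_density 0 \<sigma> (\<omega> b))) * (\<Prod>b\<in>Basis. indicator (A b) (\<omega> b))" using True by simp
      next
        case False
        with ex obtain b where "b \<in> Basis" "\<omega> b \<notin> A b" by (auto simp: PiE_def Pi_def)
        then have "(\<Prod>b\<in>Basis. indicator (A b) (\<omega> b)) = (0::ennreal)"
          by (intro prod_zero) (auto intro!: bexI[of _ b])
        then show "(\<Prod>b\<in>Basis. ennreal (normal_density 0 \<sigma> (\<omega> b))) * indicator (Pi\<^sub>E Basis A) \<omega> =
          (\<Prod>b\<in>Basis. ennreal (normal_density 0 \<sigma> (\<omega> b))) * (\<Prod>b\<in>Basis. indicator (A b) (\<omega> b))" using False by simp
      qed
    qed
    also have "\<dots> = (\<Prod>b\<in>Basis. \<integral>\<^sup>+x. ennreal (normal_density 0 \<sigma> x) * indicator (A b) x \<partial>lborel)"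
      by (rule lb.product_nn_integral_prod) auto
    also have "\<dots> = (\<Prod>i\<in>Basis. emeasure N (A i))"
      by (intro prod.cong refl) (auto simp: N_def emeasure_density)
    finally show "emeasure (density (Pi\<^sub>M Basis (\<lambda>_. lborel)) (\<lambda>\<omega>. \<Prod>b\<in>Basis. ennreal (normal_density 0 \<sigma> (\<omega> b)))) (Pi\<^sub>E Basis A)
      = (\<Prod>i\<in>Basis. emeasure N (A i))" .
  qed simp
  have comp: "distr P N (\<lambda>\<omega>. \<omega> b) = N" if "b \<in> Basis" for b
    unfolding P_def by (rule pp.PiM_component[OF that])
  have meas[measurable]: "(\<lambda>\<omega>. \<omega> b) \<in> measurable P N" if "b \<in> Basis" for b
    unfolding P_def by (rule measurable_component_singleton[OF that])
  have indep: "P.indep_vars (\<lambda>_. N) (\<lambda>b \<omega>. \<omega> b) Basis"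
  proof (subst P.indep_vars_iff_distr_eq_PiM')
    have "distr P (Pi\<^sub>M Basis (\<lambda>i. N)) (\<lambda>x. \<lambda>i\<in>Basis. x i) = distr P P (\<lambda>x. x)"
      by (intro distr_cong) (auto simp: P_def space_PiM)
    also have "\<dots> = (\<Pi>\<^sub>M i\<in>Basis. distr P N (\<lambda>\<omega>. \<omega> i))"
      unfolding distr_id2[OF refl] by (subst (1) P_def) (auto intro!: PiM_cong simp: comp)
    finally show "distr P (Pi\<^sub>M Basis (\<lambda>i. N)) (\<lambda>x. \<lambda>i\<in>Basis. x i) = (\<Pi>\<^sub>M i\<in>Basis. distr P N (\<lambda>\<omega>. \<omega> i))" .
  qed (auto simp: nonempty_Basis)
  \<comment> \<open>The sum rule for independent normals requires strictly positive deviations and a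
    nonempty index set, so coordinates with zero coefficient are dropped.\<close>
  define J where "J = {b\<in>Basis. e \<bullet> b \<noteq> 0}"
  have J: "finite J" "J \<subseteq> Basis" by (auto simp: J_def)
  have "e \<noteq> 0" using e by auto
  then have J0: "J \<noteq> {}" unfolding J_def using euclidean_eq_iff[of e 0] by auto
  have "P.indep_vars (\<lambda>_. N) (\<lambda>b \<omega>. \<omega> b) J"
    by (rule P.indep_vars_subset[OF indep J(2)])
  then have "P.indep_vars (\<lambda>_. borel) (\<lambda>b \<omega>. (e \<bullet> b) * \<omega> b) J"
    by (rule P.indep_vars_compose2[where Y="\<lambda>b x. (e \<bullet> b) * x"]) simp
  moreover have "distributed P lborel (\<lambda>\<omega>. (e \<bullet> b) * \<omega> b) (normal_density 0 (\<bar>e \<bullet> b\<bar> * \<sigma>))" if "b \<in> J" for b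
  proof -
    have b: "b \<in> Basis" "e \<bullet> b \<noteq> 0" using that by (auto simp: J_def)
    have "distr P lborel (\<lambda>\<omega>. \<omega> b) = N"
      using comp[OF b(1)] by (simp cong: distr_cong add: sN)
    then have "distributed P lborel (\<lambda>\<omega>. \<omega> b) (normal_density 0 \<sigma>)"
      unfolding distributed_def using b meas[OF b(1)] by (auto simp: N_def)
    from P.normal_density_affine[OF this \<sigma> b(2), of 0] show ?thesis by simp
  qed
  ultimately have "distributed P lborel (\<lambda>\<omega>. \<Sum>b\<in>J. (e \<bullet> b) * \<omega> b)
      (normal_density (\<Sum>b\<in>J. 0) (sqrt (\<Sum>b\<in>J. (\<bar>e \<bullet> b\<bar> * \<sigma>)\<^sup>2)))"
    using \<sigma> by (intro P.sum_indep_normal[OF J(1) J0]) (auto simp: J_def)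
  moreover have "(\<Sum>b\<in>J. (\<bar>e \<bullet> b\<bar> * \<sigma>)\<^sup>2) = \<sigma>\<^sup>2"
  proof -
    have "(\<Sum>b\<in>J. (\<bar>e \<bullet> b\<bar> * \<sigma>)\<^sup>2) = (\<Sum>b\<in>Basis. (\<bar>e \<bullet> b\<bar> * \<sigma>)\<^sup>2)"
      by (rule sum.mono_neutral_left) (auto simp: J_def)
    also have "\<dots> = (\<Sum>b\<in>Basis. (e \<bullet> b) * (e \<bullet> b)) * \<sigma>\<^sup>2"
      by (simp add: sum_distrib_right power_mult_distrib) (simp add: power2_eq_square)
    also have "\<dots> = \<sigma>\<^sup>2" using e by (simp add: euclidean_inner[symmetric] norm_eq_1)
    finally show ?thesis .
  qed
  ultimately have D: "distributed P lborel (\<lambda>\<omega>. \<Sum>b\<in>J. (e \<bullet> b) * \<omega> b) (normal_density 0 \<sigma>)"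
    using \<sigma> by simp
  have "(\<integral>\<^sup>+u. ennreal (normal_density 0 \<sigma> u) * F u \<partial>lborel) = (\<integral>\<^sup>+\<omega>. F (\<Sum>b\<in>J. (e \<bullet> b) * \<omega> b) \<partial>P)"
    by (rule distributed_nn_integral[OF D]) simp
  also have "\<dots> = (\<integral>\<^sup>+\<omega>. (\<Prod>b\<in>Basis. ennreal (normal_density 0 \<sigma> (\<omega> b))) * F (\<Sum>b\<in>J. (e \<bullet> b) * \<omega> b) \<partial>PiM (Basis::'a set) (\<lambda>_. lborel))"
    unfolding P_eq using J(2) by (subst nn_integral_density) (auto intro!: measurable_compose[OF _ F] borel_measurable_sum)
  also have "\<dots> = (\<integral>\<^sup>+\<omega>. ennreal (\<Prod>b\<in>Basis. normal_density 0 \<sigma> ((\<Sum>b\<in>Basis. \<omega> b *\<^sub>R b) \<bullet> b)) * F ((\<Sum>b\<in>Basis. \<omega> b *\<^sub>R b) \<bullet> e) \<partial>PiM (Basis::'a set) (\<lambda>_. lborel))"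
  proof (rule nn_integral_cong)
    fix \<omega> :: "'a \<Rightarrow> real"
    have "(\<Sum>b\<in>Basis. \<omega> b *\<^sub>R b) \<bullet> e = (\<Sum>b\<in>Basis. (e \<bullet> b) * \<omega> b)"
      by (simp add: inner_sum_left) (simp add: inner_commute mult.commute)
    also have "\<dots> = (\<Sum>b\<in>J. (e \<bullet> b) * \<omega> b)"
      by (rule sum.mono_neutral_right) (auto simp: J_def)
    finally show "(\<Prod>b\<in>Basis. ennreal (normal_density 0 \<sigma> (\<omega> b))) * F (\<Sum>b\<in>J. (e \<bullet> b) * \<omega> b)
      = ennreal (\<Prod>b\<in>Basis. normal_density 0 \<sigma> ((\<Sum>b\<in>Basis. \<omega> b *\<^sub>R b) \<bullet> b)) * F ((\<Sum>b\<in>Basis. \<omega> b *\<^sub>R b) \<bullet> e)"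
      by (simp add: prod_ennreal inner_sum_left_Basis cong: prod.cong)
  qed
  also have "\<dots> = (\<integral>\<^sup>+(h::'a). ennreal (\<Prod>b\<in>Basis. normal_density 0 \<sigma> (h \<bullet> b)) * F (h \<bullet> e) \<partial>lborel)"
    by (subst (2) lborel_eq) (simp add: nn_integral_distr)
  finally show ?thesis ..
qed


section \<open>Gaussian subordination of the Cauchy kernel\<close>

lemma nn_integral_Gamma_scaled:
  assumes a: "0 < (a::real)" and A: "0 < A"
  shows "(\<integral>\<^sup>+s. ennreal (indicator {0<..} s * (s powr (a - 1) * exp (- s * A))) \<partial>lborel) = ennreal (Gamma a / A powr a)"
proof -
  let ?I = "\<integral>\<^sup>+s. ennreal (indicator {0<..} s * (s powr (a - 1) * exp (- s * A))) \<partial>lborel"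
  have "ennreal (Gamma a) = (\<integral>\<^sup>+s. ennreal (indicator {0..} s * s powr (a - 1) / exp s) \<partial>lborel)"
    by (rule Gamma_conv_nn_integral_real[OF a])
  also have "\<dots> = ennreal \<bar>A\<bar> * (\<integral>\<^sup>+s. ennreal (indicator {0..} (0 + A * s) * (0 + A * s) powr (a - 1) / exp (0 + A * s)) \<partial>lborel)"
    using A by (intro nn_integral_real_affine) auto
  also have "(\<integral>\<^sup>+s. ennreal (indicator {0..} (0 + A * s) * (0 + A * s) powr (a - 1) / exp (0 + A * s)) \<partial>lborel)
    = (\<integral>\<^sup>+s. ennreal (A powr (a - 1)) * ennreal (indicator {0<..} s * (s powr (a - 1) * exp (- s * A))) \<partial>lborel)"
    using A by (intro nn_integral_cong)
      (auto simp: indicator_def zero_le_mult_iff powr_mult exp_minus field_simps ennreal_mult'[symmetric])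
  also have "\<dots> = ennreal (A powr (a - 1)) * ?I"
    by (rule nn_integral_cmult) simp
  also have "ennreal \<bar>A\<bar> * \<dots> = ennreal (A powr a) * ?I"
    using A by (simp add: mult.assoc[symmetric] ennreal_mult'[symmetric] powr_diff)
  finally have "ennreal (Gamma a) / ennreal (A powr a) = ennreal (A powr a) * ?I / ennreal (A powr a)" by simp
  also have "\<dots> = ?I"
    using A by (subst mult.commute, intro ennreal_mult_divide_eq) auto
  finally show ?thesis
    using A a by (simp add: divide_ennreal)
qed

lemma cauchy_kernel_measurable[measurable (raw)]:
  assumes [measurable]: "f \<in> borel_measurable M" "g \<in> borel_measurable M" "h \<in> borel_measurable M"
  shows "(\<lambda>x. cauchy_kernel (f x) (g x) (h x :: 'a::euclidean_space)) \<in> borel_measurable M"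
  unfolding cauchy_kernel_def by measurable

lemma cauchy_const_pos: "0 < cauchy_const TYPE('a::euclidean_space)"
  unfolding cauchy_const_def by (intro mult_pos_pos Gamma_real_pos) auto

lemma cauchy_kernel_nonneg: "0 \<le> t \<Longrightarrow> 0 \<le> cauchy_kernel t x (y::'a::euclidean_space)"
  unfolding cauchy_kernel_def using cauchy_const_pos[where 'a='a] by auto

lemma cauchy_kernel_pos: "0 < t \<Longrightarrow> 0 < cauchy_kernel t x (y::'a::euclidean_space)"
  unfolding cauchy_kernel_def using cauchy_const_pos[where 'a='a]
  by (intro divide_pos_pos mult_pos_pos) (auto simp: add_pos_nonneg)

lemma cauchy_kernel_diff: "cauchy_kernel t x (y::'a::euclidean_space) = cauchy_kernel t 0 (y - x)"
  unfolding cauchy_kernel_def by (simp add: norm_minus_commute)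


text \<open>Subordination of Brownian motion by the 1/2-stable subordinator, written in the variable
  s = 1/(4 tau), tau being the random time; in this variable the mixing law is the Gamma law of
  shape 1/2 and rate r^2. The Gaussian with variance 1/(2s) contributes (s/pi)^(d/2) exp(-s |h|^2),
  so the integrand becomes that of Euler's integral with exponent (d+1)/2 and rate
  \<open>r\<^sup>2 + (norm h)\<^sup>2\<close>.\<close>

lemma cauchy_kernel_subordination:
  fixes h :: "'a::euclidean_space"
  assumes r: "0 < r"
  shows "ennreal (cauchy_kernel r 0 h) = (\<integral>\<^sup>+s. ennreal (indicator {0<..} s * (r / sqrt (pi * s) * exp (- s * r\<^sup>2)))
     * ennreal (\<Prod>b\<in>Basis. normal_density 0 (1 / sqrt (2 * s)) (h \<bullet> b)) \<partial>lborel)"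
proof -
  let ?a = "(real DIM('a) + 1) / 2"
  let ?A = "r\<^sup>2 + (norm h)\<^sup>2"
  have A: "0 < ?A" using r by (simp add: add_pos_nonneg)
  have a: "0 < ?a" by simp
  have "(\<integral>\<^sup>+s. ennreal (indicator {0<..} s * (r / sqrt (pi * s) * exp (- s * r\<^sup>2)))
     * ennreal (\<Prod>b\<in>Basis. normal_density 0 (1 / sqrt (2 * s)) (h \<bullet> b)) \<partial>lborel)
     = (\<integral>\<^sup>+s. ennreal (r * pi powr (- ?a)) * ennreal (indicator {0<..} s * (s powr (?a - 1) * exp (- s * ?A))) \<partial>lborel)"
  proof (rule nn_integral_cong)
    fix s :: real
    show "ennreal (indicator {0<..} s * (r / sqrt (pi * s) * exp (- s * r\<^sup>2)))
     * ennreal (\<Prod>b\<in>Basis. normal_density 0 (1 / sqrt (2 * s)) (h \<bullet> b))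
     = ennreal (r * pi powr (- ?a)) * ennreal (indicator {0<..} s * (s powr (?a - 1) * exp (- s * ?A)))"
    proof (cases "0 < s")
      case True
      have "normal_density 0 (1 / sqrt (2 * s)) x = sqrt (s / pi) * exp (- s * x\<^sup>2)" for x
        using True by (simp add: normal_density_def power_divide real_sqrt_divide field_simps)
      then have "(\<Prod>b\<in>Basis. normal_density 0 (1 / sqrt (2 * s)) (h \<bullet> b)) = (\<Prod>b\<in>Basis. sqrt (s / pi) * exp (- s * (h \<bullet> b)\<^sup>2))"
        by simp
      also have "\<dots> = sqrt (s / pi) ^ DIM('a) * exp (- s * (norm h)\<^sup>2)"
        proof -
        have "(\<Prod>b\<in>Basis. exp (- s * (h \<bullet> b)\<^sup>2)) = exp (\<Sum>b\<in>Basis. - s * (h \<bullet> b)\<^sup>2)"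
          by (rule exp_sum[symmetric]) simp
        also have "(\<Sum>b\<in>Basis. - s * (h \<bullet> b)\<^sup>2) = - s * (norm h)\<^sup>2"
        proof -
          have "(norm h)\<^sup>2 = (\<Sum>b\<in>Basis. (h \<bullet> b)\<^sup>2)"
            by (subst power2_norm_eq_inner, subst euclidean_inner) (simp only: power2_eq_square)
          then show ?thesis by (simp add: sum_distrib_left sum_negf)
        qed
        finally show ?thesis by (simp add: prod.distrib)
      qed
      also have "sqrt (s / pi) ^ DIM('a) = (s / pi) powr (real DIM('a) / 2)"
      proof -
        have "sqrt (s / pi) = (s / pi) powr (1/2)" using True by (subst powr_half_sqrt) auto
        then have "sqrt (s / pi) ^ DIM('a) = ((s / pi) powr (1/2)) powr real DIM('a)"
          using True by (subst powr_realpow) auto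
        also have "\<dots> = (s / pi) powr (real DIM('a) / 2)" unfolding powr_powr by (simp only: mult_1_left times_divide_eq_left)
        finally show ?thesis .
      qed
      also have "\<dots> = s powr (real DIM('a) / 2) * pi powr (- (real DIM('a) / 2))"
        using powr_divide[of s pi "real DIM('a) / 2"] True by (simp only: powr_minus divide_inverse)
      finally have P: "(\<Prod>b\<in>Basis. normal_density 0 (1 / sqrt (2 * s)) (h \<bullet> b))
          = s powr (real DIM('a) / 2) * pi powr (- (real DIM('a) / 2)) * exp (- s * (norm h)\<^sup>2)" .
      have Q: "r / sqrt (pi * s) = r * (s powr (- (1/2)) * pi powr (- (1/2)))"
      proof -
        have "x powr (- (1/2)) = inverse (sqrt x)" if "0 < x" for x
          using that by (simp only: powr_minus powr_half_sqrt less_imp_le)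
        note * = this[OF True] this[OF pi_gt_zero]
        show ?thesis
          unfolding * by (simp only: real_sqrt_mult divide_inverse inverse_mult_distrib ac_simps)
      qed
      have S: "s powr (- (1/2)) * s powr (real DIM('a) / 2) = s powr (?a - 1)"
        unfolding powr_add[symmetric] by (simp add: field_simps)
      have T: "pi powr (- (1/2)) * pi powr (- (real DIM('a) / 2)) = pi powr (- ?a)"
        unfolding powr_add[symmetric] by (rule arg_cong[where f="(powr) pi"]) (simp add: field_simps)
      have E: "exp (- s * r\<^sup>2) * exp (- s * (norm h)\<^sup>2) = exp (- s * ?A)"
        unfolding exp_add[symmetric] by (simp add: algebra_simps)
      show ?thesis
        using True r unfolding P Q
        by (simp only: S[symmetric] T[symmetric] E[symmetric]) (simp add: ennreal_mult'[symmetric] ac_simps)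
    qed simp
  qed
  also have "\<dots> = ennreal (r * pi powr (- ?a)) * ennreal (Gamma ?a / ?A powr ?a)"
    by (subst nn_integral_cmult, measurable) (simp only: nn_integral_Gamma_scaled[OF a A])
  also have "\<dots> = ennreal (cauchy_kernel r 0 h)"
  proof -
    have "r * pi powr (- ?a) * (Gamma ?a / ?A powr ?a) = cauchy_kernel r 0 h"
    proof -
      have E: "- (real DIM('a) + 1) / 2 = - ?a" by (rule minus_divide_left[symmetric])
      show ?thesis unfolding cauchy_kernel_def cauchy_const_def E by simp
    qed
    moreover have "0 \<le> r * pi powr (- ?a)" using r by simp
    ultimately show ?thesis by (metis ennreal_mult')
  qed
  finally show ?thesis ..
qed

text \<open>The mixing law of the subordination does not depend on the dimension. Hence each
  Gaussian is projected to the line spanned by \<open>e\<close>, and the same mixture taken in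
  dimension one is again a Cauchy density.\<close>

lemma cauchy_kernel_marginal:
  fixes e :: "'a::euclidean_space" and F :: "real \<Rightarrow> ennreal"
  assumes r: "0 < r" and e: "norm e = 1" and F[measurable]: "F \<in> borel_measurable borel"
  shows "(\<integral>\<^sup>+h. ennreal (cauchy_kernel r 0 h) * F (h \<bullet> e) \<partial>lborel)
    = (\<integral>\<^sup>+u. ennreal (r / (pi * (r\<^sup>2 + u\<^sup>2))) * F u \<partial>lborel)"
proof -
  let ?c = "\<lambda>s. ennreal (indicator {0<..} s * (r / sqrt (pi * s) * exp (- s * r\<^sup>2)))"
  let ?n = "\<lambda>s. normal_density 0 (1 / sqrt (2 * s))"
  have [measurable]: "(\<lambda>x. normal_density 0 (f x) (g x)) \<in> borel_measurable M"
    if [measurable]: "f \<in> borel_measurable M" "g \<in> borel_measurable M" for f g :: "'z \<Rightarrow> real" and M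
    unfolding normal_density_def by measurable
  have "(\<integral>\<^sup>+h. ennreal (cauchy_kernel r 0 h) * F (h \<bullet> e) \<partial>lborel)
    = (\<integral>\<^sup>+h. \<integral>\<^sup>+s. ?c s * (ennreal (\<Prod>b\<in>Basis. ?n s (h \<bullet> b)) * F (h \<bullet> e)) \<partial>lborel \<partial>lborel)"
  proof (rule nn_integral_cong)
    fix h :: 'a
    have "(\<integral>\<^sup>+s. ?c s * ennreal (\<Prod>b\<in>Basis. ?n s (h \<bullet> b)) * F (h \<bullet> e) \<partial>lborel)
        = (\<integral>\<^sup>+s. ?c s * ennreal (\<Prod>b\<in>Basis. ?n s (h \<bullet> b)) \<partial>lborel) * F (h \<bullet> e)"
      by (rule nn_integral_multc) measurable
    then show "ennreal (cauchy_kernel r 0 h) * F (h \<bullet> e)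
        = (\<integral>\<^sup>+s. ?c s * (ennreal (\<Prod>b\<in>Basis. ?n s (h \<bullet> b)) * F (h \<bullet> e)) \<partial>lborel)"
      by (simp only: mult.assoc cauchy_kernel_subordination[OF r])
  qed
  also have "\<dots> = (\<integral>\<^sup>+s. \<integral>\<^sup>+h. ?c s * (ennreal (\<Prod>b\<in>Basis. ?n s (h \<bullet> b)) * F (h \<bullet> e)) \<partial>lborel \<partial>lborel)"
    by (rule lborel_pair.Fubini') (simp add: case_prod_beta)
  also have "\<dots> = (\<integral>\<^sup>+s. \<integral>\<^sup>+u. ?c s * (ennreal (?n s u) * F u) \<partial>lborel \<partial>lborel)"
  proof (rule nn_integral_cong)
    fix s :: real
    show "(\<integral>\<^sup>+h. ?c s * (ennreal (\<Prod>b\<in>Basis. ?n s (h \<bullet> b)) * F (h \<bullet> e)) \<partial>lborel)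
      = (\<integral>\<^sup>+u. ?c s * (ennreal (?n s u) * F u) \<partial>lborel)"
    proof (cases "0 < s")
      case True
      then have \<sigma>: "0 < 1 / sqrt (2 * s)" by simp
      show ?thesis
        by (subst (1 2) nn_integral_cmult) (measurable, simp only: gaussian_projection[OF \<sigma> e F])
    qed simp
  qed
  also have "\<dots> = (\<integral>\<^sup>+u. \<integral>\<^sup>+s. ?c s * (ennreal (?n s u) * F u) \<partial>lborel \<partial>lborel)"
    by (rule lborel_pair.Fubini') (simp add: case_prod_beta)
  also have "\<dots> = (\<integral>\<^sup>+u. ennreal (r / (pi * (r\<^sup>2 + u\<^sup>2))) * F u \<partial>lborel)"
  proof (rule nn_integral_cong)
    fix u :: real
    have "(\<integral>\<^sup>+s. ?c s * (ennreal (?n s u) * F u) \<partial>lborel) = (\<integral>\<^sup>+s. ?c s * ennreal (?n s u) \<partial>lborel) * F u"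
    proof -
      have "(\<integral>\<^sup>+s. ?c s * ennreal (?n s u) * F u \<partial>lborel) = (\<integral>\<^sup>+s. ?c s * ennreal (?n s u) \<partial>lborel) * F u"
        by (rule nn_integral_multc) measurable
      then show ?thesis by (simp only: mult.assoc)
    qed
    \<comment> \<open>The subordination formula once more, now at type \<open>real\<close>, where
      \<open>Basis\<close> has the single element 1.\<close>
    also have "(\<integral>\<^sup>+s. ?c s * ennreal (?n s u) \<partial>lborel) = ennreal (cauchy_kernel r 0 u)"
      using cauchy_kernel_subordination[OF r, of u] by simp
    also have "cauchy_kernel r 0 u = r / (pi * (r\<^sup>2 + u\<^sup>2))"
    proof -
      have *: "(real DIM(real) + 1) / 2 = 1" "- (real DIM(real) + 1) / 2 = -1" by simp_all
      have "pi powr (-1) = 1 / pi" by (rule powr_neg_one) simp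
      then show ?thesis
        unfolding cauchy_kernel_def cauchy_const_def * by (simp add: powr_one field_simps)
    qed
    finally show "(\<integral>\<^sup>+s. ?c s * (ennreal (?n s u) * F u) \<partial>lborel) = ennreal (r / (pi * (r\<^sup>2 + u\<^sup>2))) * F u" .
  qed
  finally show ?thesis .
qed

section \<open>Mass, tail and truncated first moment of the Cauchy kernel\<close>

lemma nn_integral_inverse_1_plus_square:
  "(\<integral>\<^sup>+(x::real). ennreal (inverse (1 + x\<^sup>2)) \<partial>lborel) = ennreal pi"
proof -
  have "integrable lborel (\<lambda>x::real. inverse (1 + x\<^sup>2))"
    using integrable_inverse_1_plus_square by (simp add: set_integrable_def)
  moreover have "(\<integral>(x::real). inverse (1 + x\<^sup>2) \<partial>lborel) = pi"
    using LBINT_inverse_1_plus_square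
    by (simp add: interval_lebesgue_integral_def set_lebesgue_integral_def)
  ultimately show ?thesis by (subst nn_integral_eq_integral) (auto intro!: AE_I2)
qed

lemma nn_integral_cauchy_density:
  assumes r: "0 < (r::real)"
  shows "(\<integral>\<^sup>+u. ennreal (r / (pi * (r\<^sup>2 + u\<^sup>2))) \<partial>lborel) = 1"
proof -
  have "(\<integral>\<^sup>+u. ennreal (r / (pi * (r\<^sup>2 + u\<^sup>2))) \<partial>lborel)
      = ennreal \<bar>r\<bar> * (\<integral>\<^sup>+u. ennreal (r / (pi * (r\<^sup>2 + (0 + r * u)\<^sup>2))) \<partial>lborel)"
    using r by (intro nn_integral_real_affine) auto
  also have "(\<integral>\<^sup>+u. ennreal (r / (pi * (r\<^sup>2 + (0 + r * u)\<^sup>2))) \<partial>lborel)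
      = (\<integral>\<^sup>+u. ennreal (1 / (pi * r)) * ennreal (inverse (1 + u\<^sup>2)) \<partial>lborel)"
  proof (rule nn_integral_cong)
    fix u :: real
    have "r\<^sup>2 + (0 + r * u)\<^sup>2 = r * r * (1 + u\<^sup>2)" by (simp add: power2_eq_square algebra_simps)
    then have "r / (pi * (r\<^sup>2 + (0 + r * u)\<^sup>2)) = 1 / (pi * r) * inverse (1 + u\<^sup>2)"
      using r by (simp add: divide_inverse)
    then show "ennreal (r / (pi * (r\<^sup>2 + (0 + r * u)\<^sup>2))) = ennreal (1 / (pi * r)) * ennreal (inverse (1 + u\<^sup>2))"
      using r by (metis ennreal_mult' divide_nonneg_nonneg mult_nonneg_nonneg less_imp_le pi_ge_zero zero_le_one)
  qed
  also have "\<dots> = ennreal (1 / (pi * r)) * ennreal pi"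
    by (subst nn_integral_cmult) (auto simp: nn_integral_inverse_1_plus_square)
  also have "ennreal \<bar>r\<bar> * \<dots> = ennreal (r * (1 / (pi * r) * pi))"
    using r by (simp add: ennreal_mult'[symmetric])
  also have "\<dots> = 1" using r by simp
  finally show ?thesis .
qed

text \<open>The marginal identity with \<open>F = 1\<close> reduces the mass in every dimension to
  the arctangent integral.\<close>

lemma nn_integral_cauchy_kernel_0:
  assumes r: "0 < r"
  shows "(\<integral>\<^sup>+(h::'a::euclidean_space). ennreal (cauchy_kernel r 0 h) \<partial>lborel) = 1"
proof -
  obtain b :: 'a where b: "b \<in> Basis" using nonempty_Basis by blast
  have "(\<integral>\<^sup>+(h::'a). ennreal (cauchy_kernel r 0 h) * 1 \<partial>lborel) = (\<integral>\<^sup>+u. ennreal (r / (pi * (r\<^sup>2 + u\<^sup>2))) * 1 \<partial>lborel)"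
    using b by (intro cauchy_kernel_marginal[OF r, where e=b and F="\<lambda>_. 1"]) auto
  then show ?thesis using nn_integral_cauchy_density[OF r] by simp
qed

lemma cauchy_kernel_commute: "cauchy_kernel t x (y::'a::euclidean_space) = cauchy_kernel t y x"
  unfolding cauchy_kernel_def by (simp add: norm_minus_commute)

lemma nn_integral_cauchy_kernel_translate:
  fixes F :: "'a::euclidean_space \<Rightarrow> ennreal"
  assumes [measurable]: "F \<in> borel_measurable borel"
  shows "(\<integral>\<^sup>+y. ennreal (cauchy_kernel r x y) * F y \<partial>lborel) = (\<integral>\<^sup>+h. ennreal (cauchy_kernel r 0 h) * F (x + h) \<partial>lborel)"
proof -
  have "(\<integral>\<^sup>+h. ennreal (cauchy_kernel r x (x + h)) * F (x + h) \<partial>lborel) = (\<integral>\<^sup>+y. ennreal (cauchy_kernel r x y) * F y \<partial>lborel)"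
    by (rule nn_integral_lborel_translate) auto
  then show ?thesis by (simp add: cauchy_kernel_diff[of r x])
qed

lemma nn_integral_cauchy_kernel:
  assumes "0 < r"
  shows "(\<integral>\<^sup>+(y::'a::euclidean_space). ennreal (cauchy_kernel r x y) \<partial>lborel) = 1"
    and "(\<integral>\<^sup>+(x::'a::euclidean_space). ennreal (cauchy_kernel r x y) \<partial>lborel) = 1"
proof -
  show *: "(\<integral>\<^sup>+(y::'a). ennreal (cauchy_kernel r x y) \<partial>lborel) = 1" for x
    using nn_integral_cauchy_kernel_translate[of "\<lambda>_. 1" r x] nn_integral_cauchy_kernel_0[OF assms, where 'a='a] by simp
  show "(\<integral>\<^sup>+(x::'a). ennreal (cauchy_kernel r x y) \<partial>lborel) = 1"
    using *[of y] by (subst cauchy_kernel_commute)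
qed

text \<open>The indicator is dominated by a sum over coordinates of
  \<open>min 1 ((h \<bullet> b)\<^sup>2)\<close>, so only one-dimensional marginals enter; each
  coordinate contributes at most 2r.\<close>

lemma cauchy_kernel_tail:
  assumes r: "0 < r"
  shows "(\<integral>\<^sup>+(h::'a::euclidean_space). ennreal (cauchy_kernel r 0 h) * indicator {h. 1 \<le> norm h} h \<partial>lborel)
    \<le> ennreal (2 * real DIM('a) * r)"
proof -
  have ptw: "indicator {h. 1 \<le> norm h} h \<le> (\<Sum>b\<in>Basis. ennreal (min 1 ((h \<bullet> b)\<^sup>2)))" for h :: 'a
  proof (cases "1 \<le> norm h")
    case True
    then have "1 \<le> (norm h)\<^sup>2" by (simp add: abs_le_square_iff[of 1, simplified, symmetric])
    also have "(norm h)\<^sup>2 = (\<Sum>b\<in>Basis. (h \<bullet> b)\<^sup>2)"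
      by (subst power2_norm_eq_inner, subst euclidean_inner) (simp only: power2_eq_square)
    finally have S: "1 \<le> (\<Sum>b\<in>Basis. (h \<bullet> b)\<^sup>2)" .
    have "1 \<le> (\<Sum>b\<in>Basis. min 1 ((h \<bullet> b)\<^sup>2))"
    proof (cases "\<exists>b\<in>Basis. 1 < (h \<bullet> b)\<^sup>2")
      case True
      then obtain b where b: "b \<in> Basis" "1 < (h \<bullet> b)\<^sup>2" by blast
      have "min 1 ((h \<bullet> b)\<^sup>2) \<le> (\<Sum>b\<in>Basis. min 1 ((h \<bullet> b)\<^sup>2))"
        using b by (intro member_le_sum) auto
      with b show ?thesis by simp
    next
      case False
      then have "(\<Sum>b\<in>Basis. min 1 ((h \<bullet> b)\<^sup>2)) = (\<Sum>b\<in>Basis. (h \<bullet> b)\<^sup>2)"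
        by (intro sum.cong) auto
      with S show ?thesis by simp
    qed
    then have "1 \<le> ennreal (\<Sum>b\<in>Basis. min 1 ((h \<bullet> b)\<^sup>2))" by simp
    also have "\<dots> = (\<Sum>b\<in>Basis. ennreal (min 1 ((h \<bullet> b)\<^sup>2)))" by (rule sum_ennreal[symmetric]) simp
    finally show ?thesis using True by simp
  qed simp
  have one: "(\<integral>\<^sup>+(h::'a). ennreal (cauchy_kernel r 0 h) * ennreal (min 1 ((h \<bullet> b)\<^sup>2)) \<partial>lborel) \<le> ennreal (2 * r)"
    if b: "b \<in> Basis" for b
  proof -
    have "(\<integral>\<^sup>+(h::'a). ennreal (cauchy_kernel r 0 h) * ennreal (min 1 ((h \<bullet> b)\<^sup>2)) \<partial>lborel)
      = (\<integral>\<^sup>+u. ennreal (r / (pi * (r\<^sup>2 + u\<^sup>2))) * ennreal (min 1 (u\<^sup>2)) \<partial>lborel)"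
      using b by (intro cauchy_kernel_marginal[OF r, where e=b and F="\<lambda>u. ennreal (min 1 (u\<^sup>2))"]) auto
    also have "\<dots> \<le> (\<integral>\<^sup>+u. ennreal (2 * r / pi) * ennreal (inverse (1 + u\<^sup>2)) \<partial>lborel)"
    proof (rule nn_integral_mono)
      fix u :: real
      have p: "0 < r\<^sup>2 + u\<^sup>2" "0 < 1 + u\<^sup>2" using r by (simp_all add: add_pos_nonneg)
      \<comment> \<open>Compares the truncated square against the density of scale r with the
        density of scale 1, uniformly in r; only the prefactor r remains.\<close>
      have q: "min 1 (u\<^sup>2) * (1 + u\<^sup>2) \<le> 2 * (r\<^sup>2 + u\<^sup>2)"
      proof (cases "u\<^sup>2 \<le> 1")
        case True
        then have "u\<^sup>2 * u\<^sup>2 \<le> u\<^sup>2 * 1" by (intro mult_left_mono) auto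
        with True show ?thesis by (simp add: algebra_simps add_increasing)
      next
        case False
        then have "1 + u\<^sup>2 \<le> 2 * u\<^sup>2" by simp
        also have "\<dots> \<le> 2 * (r\<^sup>2 + u\<^sup>2)" by simp
        finally show ?thesis using False by simp
      qed
      have "r / (pi * (r\<^sup>2 + u\<^sup>2)) * min 1 (u\<^sup>2) = (r / pi) * (min 1 (u\<^sup>2) / (r\<^sup>2 + u\<^sup>2))" by simp
      also have "\<dots> \<le> (r / pi) * (2 / (1 + u\<^sup>2))"
        using q p r by (intro mult_left_mono) (simp_all add: divide_simps mult.commute)
      finally have "r / (pi * (r\<^sup>2 + u\<^sup>2)) * min 1 (u\<^sup>2) \<le> 2 * r / pi * inverse (1 + u\<^sup>2)"
        by (simp add: divide_inverse mult_ac)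
      then show "ennreal (r / (pi * (r\<^sup>2 + u\<^sup>2))) * ennreal (min 1 (u\<^sup>2)) \<le> ennreal (2 * r / pi) * ennreal (inverse (1 + u\<^sup>2))"
        using r p by (subst (1 2) ennreal_mult'[symmetric]) (auto intro!: ennreal_leI)
    qed
    also have "\<dots> = ennreal (2 * r / pi) * ennreal pi"
      by (subst nn_integral_cmult) (auto simp: nn_integral_inverse_1_plus_square)
    also have "\<dots> = ennreal (2 * r)" using r by (subst ennreal_mult'[symmetric]) auto
    finally show ?thesis .
  qed
  have "(\<integral>\<^sup>+(h::'a). ennreal (cauchy_kernel r 0 h) * indicator {h. 1 \<le> norm h} h \<partial>lborel)
     \<le> (\<integral>\<^sup>+(h::'a). ennreal (cauchy_kernel r 0 h) * (\<Sum>b\<in>Basis. ennreal (min 1 ((h \<bullet> b)\<^sup>2))) \<partial>lborel)"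
    by (intro nn_integral_mono mult_left_mono ptw) simp
  also have "\<dots> = (\<Sum>b\<in>Basis. \<integral>\<^sup>+(h::'a). ennreal (cauchy_kernel r 0 h) * ennreal (min 1 ((h \<bullet> b)\<^sup>2)) \<partial>lborel)"
    unfolding sum_distrib_left by (rule nn_integral_sum) measurable
  also have "\<dots> \<le> (\<Sum>b\<in>(Basis::'a set). ennreal (2 * r))" by (rule sum_mono) (rule one)
  also have "\<dots> = ennreal (2 * real DIM('a) * r)"
    using r by (simp add: ennreal_of_nat_eq_real_of_nat ennreal_mult'[symmetric] mult_ac)
  finally show ?thesis .
qed

text \<open>On each half of the interval the integrand has the primitive r/(2 pi) ln(r^2 + u^2) up
  to sign. The cut at 1 is essential: the first absolute moment of a Cauchy law is infinite.\<close>

lemma nn_integral_abs_cauchy_density: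
  assumes r: "0 < (r::real)"
  shows "(\<integral>\<^sup>+u. ennreal (r / (pi * (r\<^sup>2 + u\<^sup>2))) * ennreal (\<bar>u\<bar> * indicator {-1..1} u) \<partial>lborel)
    \<le> ennreal (r / pi * (ln (r\<^sup>2 + 1) - ln (r\<^sup>2)))"
proof -
  let ?f = "\<lambda>u. r / pi * u / (r\<^sup>2 + u\<^sup>2)"
  let ?F = "\<lambda>u. r / (2 * pi) * ln (r\<^sup>2 + u\<^sup>2)"
  have p: "0 < r\<^sup>2 + u\<^sup>2" for u using r by (simp add: add_pos_nonneg)
  have L: "ln (r\<^sup>2) \<le> ln (r\<^sup>2 + 1)"
    using r by (subst ln_le_cancel_iff) (auto simp: add_pos_nonneg)
  have D: "DERIV ?F u :> ?f u" for u
    using p[of u] by (auto intro!: derivative_eq_intros simp: divide_simps)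
  have 1: "(\<integral>\<^sup>+u. ennreal (?f u) * indicator {0..1} u \<partial>lborel) = ennreal (?F 1 - ?F 0)"
    using r by (intro nn_integral_FTC_Icc D) (auto intro!: divide_nonneg_pos p)
  have 2: "(\<integral>\<^sup>+u. ennreal (- ?f u) * indicator {-1..0} u \<partial>lborel) = ennreal (- ?F 0 - (- ?F (-1)))"
  proof (rule nn_integral_FTC_Icc[where F="\<lambda>u. - ?F u"])
    show "DERIV (\<lambda>u. - ?F u) u :> - ?f u" for u by (rule DERIV_minus[OF D])
    fix u :: real assume "u \<in> {-1..0}"
    then have "r / pi * u \<le> 0" using r by (simp add: mult_nonneg_nonpos divide_nonpos_pos)
    then show "0 \<le> - ?f u" using divide_nonpos_pos[OF _ p] by (subst neg_0_le_iff_le) blast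
  qed auto
  have "(\<integral>\<^sup>+u. ennreal (r / (pi * (r\<^sup>2 + u\<^sup>2))) * ennreal (\<bar>u\<bar> * indicator {-1..1} u) \<partial>lborel)
    \<le> (\<integral>\<^sup>+u. ennreal (?f u) * indicator {0..1} u + ennreal (- ?f u) * indicator {-1..0} u \<partial>lborel)"
  proof (rule nn_integral_mono)
    fix u :: real
    have *: "ennreal (r / (pi * (r\<^sup>2 + u\<^sup>2))) * ennreal \<bar>u\<bar> = ennreal (if 0 \<le> u then ?f u else - ?f u)"
      using r p[of u] by (subst ennreal_mult'[symmetric]) (auto simp: mult_ac)
    then show "ennreal (r / (pi * (r\<^sup>2 + u\<^sup>2))) * ennreal (\<bar>u\<bar> * indicator {-1..1} u)
      \<le> ennreal (?f u) * indicator {0..1} u + ennreal (- ?f u) * indicator {-1..0} u"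
      by (auto simp: indicator_def)
  qed
  also have "\<dots> = ennreal (?F 1 - ?F 0) + ennreal (- ?F 0 - (- ?F (-1)))"
    unfolding 1[symmetric] 2[symmetric] by (rule nn_integral_add) measurable
  also have "\<dots> = ennreal (?F 1 - ?F 0 + (- ?F 0 - (- ?F (-1))))"
    using r L by (subst ennreal_plus) (auto intro!: mult_left_mono divide_right_mono)
  also have "?F 1 - ?F 0 + (- ?F 0 - (- ?F (-1))) = r / pi * (ln (r\<^sup>2 + 1) - ln (r\<^sup>2))"
    by (simp add: field_simps)
  finally show ?thesis .
qed

text \<open>By Cauchy-Schwarz the unit ball lies in the slab where the component along v/|v| has
  modulus at most 1, and on the slab the marginal applies. Then ln(r^2 + 1) is at most ln 2, and -
  ln(r^2) is 2 ln(1/r); the resulting factor 2 is halved when passing to the heat content.\<close>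

lemma cauchy_kernel_first_moment:
  fixes v :: "'a::euclidean_space"
  assumes r: "0 < r" "r \<le> 1"
  shows "(\<integral>\<^sup>+h. ennreal (cauchy_kernel r 0 h * indicator (ball 0 1) h) * ennreal \<bar>h \<bullet> v\<bar> \<partial>lborel)
    \<le> ennreal (r / pi * (2 * ln (1 / r) + ln 2)) * ennreal (norm v)"
proof (cases "v = 0")
  case False
  define e where "e = v /\<^sub>R norm v"
  have e: "norm e = 1" using False by (simp add: e_def)
  have v: "v = norm v *\<^sub>R e" using False by (simp add: e_def)
  have "(\<integral>\<^sup>+h. ennreal (cauchy_kernel r 0 h * indicator (ball 0 1) h) * ennreal \<bar>h \<bullet> v\<bar> \<partial>lborel)
    \<le> (\<integral>\<^sup>+h. ennreal (norm v) * (ennreal (cauchy_kernel r 0 h) * ennreal (\<bar>h \<bullet> e\<bar> * indicator {-1..1} (h \<bullet> e))) \<partial>lborel)"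
  proof (rule nn_integral_mono)
    fix h :: 'a
    have "\<bar>h \<bullet> v\<bar> = norm v * \<bar>h \<bullet> e\<bar>" by (subst v) (simp add: abs_mult)
    moreover have "\<bar>h \<bullet> e\<bar> \<le> 1" if "norm h < 1"
      using Cauchy_Schwarz_ineq2[of h e] e that by simp
    ultimately show "ennreal (cauchy_kernel r 0 h * indicator (ball 0 1) h) * ennreal \<bar>h \<bullet> v\<bar>
      \<le> ennreal (norm v) * (ennreal (cauchy_kernel r 0 h) * ennreal (\<bar>h \<bullet> e\<bar> * indicator {-1..1} (h \<bullet> e)))"
      by (auto simp: indicator_def ennreal_mult' mult_ac)
  qed
  also have "\<dots> = ennreal (norm v) * (\<integral>\<^sup>+u. ennreal (r / (pi * (r\<^sup>2 + u\<^sup>2))) * ennreal (\<bar>u\<bar> * indicator {-1..1} u) \<partial>lborel)"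
    by (subst nn_integral_cmult, measurable)
       (subst cauchy_kernel_marginal[OF r(1) e, where F="\<lambda>u. ennreal (\<bar>u\<bar> * indicator {-1..1} u)"], auto)
  also have "\<dots> \<le> ennreal (norm v) * ennreal (r / pi * (ln (r\<^sup>2 + 1) - ln (r\<^sup>2)))"
    by (intro mult_left_mono nn_integral_abs_cauchy_density r) simp
  also have "\<dots> \<le> ennreal (norm v) * ennreal (r / pi * (2 * ln (1 / r) + ln 2))"
  proof (intro mult_left_mono ennreal_leI)
    have "r\<^sup>2 \<le> 1" using r by (simp add: power_le_one)
    then have "ln (r\<^sup>2 + 1) \<le> ln 2" by (subst ln_le_cancel_iff) (auto simp: add_nonneg_pos)
    moreover have "ln (r\<^sup>2) = - (2 * ln (1 / r))" using r by (simp add: ln_realpow ln_div)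
    ultimately show "ln (r\<^sup>2 + 1) - ln (r\<^sup>2) \<le> 2 * ln (1 / r) + ln 2" by linarith
  qed (use r in auto)
  finally show ?thesis by (simp add: mult.commute)
qed simp

subsection \<open>Mollification and the perimeter\<close>

text \<open>Dominated convergence. The bilinear map \<open>p\<close> lets one statement serve the
  gradient of the mollified indicator, the partial derivatives of the mollified test field, and its
  divergence.\<close>

lemma convolution_continuous:
  fixes k :: "'a::euclidean_space \<Rightarrow> 'c::euclidean_space" and g :: "'a \<Rightarrow> 'd::euclidean_space"
    and p :: "'c \<Rightarrow> 'd \<Rightarrow> 'e::euclidean_space"
  assumes p: "bounded_bilinear p" and k: "continuous_on UNIV k" "\<And>y. norm (k y) \<le> B"
    and g: "integrable lborel g"
  shows "continuous_on UNIV (\<lambda>x. \<integral>z. p (k (z - x)) (g z) \<partial>lborel)"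
proof (rule continuous_at_imp_continuous_on, intro ballI)
  fix x
  obtain K where K: "\<And>a b. norm (p a b) \<le> norm a * norm b * K" "0 \<le> K"
    using bounded_bilinear.nonneg_bounded[OF p] by blast
  have B: "0 \<le> B" using k(2)[of 0] norm_ge_zero order_trans by blast
  have [measurable]: "k \<in> borel_measurable borel" using k(1) by (rule borel_measurable_continuous_onI)
  have [measurable]: "g \<in> borel_measurable borel" using g by simp
  have [measurable]: "(\<lambda>x. p (u x) (v x)) \<in> borel_measurable borel"
    if [measurable]: "u \<in> borel_measurable borel" "v \<in> borel_measurable borel" for u :: "'a \<Rightarrow> 'c" and v
    by (rule borel_measurable_continuous_Pair[OF that])
       (intro continuous_intros bounded_bilinear.continuous_on[OF p])
  show "isCont (\<lambda>x. \<integral>z. p (k (z - x)) (g z) \<partial>lborel) x"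
    unfolding continuous_at_sequentially comp_def
  proof (intro allI impI)
    fix X assume X: "X \<longlonglongrightarrow> x"
    show "(\<lambda>n. \<integral>z. p (k (z - X n)) (g z) \<partial>lborel) \<longlonglongrightarrow> (\<integral>z. p (k (z - x)) (g z) \<partial>lborel)"
    proof (rule integral_dominated_convergence)
      show "integrable lborel (\<lambda>z. B * K * norm (g z))" using g by simp
      show "AE z in lborel. norm (p (k (z - X n)) (g z)) \<le> B * K * norm (g z)" for n
      proof (rule AE_I2)
        fix z
        have "norm (p (k (z - X n)) (g z)) \<le> norm (k (z - X n)) * norm (g z) * K" by (rule K)
        also have "\<dots> \<le> B * norm (g z) * K" using k(2) K(2) by (intro mult_right_mono) auto
        finally show "norm (p (k (z - X n)) (g z)) \<le> B * K * norm (g z)" by (simp add: mult_ac)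
      qed
      show "AE z in lborel. (\<lambda>n. p (k (z - X n)) (g z)) \<longlonglongrightarrow> p (k (z - x)) (g z)"
      proof (rule AE_I2)
        fix z
        have "isCont k (z - x)" using k(1) by (simp add: continuous_on_eq_continuous_at)
        then have "(\<lambda>n. k (z - X n)) \<longlonglongrightarrow> k (z - x)"
          by (rule isCont_tendsto_compose) (intro tendsto_intros X)
        then show "(\<lambda>n. p (k (z - X n)) (g z)) \<longlonglongrightarrow> p (k (z - x)) (g z)"
          by (intro bounded_bilinear.tendsto[OF p] tendsto_const)
      qed
    qed simp_all
  qed
qed

text \<open>The square of the positive part is continuously differentiable with a derivative that is
  Lipschitz of constant 2; this is its first-order Taylor estimate.\<close>

lemma pos_part_square_remainder:
  fixes a b :: real
  shows "\<bar>(max 0 b)\<^sup>2 - (max 0 a)\<^sup>2 - 2 * max 0 a * (b - a)\<bar> \<le> (b - a)\<^sup>2"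
proof -
  consider "0 \<le> a" "0 \<le> b" | "0 \<le> a" "b < 0" | "a < 0" "0 \<le> b" | "a < 0" "b < 0" by linarith
  then show ?thesis
  proof cases
    case 1
    then have "(max 0 b)\<^sup>2 - (max 0 a)\<^sup>2 - 2 * max 0 a * (b - a) = (b - a)\<^sup>2"
      by (simp add: power2_eq_square algebra_simps)
    then show ?thesis by simp
  next
    case 2
    then have "(max 0 b)\<^sup>2 - (max 0 a)\<^sup>2 - 2 * max 0 a * (b - a) = a * a - 2 * (a * b)"
      by (simp add: power2_eq_square algebra_simps)
    moreover have "a * b \<le> 0" using 2 by (simp add: mult_le_0_iff)
    moreover have "(b - a)\<^sup>2 = b * b + a * a - 2 * (a * b)" by (simp add: power2_eq_square algebra_simps)
    moreover have "0 \<le> a * a" "0 \<le> b * b" by simp_all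
    ultimately show ?thesis by linarith
  next
    case 3
    then have "b * b \<le> (b - a) * (b - a)" by (intro mult_mono) auto
    with 3 show ?thesis by (simp add: power2_eq_square)
  qed simp
qed

text \<open>A mollifier of radius \<epsilon>, where \<open>G\<close> plays the role of its gradient.
  Regularity is demanded as a first-order Taylor estimate with one quadratic constant
  \<open>L\<close> for all points; integrated against any integrable function, it differentiates a
  convolution directly. The kernel will be evaluated at \<open>z - x\<close>, which puts a minus
  sign in front of every derivative in \<open>x\<close>.\<close>

locale smooth_kernel =
  fixes \<eta> :: "'a::euclidean_space \<Rightarrow> real" and G :: "'a \<Rightarrow> 'a" and B L \<epsilon> :: real
  assumes eta_cont: "continuous_on UNIV \<eta>" and G_cont: "continuous_on UNIV G"
    and eta_nonneg: "\<And>x. 0 \<le> \<eta> x" and eta_bound: "\<And>x. \<eta> x \<le> B" and G_bound: "\<And>x. norm (G x) \<le> B"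
    and eta_supp: "\<And>x. \<epsilon> \<le> norm x \<Longrightarrow> \<eta> x = 0" and G_supp: "\<And>x. \<epsilon> \<le> norm x \<Longrightarrow> G x = 0"
    and eta_even: "\<And>x. \<eta> (- x) = \<eta> x" and G_odd: "\<And>x. G (- x) = - G x"
    and remainder: "\<And>x v. norm v \<le> 1 \<Longrightarrow> \<bar>\<eta> (x + v) - \<eta> x - G x \<bullet> v\<bar> \<le> L * (norm v)\<^sup>2"
    and eta_mass: "(\<integral>\<^sup>+x. ennreal (\<eta> x) \<partial>lborel) = 1"
begin

lemma eta_measurable[measurable]: "\<eta> \<in> borel_measurable borel"
  using eta_cont by (rule borel_measurable_continuous_onI)

lemma G_measurable[measurable]: "G \<in> borel_measurable borel"
  using G_cont by (rule borel_measurable_continuous_onI)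

lemma B_nonneg: "0 \<le> B"
  using eta_nonneg[of 0] eta_bound[of 0] by linarith

lemma L_nonneg: "0 \<le> L"
proof -
  obtain b :: 'a where "b \<in> Basis" using nonempty_Basis by blast
  then show ?thesis using remainder[of b 0] by (simp add: order_trans[OF abs_ge_zero])
qed

lemma integrable_eta: "integrable lborel g \<Longrightarrow> integrable lborel (\<lambda>z. \<eta> (z - x) *\<^sub>R (g z :: 'b::euclidean_space))"
proof -
  assume g: "integrable lborel g"
  then have [measurable]: "g \<in> borel_measurable borel" by simp
  show ?thesis
  proof (rule Bochner_Integration.integrable_bound)
    show "integrable lborel (\<lambda>z. B *\<^sub>R g z)" using g by simp
    show "AE z in lborel. norm (\<eta> (z - x) *\<^sub>R g z) \<le> norm (B *\<^sub>R g z)"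
      using eta_nonneg eta_bound B_nonneg by (auto intro!: AE_I2 mult_right_mono)
  qed simp
qed

lemma integrable_G: "integrable lborel g \<Longrightarrow> integrable lborel (\<lambda>z. (G (z - x) \<bullet> v) *\<^sub>R (g z :: 'b::euclidean_space))"
proof -
  assume g: "integrable lborel g"
  then have [measurable]: "g \<in> borel_measurable borel" by simp
  have *: "\<bar>G y \<bullet> v\<bar> \<le> B * norm v" for y
    by (rule order_trans[OF Cauchy_Schwarz_ineq2]) (intro mult_right_mono G_bound norm_ge_zero)
  show ?thesis
  proof (rule Bochner_Integration.integrable_bound)
    show "integrable lborel (\<lambda>z. (B * norm v) *\<^sub>R g z)" using g by simp
    show "AE z in lborel. norm ((G (z - x) \<bullet> v) *\<^sub>R g z) \<le> norm ((B * norm v) *\<^sub>R g z)"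
      using * B_nonneg by (auto intro!: AE_I2 mult_right_mono)
  qed simp
qed

text \<open>The Taylor remainder of the kernel is uniform in its base point, so integrating it
  against \<open>g\<close> leaves a remainder of at most \<open>L\<close> times the L1 norm of
  \<open>g\<close> times the squared increment.\<close>

lemma convolution_has_derivative:
  fixes g :: "'a \<Rightarrow> 'b::euclidean_space"
  assumes g: "integrable lborel g"
  shows "((\<lambda>x. \<integral>z. \<eta> (z - x) *\<^sub>R g z \<partial>lborel) has_derivative
     (\<lambda>v. - (\<integral>z. (G (z - x) \<bullet> v) *\<^sub>R g z \<partial>lborel))) (at x)"
  unfolding has_derivative_at_alt
proof (intro conjI allI impI)
  let ?D = "\<lambda>v. - (\<integral>z. (G (z - x) \<bullet> v) *\<^sub>R g z \<partial>lborel)"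
  have [measurable]: "g \<in> borel_measurable borel" using g by simp
  have "linear ?D"
    by (rule linearI) (simp_all add: inner_add_right scaleR_add_left integrable_G[OF g]
       scaleR_scaleR[symmetric] del: scaleR_scaleR)
  then show "bounded_linear ?D" by (rule linear_conv_bounded_linear[THEN iffD1])
  define M where "M = (\<integral>z. norm (g z) \<partial>lborel)"
  have M: "0 \<le> M" unfolding M_def by (rule Bochner_Integration.integral_nonneg) simp
  have rem: "norm ((\<integral>z. \<eta> (z - y) *\<^sub>R g z \<partial>lborel) - (\<integral>z. \<eta> (z - x) *\<^sub>R g z \<partial>lborel) - ?D (y - x))
      \<le> L * M * (norm (y - x))\<^sup>2" if "norm (y - x) \<le> 1" for y
  proof -
    have "(\<integral>z. \<eta> (z - y) *\<^sub>R g z \<partial>lborel) - (\<integral>z. \<eta> (z - x) *\<^sub>R g z \<partial>lborel) - ?D (y - x)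
      = (\<integral>z. \<eta> (z - y) *\<^sub>R g z - \<eta> (z - x) *\<^sub>R g z + (G (z - x) \<bullet> (y - x)) *\<^sub>R g z \<partial>lborel)"
      using integrable_eta[OF g] integrable_G[OF g] by simp
    also have "\<dots> = (\<integral>z. (\<eta> (z - y) - \<eta> (z - x) + G (z - x) \<bullet> (y - x)) *\<^sub>R g z \<partial>lborel)"
      by (simp only: scaleR_add_left scaleR_diff_left)
    also have "norm \<dots> \<le> (\<integral>z. (L * (norm (y - x))\<^sup>2) * norm (g z) \<partial>lborel)"
    proof (rule order_trans[OF Bochner_Integration.integral_norm_bound integral_mono'])
      fix z
      have "\<bar>\<eta> (z - y) - \<eta> (z - x) + G (z - x) \<bullet> (y - x)\<bar> \<le> L * (norm (y - x))\<^sup>2"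
        \<comment> \<open>Moving \<open>x\<close> to \<open>y\<close> moves the kernel argument
          \<open>z - x\<close> by \<open>x - y\<close>.\<close>
        using remainder[of "x - y" "z - x"] that by (simp add: norm_minus_commute inner_diff_right algebra_simps)
      then show "norm ((\<eta> (z - y) - \<eta> (z - x) + G (z - x) \<bullet> (y - x)) *\<^sub>R g z) \<le> L * (norm (y - x))\<^sup>2 * norm (g z)"
        by (simp add: mult_right_mono)
    qed (use g L_nonneg in auto)
    also have "\<dots> = L * M * (norm (y - x))\<^sup>2" by (simp add: M_def)
    finally show ?thesis .
  qed
  fix e :: real assume e: "0 < e"
  \<comment> \<open>The cap 1 is the range in which the Taylor estimate holds; the summand 1 in the
    denominator covers the case \<open>L * M = 0\<close>.\<close>
  define d where "d = min 1 (e / (L * M + 1))"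
  have LM: "0 \<le> L * M" using L_nonneg M by simp
  have d: "0 < d" using e LM by (simp add: d_def)
  have "norm ((\<integral>z. \<eta> (z - y) *\<^sub>R g z \<partial>lborel) - (\<integral>z. \<eta> (z - x) *\<^sub>R g z \<partial>lborel) - ?D (y - x)) \<le> e * norm (y - x)"
    if y: "norm (y - x) < d" for y
  proof -
    have "L * M * norm (y - x) \<le> (L * M + 1) * d"
      using LM y by (intro mult_mono) auto
    also have "\<dots> \<le> (L * M + 1) * (e / (L * M + 1))" using LM by (intro mult_left_mono) (auto simp: d_def)
    also have "\<dots> = e" using LM by simp
    finally have "L * M * norm (y - x) * norm (y - x) \<le> e * norm (y - x)" by (rule mult_right_mono) simp
    then show ?thesis using rem[of y] y by (simp add: d_def power2_eq_square mult.assoc)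
  qed
  with d show "\<exists>d>0. \<forall>y. norm (y - x) < d \<longrightarrow>
    norm ((\<integral>z. \<eta> (z - y) *\<^sub>R g z \<partial>lborel) - (\<integral>z. \<eta> (z - x) *\<^sub>R g z \<partial>lborel) - ?D (y - x)) \<le> e * norm (y - x)"
    by blast
qed

end

text \<open>A truncated polynomial is smooth enough here: continuously differentiable with Lipschitz
  gradient, which is all that \<open>smooth_kernel\<close> asks for. It needs normalising to mass
  one.\<close>

definition bump :: "real \<Rightarrow> 'a::euclidean_space \<Rightarrow> real" where
  "bump \<epsilon> x = (max 0 (\<epsilon>\<^sup>2 - (norm x)\<^sup>2))\<^sup>2"

definition bump_grad :: "real \<Rightarrow> 'a::euclidean_space \<Rightarrow> 'a" where
  "bump_grad \<epsilon> x = (- 4 * max 0 (\<epsilon>\<^sup>2 - (norm x)\<^sup>2)) *\<^sub>R x"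

text \<open>With a and b the values of \<epsilon>^2 - |.|^2 at x and x + v, the chain rule has inner
  part b - a = - 2 x . v - |v|^2. The squared-positive-part estimate costs (b - a)^2, at most (2
  \<epsilon> + 3)^2 |v|^2 when |x| is at most \<epsilon> + 1; the quadratic term of b - a costs at
  most 2 \<epsilon>^2 |v|^2. Farther out, x and x + v both lie outside the support.\<close>

lemma bump_remainder:
  fixes x v :: "'a::euclidean_space"
  assumes \<epsilon>: "0 < \<epsilon>" and v: "norm v \<le> 1"
  shows "\<bar>bump \<epsilon> (x + v) - bump \<epsilon> x - bump_grad \<epsilon> x \<bullet> v\<bar> \<le> ((2 * \<epsilon> + 3)\<^sup>2 + 2 * \<epsilon>\<^sup>2) * (norm v)\<^sup>2"
proof (cases "norm x \<le> \<epsilon> + 1")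
  case True
  define a where "a = \<epsilon>\<^sup>2 - (norm x)\<^sup>2"
  define b where "b = \<epsilon>\<^sup>2 - (norm (x + v))\<^sup>2"
  have ba: "b - a = - 2 * (x \<bullet> v) - (norm v)\<^sup>2"
    by (simp add: a_def b_def power2_norm_eq_inner inner_add_left inner_add_right inner_commute)
  have "\<bar>b - a\<bar> = \<bar>norm (x + v) - norm x\<bar> * (norm (x + v) + norm x)"
  proof -
    have "b - a = - ((norm (x + v) - norm x) * (norm (x + v) + norm x))"
      by (simp add: a_def b_def power2_eq_square algebra_simps)
    then show ?thesis by (simp add: abs_mult)
  qed
  also have "\<dots> \<le> norm v * (2 * \<epsilon> + 3)"
  proof (intro mult_mono)
    show "\<bar>norm (x + v) - norm x\<bar> \<le> norm v" using norm_triangle_ineq3[of "x + v" x] by simp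
    show "norm (x + v) + norm x \<le> 2 * \<epsilon> + 3" using norm_triangle_ineq[of x v] v True by linarith
  qed auto
  finally have "\<bar>b - a\<bar>\<^sup>2 \<le> (norm v * (2 * \<epsilon> + 3))\<^sup>2" by (rule power_mono) simp
  then have 1: "(b - a)\<^sup>2 \<le> (2 * \<epsilon> + 3)\<^sup>2 * (norm v)\<^sup>2" by (simp add: power_mult_distrib mult.commute)
  have "max 0 a \<le> \<epsilon>\<^sup>2" by (simp add: a_def)
  then have 2: "2 * max 0 a * (norm v)\<^sup>2 \<le> 2 * \<epsilon>\<^sup>2 * (norm v)\<^sup>2" by (intro mult_right_mono) auto
  have 0: "0 \<le> 2 * max 0 a * (norm v)\<^sup>2" by simp
  have "bump \<epsilon> (x + v) - bump \<epsilon> x - bump_grad \<epsilon> x \<bullet> v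
     = (max 0 b)\<^sup>2 - (max 0 a)\<^sup>2 - 2 * max 0 a * (b - a) - 2 * max 0 a * (norm v)\<^sup>2"
    unfolding ba bump_def bump_grad_def a_def[symmetric] b_def[symmetric] by (simp add: algebra_simps)
  then show ?thesis using pos_part_square_remainder[of b a] 1 2 0 by (simp only: distrib_right) linarith
next
  case False
  then have x: "\<epsilon> < norm x" "\<epsilon> < norm (x + v)" using v norm_triangle_ineq4[of "x + v" v] by auto
  then have "\<epsilon>\<^sup>2 < (norm x)\<^sup>2" "\<epsilon>\<^sup>2 < (norm (x + v))\<^sup>2" using \<epsilon> by (auto intro!: power_strict_mono)
  then show ?thesis by (simp add: bump_def bump_grad_def)
qed

lemma bump_nonneg: "0 \<le> bump \<epsilon> x"
  by (simp add: bump_def)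

lemma bump_supp: "0 < \<epsilon> \<Longrightarrow> \<epsilon> \<le> norm x \<Longrightarrow> max 0 (\<epsilon>\<^sup>2 - (norm x)\<^sup>2) = 0"
  using power_mono[of \<epsilon> "norm x" 2] by simp

lemma smooth_kernel_exists:
  assumes \<epsilon>: "0 < \<epsilon>"
  shows "\<exists>\<eta> G B L. smooth_kernel (\<eta> :: 'a::euclidean_space \<Rightarrow> real) G B L \<epsilon>"
proof -
  have cont: "continuous_on UNIV (bump \<epsilon> :: 'a \<Rightarrow> real)" "continuous_on UNIV (bump_grad \<epsilon> :: 'a \<Rightarrow> 'a)"
    unfolding bump_def bump_grad_def by (intro continuous_intros)+
  then have [measurable]: "(bump \<epsilon> :: 'a \<Rightarrow> real) \<in> borel_measurable borel"
    by (intro borel_measurable_continuous_onI)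
  have bnd: "bump \<epsilon> x \<le> (\<epsilon>\<^sup>2)\<^sup>2" for x :: 'a unfolding bump_def by (intro power_mono) auto
  have gbnd: "norm (bump_grad \<epsilon> x) \<le> 4 * \<epsilon>\<^sup>2 * \<epsilon>" for x :: 'a
  proof (cases "\<epsilon> \<le> norm x")
    case True
    then show ?thesis using \<epsilon> bump_supp[OF \<epsilon> True] by (simp add: bump_grad_def)
  next
    case False
    then show ?thesis using \<epsilon> unfolding bump_grad_def by (simp only: norm_scaleR abs_mult, intro mult_mono) auto
  qed
  define Z where "Z = (\<integral>(x::'a). bump \<epsilon> x \<partial>lborel)"
  have int: "integrable lborel (bump \<epsilon> :: 'a \<Rightarrow> real)"
    by (rule integrableI_bounded_set[where A="ball 0 \<epsilon>" and B="(\<epsilon>\<^sup>2)\<^sup>2"])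
       (use bnd bump_supp[OF \<epsilon>] in \<open>auto simp: bump_def emeasure_lborel_ball_finite[simplified] not_less intro!: AE_I2\<close>)
  \<comment> \<open>Positivity of the mass \<open>Z\<close>: on the ball of radius \<epsilon>/2 the
    difference \<epsilon>^2 - |x|^2 is at least (1 - 1/4) \<epsilon>^2.\<close>
  have "0 < (3 / 4 * \<epsilon>\<^sup>2)\<^sup>2 * measure lborel (ball (0::'a) (\<epsilon> / 2))"
    using \<epsilon> by (intro mult_pos_pos content_ball_pos) auto
  also have "\<dots> = (\<integral>x. (3 / 4 * \<epsilon>\<^sup>2)\<^sup>2 * indicator (ball (0::'a) (\<epsilon> / 2)) x \<partial>lborel)" by simp
  also have "\<dots> \<le> Z" unfolding Z_def
  proof (rule integral_mono')
    fix x :: 'a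
    have "(3 / 4 * \<epsilon>\<^sup>2)\<^sup>2 \<le> bump \<epsilon> x" if "norm x < \<epsilon> / 2"
    proof -
      have "(norm x)\<^sup>2 \<le> (\<epsilon> / 2)\<^sup>2" using that by (intro power_mono) auto
      then have "3 / 4 * \<epsilon>\<^sup>2 \<le> \<epsilon>\<^sup>2 - (norm x)\<^sup>2" by (simp add: power_divide)
      then have "3 / 4 * \<epsilon>\<^sup>2 \<le> max 0 (\<epsilon>\<^sup>2 - (norm x)\<^sup>2)" by (rule max.coboundedI2)
      then show ?thesis unfolding bump_def by (intro power_mono) auto
    qed
    then show "(3 / 4 * \<epsilon>\<^sup>2)\<^sup>2 * indicator (ball (0::'a) (\<epsilon> / 2)) x \<le> bump \<epsilon> x"
      by (auto simp: indicator_def bump_def)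
  qed (rule int bump_nonneg)+
  finally have Z: "0 < Z" .
  have "smooth_kernel (\<lambda>x::'a. bump \<epsilon> x / Z) (\<lambda>x. bump_grad \<epsilon> x /\<^sub>R Z) (max ((\<epsilon>\<^sup>2)\<^sup>2) (4 * \<epsilon>\<^sup>2 * \<epsilon>) / Z)
      (((2 * \<epsilon> + 3)\<^sup>2 + 2 * \<epsilon>\<^sup>2) / Z) \<epsilon>"
  proof
    show "continuous_on UNIV (\<lambda>x::'a. bump \<epsilon> x / Z)" using Z by (intro continuous_intros cont) auto
    show "continuous_on UNIV (\<lambda>x::'a. bump_grad \<epsilon> x /\<^sub>R Z)" by (intro continuous_intros cont)
    fix x :: 'a
    show "0 \<le> bump \<epsilon> x / Z" using Z by (simp add: bump_nonneg)
    show "bump \<epsilon> x / Z \<le> max ((\<epsilon>\<^sup>2)\<^sup>2) (4 * \<epsilon>\<^sup>2 * \<epsilon>) / Z"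
      using Z bnd[of x] by (intro divide_right_mono) auto
    have "norm (bump_grad \<epsilon> x) / Z \<le> max ((\<epsilon>\<^sup>2)\<^sup>2) (4 * \<epsilon>\<^sup>2 * \<epsilon>) / Z"
      using Z gbnd[of x] by (intro divide_right_mono) auto
    then show "norm (bump_grad \<epsilon> x /\<^sub>R Z) \<le> max ((\<epsilon>\<^sup>2)\<^sup>2) (4 * \<epsilon>\<^sup>2 * \<epsilon>) / Z"
      using Z by (simp add: divide_inverse mult.commute)
    show "bump \<epsilon> (- x) / Z = bump \<epsilon> x / Z" "bump_grad \<epsilon> (- x) /\<^sub>R Z = - (bump_grad \<epsilon> x /\<^sub>R Z)"
      by (simp_all add: bump_def bump_grad_def)
    show "bump \<epsilon> x / Z = 0" "bump_grad \<epsilon> x /\<^sub>R Z = 0" if "\<epsilon> \<le> norm x"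
      using bump_supp[OF \<epsilon> that] by (simp_all add: bump_def bump_grad_def)
    fix v :: 'a assume v: "norm v \<le> 1"
    have "\<bar>bump \<epsilon> (x + v) / Z - bump \<epsilon> x / Z - (bump_grad \<epsilon> x /\<^sub>R Z) \<bullet> v\<bar> = \<bar>bump \<epsilon> (x + v) - bump \<epsilon> x - bump_grad \<epsilon> x \<bullet> v\<bar> / Z"
    proof -
      have "bump \<epsilon> (x + v) / Z - bump \<epsilon> x / Z - (bump_grad \<epsilon> x /\<^sub>R Z) \<bullet> v
          = (bump \<epsilon> (x + v) - bump \<epsilon> x - bump_grad \<epsilon> x \<bullet> v) / Z"
        by (simp add: diff_divide_distrib) (simp add: divide_inverse mult.commute)
      then show ?thesis using Z by simp
    qed
    also have "\<dots> \<le> ((2 * \<epsilon> + 3)\<^sup>2 + 2 * \<epsilon>\<^sup>2) * (norm v)\<^sup>2 / Z"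
      using Z by (intro divide_right_mono bump_remainder[OF \<epsilon> v]) auto
    finally show "\<bar>bump \<epsilon> (x + v) / Z - bump \<epsilon> x / Z - (bump_grad \<epsilon> x /\<^sub>R Z) \<bullet> v\<bar> \<le> ((2 * \<epsilon> + 3)\<^sup>2 + 2 * \<epsilon>\<^sup>2) / Z * (norm v)\<^sup>2"
      by simp
  next
    have "(\<integral>\<^sup>+(x::'a). ennreal (bump \<epsilon> x / Z) \<partial>lborel) = ennreal (\<integral>(x::'a). bump \<epsilon> x / Z \<partial>lborel)"
      using int Z by (intro nn_integral_eq_integral integrable_divide AE_I2) (auto simp: bump_nonneg)
    also have "(\<integral>(x::'a). bump \<epsilon> x / Z \<partial>lborel) = 1" using Z by (simp add: Z_def)
    finally show "(\<integral>\<^sup>+(x::'a). ennreal (bump \<epsilon> x / Z) \<partial>lborel) = 1" by simp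
  qed
  then show ?thesis by blast
qed

text \<open>Regularity of Lebesgue measure encloses \<Omega> between a compact \<open>C\<close> and
  an open \<open>T\<close> with |T - C| at most e/2, and \<open>T\<close> contains a d-neighbourhood
  of \<open>C\<close>. If |w| < d and exactly one of x, x + w lies in \<Omega>, then at least one of
  them lies in \<open>T - C\<close>; the two possibilities together cost e.\<close>

lemma indicator_translate_continuous:
  fixes \<Omega> :: "'a::euclidean_space set"
  assumes \<Omega>: "\<Omega> \<in> sets borel" "bounded \<Omega>" and e: "0 < e"
  shows "\<exists>d>0. \<forall>w. norm w < d \<longrightarrow>
    (\<integral>\<^sup>+x. ennreal \<bar>indicator \<Omega> (x + w) - indicator \<Omega> x\<bar> \<partial>lborel) \<le> ennreal e"
proof -
  have L: "\<Omega> \<in> sets lebesgue" using \<Omega>(1) by simp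
  have e4: "0 < e / 4" using e by simp
  obtain T where T: "open T" "\<Omega> \<subseteq> T" "T - \<Omega> \<in> lmeasurable" "emeasure lebesgue (T - \<Omega>) < ennreal (e / 4)"
    using sets_lebesgue_outer_open[OF L e4] by blast
  obtain C where C: "closed C" "C \<subseteq> \<Omega>" "\<Omega> - C \<in> lmeasurable" "emeasure lebesgue (\<Omega> - C) < ennreal (e / 4)"
    using sets_lebesgue_inner_closed[OF L e4] by blast
  have "compact C" using C(1,2) \<Omega>(2) bounded_subset compact_eq_bounded_closed by blast
  then obtain d where d: "0 < d" "(\<Union>x\<in>C. ball x d) \<subseteq> T"
    using compact_subset_open_imp_ball_epsilon_subset[of C T] T(1,2) C(2) by blast
  have [measurable]: "T \<in> sets borel" "C \<in> sets borel" "\<Omega> \<in> sets borel" using T(1) C(1) \<Omega>(1) by auto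
  have "emeasure lborel (T - C) \<le> emeasure lborel (T - \<Omega>) + emeasure lborel (\<Omega> - C)"
    by (rule order_trans[OF emeasure_mono emeasure_subadditive]) auto
  also have "\<dots> \<le> ennreal (e / 4) + ennreal (e / 4)"
    using T(4) C(4) by (intro add_mono) auto
  also have "\<dots> = ennreal (e / 2)" using e by (simp add: ennreal_plus[symmetric] del: ennreal_plus)
  finally have TC: "emeasure lborel (T - C) \<le> ennreal (e / 2)" .
  have "(\<integral>\<^sup>+x. ennreal \<bar>indicator \<Omega> (x + w) - indicator \<Omega> x\<bar> \<partial>lborel) \<le> ennreal e" if w: "norm w < d" for w
  proof -
    have T_add: "y + u \<in> T" if "y \<in> C" "norm u < d" for y u
    proof -
      have "y + u \<in> ball y d" using that(2) by (simp add: dist_norm)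
      with d(2) that(1) show ?thesis by blast
    qed
    have "(\<integral>\<^sup>+x. ennreal \<bar>indicator \<Omega> (x + w) - indicator \<Omega> x\<bar> \<partial>lborel)
      \<le> (\<integral>\<^sup>+x. indicator (T - C) (w + x) + indicator (T - C) x \<partial>lborel)"
    proof (rule nn_integral_mono)
      fix x
      consider "x \<in> \<Omega> \<longleftrightarrow> x + w \<in> \<Omega>" | "x \<in> \<Omega>" "x + w \<notin> \<Omega>" | "x \<notin> \<Omega>" "x + w \<in> \<Omega>" by blast
      then show "ennreal \<bar>indicator \<Omega> (x + w) - indicator \<Omega> x\<bar> \<le> indicator (T - C) (w + x) + indicator (T - C) x"
      proof cases
        case 1
        then have "\<bar>indicator \<Omega> (x + w) - indicator \<Omega> x :: real\<bar> = 0" by (simp add: indicator_def)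
        then show ?thesis by simp
      next
        case 2
        have "w + x \<in> T - C \<or> x \<in> T - C"
          using 2 T_add[of x w] w C(2) T(2) by (auto simp: add.commute)
        then show ?thesis using 2 by (auto simp: indicator_def)
      next
        case 3
        have "w + x \<in> T - C \<or> x \<in> T - C"
          using 3 T_add[of "x + w" "- w"] w C(2) T(2) by (auto simp: add.commute)
        then show ?thesis using 3 by (auto simp: indicator_def)
      qed
    qed
    also have "\<dots> = (\<integral>\<^sup>+x. indicator (T - C) (w + x) \<partial>lborel) + (\<integral>\<^sup>+x. indicator (T - C) x \<partial>lborel)"
      by (rule nn_integral_add) auto
    also have "\<dots> = emeasure lborel (T - C) + emeasure lborel (T - C)"
      by (subst nn_integral_lborel_translate) auto
    also have "\<dots> \<le> ennreal (e / 2) + ennreal (e / 2)" by (intro add_mono TC)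
    also have "\<dots> = ennreal e" using e by (simp add: ennreal_plus[symmetric] del: ennreal_plus)
    finally show ?thesis .
  qed
  with d(1) show ?thesis by blast
qed

section \<open>The mollified indicator and its gradient\<close>

context smooth_kernel
begin

definition smoothed :: "'a set \<Rightarrow> 'a \<Rightarrow> real" where
  "smoothed \<Omega> x = (\<integral>z. \<eta> (z - x) *\<^sub>R indicator \<Omega> z \<partial>lborel)"

definition smoothed_grad :: "'a set \<Rightarrow> 'a \<Rightarrow> 'a" where
  "smoothed_grad \<Omega> x = - (\<integral>z. indicator \<Omega> z *\<^sub>R G (z - x) \<partial>lborel)"

context
  fixes \<Omega> :: "'a set"
  assumes \<Omega>[measurable]: "\<Omega> \<in> sets borel" and bounded_\<Omega>: "bounded \<Omega>"
begin

lemma emeasure_\<Omega>_finite: "emeasure lborel \<Omega> < \<infinity>"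
  using bounded_\<Omega> by (rule emeasure_bounded_finite)

lemma integrable_indicator_\<Omega>: "integrable lborel (indicator \<Omega> :: 'a \<Rightarrow> real)"
  using emeasure_\<Omega>_finite by (simp add: integrable_indicator_iff)

lemma integrable_indicator_G: "integrable lborel (\<lambda>z. indicator \<Omega> z *\<^sub>R G (z - x))"
  using emeasure_\<Omega>_finite G_bound by (intro integrableI_bounded_set_indicator[where B=B]) auto

lemma smoothed_has_derivative: "(smoothed \<Omega> has_derivative (\<lambda>v. smoothed_grad \<Omega> x \<bullet> v)) (at x)"
proof -
  have "(\<integral>z. (G (z - x) \<bullet> v) *\<^sub>R indicator \<Omega> z \<partial>lborel) = (\<integral>z. indicator \<Omega> z *\<^sub>R G (z - x) \<partial>lborel) \<bullet> v" for v
    by (subst integral_inner_left[symmetric]) (auto intro: integrable_indicator_G simp: mult.commute)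
  then show ?thesis
    using convolution_has_derivative[OF integrable_indicator_\<Omega>, of x]
    unfolding smoothed_def[abs_def] smoothed_grad_def by simp
qed

lemma smoothed_grad_continuous: "continuous_on UNIV (smoothed_grad \<Omega>)"
  unfolding smoothed_grad_def[abs_def]
  by (intro continuous_intros convolution_continuous[where p="\<lambda>a b. b *\<^sub>R a", OF bounded_bilinear.flip[OF bounded_bilinear_scaleR] G_cont G_bound integrable_indicator_\<Omega>])

lemma smoothed_measurable[measurable]: "smoothed \<Omega> \<in> borel_measurable borel"
  by (intro borel_measurable_continuous_onI continuous_at_imp_continuous_on ballI has_derivative_continuous[OF smoothed_has_derivative])

lemma smoothed_grad_measurable[measurable]: "smoothed_grad \<Omega> \<in> borel_measurable borel"
  using smoothed_grad_continuous by (rule borel_measurable_continuous_onI)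

lemma smoothed_grad_supp:
  assumes "\<Omega> \<subseteq> ball 0 \<rho>" "\<rho> + \<epsilon> \<le> norm x"
  shows "smoothed_grad \<Omega> x = 0"
proof -
  have "indicator \<Omega> z *\<^sub>R G (z - x) = 0" for z
  proof (cases "z \<in> \<Omega>")
    case True
    then have "norm z < \<rho>" using assms(1) by auto
    then have "\<epsilon> \<le> norm (z - x)" using assms(2) norm_triangle_ineq2[of x z] by (simp add: norm_minus_commute)
    then show ?thesis by (simp add: G_supp)
  qed simp
  then show ?thesis unfolding smoothed_grad_def by (simp only: integral_zero minus_zero)
qed

lemma smoothed_grad_bound: "norm (smoothed_grad \<Omega> x) \<le> B * measure lborel \<Omega>"
proof -
  have "norm (smoothed_grad \<Omega> x) \<le> (\<integral>z. B * indicator \<Omega> z \<partial>lborel)"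
    unfolding smoothed_grad_def norm_minus_cancel
  proof (rule order_trans[OF Bochner_Integration.integral_norm_bound integral_mono'])
    show "integrable lborel (\<lambda>z. B * indicator \<Omega> z)" using integrable_indicator_\<Omega> by simp
  qed (use G_bound B_nonneg in \<open>auto simp: indicator_def\<close>)
  then show ?thesis by simp
qed

text \<open>Duality: the L1 norm of the gradient is its pairing with its own direction field. That
  field is merely measurable, but the mollifier can be moved from the indicator onto the field by
  Fubini. The result is an admissible field \<phi>, and the pairing turns into the integral of its
  divergence over \<Omega>.\<close>

lemma smoothed_grad_L1:
  "ennreal (\<integral>x. norm (smoothed_grad \<Omega> x) \<partial>lborel) = (\<integral>\<^sup>+x. ennreal (norm (smoothed_grad \<Omega> x)) \<partial>lborel)"
  "ereal (\<integral>x. norm (smoothed_grad \<Omega> x) \<partial>lborel) \<le> Per \<Omega>"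
proof -
  let ?N = "smoothed_grad \<Omega>"
  obtain \<rho>' where \<rho>': "\<Omega> \<subseteq> ball 0 \<rho>'" using bounded_\<Omega> bounded_subset_ballD[of \<Omega> 0] by blast
  define \<rho> where "\<rho> = \<rho>' + \<epsilon>"
  have supp: "?N x = 0" if "x \<notin> ball 0 \<rho>" for x
    using that smoothed_grad_supp[OF \<rho>'] by (simp add: \<rho>_def not_less)
  have fin: "emeasure lborel (ball (0::'a) \<rho>) < \<infinity>" by (rule emeasure_lborel_ball_finite)
  have intN: "integrable lborel (\<lambda>x. norm (?N x))"
    by (rule integrableI_bounded_set[where A="ball 0 \<rho>" and B="B * measure lborel \<Omega>"])
       (use fin supp smoothed_grad_bound in auto)
  show "ennreal (\<integral>x. norm (smoothed_grad \<Omega> x) \<partial>lborel) = (\<integral>\<^sup>+x. ennreal (norm (smoothed_grad \<Omega> x)) \<partial>lborel)"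
    by (rule nn_integral_eq_integral[symmetric]) (use intN in auto)
  \<comment> \<open>the optimal test field for the mollified indicator; mollifying it makes it admissible for Per\<close>
  define \<Phi> where "\<Phi> x = - sgn (?N x)" for x
  have [measurable]: "\<Phi> \<in> borel_measurable borel" unfolding \<Phi>_def[abs_def] sgn_div_norm by measurable
  have \<Phi>1: "norm (\<Phi> x) \<le> 1" for x by (simp add: \<Phi>_def norm_sgn)
  have \<Phi>0: "\<Phi> x = 0" if "x \<notin> ball 0 \<rho>" for x using supp[OF that] by (simp add: \<Phi>_def)
  have int\<Phi>: "integrable lborel \<Phi>"
    by (rule integrableI_bounded_set[where A="ball 0 \<rho>" and B=1]) (use fin \<Phi>1 \<Phi>0 in auto)
  define \<phi> where "\<phi> z = (\<integral>x. \<eta> (x - z) *\<^sub>R \<Phi> x \<partial>lborel)" for z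
  have D: "(\<phi> has_derivative (\<lambda>v. - (\<integral>x. (G (x - z) \<bullet> v) *\<^sub>R \<Phi> x \<partial>lborel))) (at z)" for z
    unfolding \<phi>_def[abs_def] by (rule convolution_has_derivative[OF int\<Phi>])
  have FD: "frechet_derivative \<phi> (at z) = (\<lambda>v. - (\<integral>x. (G (x - z) \<bullet> v) *\<^sub>R \<Phi> x \<partial>lborel))" for z
    using frechet_derivative_at[OF D] by simp
  have div: "divergence \<phi> z = - (\<integral>x. G (x - z) \<bullet> \<Phi> x \<partial>lborel)" for z
  proof -
    have "divergence \<phi> z = - (\<Sum>b\<in>Basis. \<integral>x. (G (x - z) \<bullet> b) * (\<Phi> x \<bullet> b) \<partial>lborel)"
      unfolding divergence_def FD
      by (simp add: sum_negf integral_inner_left[symmetric] integrable_G[OF int\<Phi>] del: integral_inner_left)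
    also have "(\<Sum>b\<in>Basis. \<integral>x. (G (x - z) \<bullet> b) * (\<Phi> x \<bullet> b) \<partial>lborel) = (\<integral>x. (\<Sum>b\<in>Basis. (G (x - z) \<bullet> b) * (\<Phi> x \<bullet> b)) \<partial>lborel)"
    proof (rule Bochner_Integration.integral_sum[symmetric])
      fix b :: 'a
      show "integrable lborel (\<lambda>x. (G (x - z) \<bullet> b) * (\<Phi> x \<bullet> b))"
        using integrable_inner_left[OF integrable_G[OF int\<Phi>], of z b b] by simp
    qed
    finally show ?thesis by (simp add: euclidean_inner[symmetric])
  qed
  have "continuous_on UNIV (divergence \<phi>)"
    unfolding div[abs_def]
    by (intro continuous_intros convolution_continuous[OF bounded_bilinear_inner G_cont G_bound int\<Phi>])
  then have [measurable]: "divergence \<phi> \<in> borel_measurable borel" by (rule borel_measurable_continuous_onI)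
  have "\<phi> \<in> C1c_unit_fields"
    unfolding C1c_unit_fields_def
  proof (intro CollectI conjI ballI allI)
    show "\<phi> differentiable_on UNIV"
      unfolding differentiable_on_def differentiable_def using D by (auto intro: has_derivative_at_withinI)
    fix b :: 'a
    have "continuous_on UNIV (\<lambda>x. G x \<bullet> b)" by (intro continuous_intros G_cont)
    moreover have "norm (G y \<bullet> b) \<le> B * norm b" for y
      unfolding real_norm_def by (rule order_trans[OF Cauchy_Schwarz_ineq2]) (intro mult_right_mono G_bound norm_ge_zero)
    ultimately show "continuous_on UNIV (\<lambda>x. frechet_derivative \<phi> (at x) b)"
      unfolding FD by (intro continuous_on_minus convolution_continuous[where k="\<lambda>x. G x \<bullet> b", OF bounded_bilinear_scaleR _ _ int\<Phi>])
  next
    have "\<phi> z = 0" if "\<rho> + \<epsilon> \<le> norm z" for z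
    proof -
      have "\<eta> (x - z) *\<^sub>R \<Phi> x = 0" for x
      proof (cases "x \<in> ball 0 \<rho>")
        case True
        then have "\<epsilon> \<le> norm (x - z)" using that norm_triangle_ineq2[of z x] by (simp add: norm_minus_commute)
        then show ?thesis by (simp add: eta_supp)
      qed (simp add: \<Phi>0)
      then show ?thesis unfolding \<phi>_def by (simp only: integral_zero)
    qed
    then have "{x. \<phi> x \<noteq> 0} \<subseteq> ball 0 (\<rho> + \<epsilon>)" by (auto simp: not_le[symmetric])
    then show "compact (closure {x. \<phi> x \<noteq> 0})"
      using bounded_ball bounded_subset by (simp add: compact_closure) blast
  next
    \<comment> \<open>\<phi> z averages vectors of norm at most 1 against a weight of total mass
      one.\<close>
    fix z
    have "ennreal (norm (\<phi> z)) \<le> (\<integral>\<^sup>+x. ennreal (norm (\<eta> (x - z) *\<^sub>R \<Phi> x)) \<partial>lborel)"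
      unfolding \<phi>_def by (rule integral_norm_bound_ennreal[OF integrable_eta[OF int\<Phi>]])
    also have "\<dots> \<le> (\<integral>\<^sup>+x. ennreal (\<eta> (- z + x)) \<partial>lborel)"
      using \<Phi>1 eta_nonneg by (intro nn_integral_mono ennreal_leI) (simp add: mult_left_le)
    also have "\<dots> = 1" by (subst nn_integral_lborel_translate) (simp_all add: eta_mass)
    finally show "norm (\<phi> z) \<le> 1" by simp
  qed
  then have "ereal (LINT z:\<Omega>|lebesgue. divergence \<phi> z) \<le> Per \<Omega>"
    unfolding Per_def by (rule SUP_upper)
  also have "(LINT z:\<Omega>|lebesgue. divergence \<phi> z) = (\<integral>z. indicator \<Omega> z *\<^sub>R divergence \<phi> z \<partial>lborel)"
    unfolding set_lebesgue_integral_def by (rule integral_completion) measurable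
  also have "\<dots> = (\<integral>z. \<integral>x. - indicator \<Omega> z * (G (x - z) \<bullet> \<Phi> x) \<partial>lborel \<partial>lborel)"
    by (simp add: div)
  also have "\<dots> = (\<integral>x. \<integral>z. - indicator \<Omega> z * (G (x - z) \<bullet> \<Phi> x) \<partial>lborel \<partial>lborel)"
  proof (rule lborel_pair.Fubini_integral)
    show "integrable (lborel \<Otimes>\<^sub>M lborel) (\<lambda>(x, z). - indicator \<Omega> z * (G (x - z) \<bullet> \<Phi> x))"
    proof (rule integrableI_bounded_set[where A="ball (0::'a) \<rho> \<times> \<Omega>" and B=B])
      show "emeasure (lborel \<Otimes>\<^sub>M lborel) (ball (0::'a) \<rho> \<times> \<Omega>) < \<infinity>"
        by (subst lborel.emeasure_pair_measure_Times)
           (use fin emeasure_\<Omega>_finite in \<open>auto simp: ennreal_mult_less_top\<close>)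
      have "\<bar>G (x - z) \<bullet> \<Phi> x\<bar> \<le> B" for x z
      proof -
        have "\<bar>G (x - z) \<bullet> \<Phi> x\<bar> \<le> norm (G (x - z)) * norm (\<Phi> x)" by (rule Cauchy_Schwarz_ineq2)
        also have "\<dots> \<le> B * 1" by (intro mult_mono G_bound \<Phi>1 B_nonneg norm_ge_zero)
        finally show ?thesis by simp
      qed
      then show "AE p in lborel \<Otimes>\<^sub>M lborel. p \<in> ball (0::'a) \<rho> \<times> \<Omega> \<longrightarrow> norm (case p of (x, z) \<Rightarrow> - indicator \<Omega> z * (G (x - z) \<bullet> \<Phi> x)) \<le> B"
        by (auto simp: indicator_def)
      show "AE p in lborel \<Otimes>\<^sub>M lborel. p \<notin> ball (0::'a) \<rho> \<times> \<Omega> \<longrightarrow> (case p of (x, z) \<Rightarrow> - indicator \<Omega> z * (G (x - z) \<bullet> \<Phi> x)) = 0"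
        using \<Phi>0 by (intro AE_I2) (auto simp: indicator_def, metis inner_zero_right)
    qed measurable
  qed
  also have "\<dots> = (\<integral>x. norm (?N x) \<partial>lborel)"
  proof (rule Bochner_Integration.integral_cong[OF refl])
    fix x
    \<comment> \<open>Differentiating the field gives \<open>G (x - z)\<close>, differentiating the
      mollified indicator gives \<open>G (z - x)\<close>; oddness of \<open>G\<close> matches them,
      and the two minus signs in \<open>smoothed_grad\<close> and \<Phi> cancel.\<close>
    have "- indicator \<Omega> z * (G (x - z) \<bullet> \<Phi> x) = (indicator \<Omega> z *\<^sub>R G (z - x)) \<bullet> \<Phi> x" for z
      using G_odd[of "z - x"] by simp
    then have "(\<integral>z. - indicator \<Omega> z * (G (x - z) \<bullet> \<Phi> x) \<partial>lborel) = (\<integral>z. indicator \<Omega> z *\<^sub>R G (z - x) \<partial>lborel) \<bullet> \<Phi> x"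
      by (simp only:) (rule integral_inner_left, rule integrable_indicator_G)
    also have "\<dots> = ?N x \<bullet> sgn (?N x)" by (simp add: smoothed_grad_def \<Phi>_def)
    also have "\<dots> = norm (?N x)"
      by (cases "?N x = 0") (simp_all add: sgn_div_norm dot_square_norm power2_eq_square)
    finally show "(\<integral>z. - indicator \<Omega> z * (G (x - z) \<bullet> \<Phi> x) \<partial>lborel) = norm (?N x)" .
  qed
  finally show "ereal (\<integral>x. norm (?N x) \<partial>lborel) \<le> Per \<Omega>" .
qed

text \<open>Fundamental theorem of calculus along the segment from x to x + h; after integration in
  x every point of the segment contributes the same by translation invariance. The directional
  derivative is kept instead of the product of norms, as the sharp constant requires.\<close>

lemma smoothed_difference:
  "(\<integral>\<^sup>+x. ennreal \<bar>smoothed \<Omega> (x + h) - smoothed \<Omega> x\<bar> \<partial>lborel) \<le> (\<integral>\<^sup>+x. ennreal \<bar>h \<bullet> smoothed_grad \<Omega> x\<bar> \<partial>lborel)"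
proof -
  let ?N = "smoothed_grad \<Omega>"
  have ptw: "ennreal \<bar>smoothed \<Omega> (x + h) - smoothed \<Omega> x\<bar>
      \<le> (\<integral>\<^sup>+s. indicator {0..1} s * ennreal \<bar>h \<bullet> ?N (s *\<^sub>R h + x)\<bar> \<partial>lborel)" for x
  proof -
    let ?g = "\<lambda>s. ?N (x + s *\<^sub>R h) \<bullet> h"
    have d: "((\<lambda>s. smoothed \<Omega> (x + s *\<^sub>R h)) has_vector_derivative ?g s) (at s within {0..1})" for s
    proof -
      have "((\<lambda>s. x + s *\<^sub>R h) has_derivative (\<lambda>u. u *\<^sub>R h)) (at s within {0..1})"
        by (auto intro!: derivative_eq_intros)
      from has_derivative_compose[OF this smoothed_has_derivative]
      show ?thesis unfolding has_vector_derivative_def by (simp add: mult.commute)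
    qed
    have c: "continuous_on {0..1} ?g"
      by (intro continuous_intros continuous_on_compose2[OF smoothed_grad_continuous]) auto
    have "has_bochner_integral lborel (\<lambda>s. indicator {0..1} s *\<^sub>R ?g s) (smoothed \<Omega> (x + 1 *\<^sub>R h) - smoothed \<Omega> (x + 0 *\<^sub>R h))"
      using has_bochner_integral_FTC_Icc[of 0 1 "\<lambda>s. smoothed \<Omega> (x + s *\<^sub>R h)" ?g] d c by simp
    then have "ennreal (norm (smoothed \<Omega> (x + h) - smoothed \<Omega> x)) \<le> (\<integral>\<^sup>+s. ennreal (norm (indicator {0..1} s *\<^sub>R ?g s)) \<partial>lborel)"
      by (intro has_bochner_integral_norm_bound) simp
    also have "\<dots> = (\<integral>\<^sup>+s. indicator {0..1} s * ennreal \<bar>h \<bullet> ?N (s *\<^sub>R h + x)\<bar> \<partial>lborel)"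
      by (intro nn_integral_cong) (auto simp: indicator_def add.commute inner_commute)
    finally show ?thesis by simp
  qed
  have "(\<integral>\<^sup>+x. ennreal \<bar>smoothed \<Omega> (x + h) - smoothed \<Omega> x\<bar> \<partial>lborel)
    \<le> (\<integral>\<^sup>+x. \<integral>\<^sup>+s. indicator {0..1} s * ennreal \<bar>h \<bullet> ?N (s *\<^sub>R h + x)\<bar> \<partial>lborel \<partial>lborel)"
    by (intro nn_integral_mono ptw)
  also have "\<dots> = (\<integral>\<^sup>+s. \<integral>\<^sup>+x. indicator {0..1} s * ennreal \<bar>h \<bullet> ?N (s *\<^sub>R h + x)\<bar> \<partial>lborel \<partial>lborel)"
    by (rule lborel_pair.Fubini') (simp add: case_prod_beta)
  also have "\<dots> = (\<integral>\<^sup>+s. indicator {0..1} s * (\<integral>\<^sup>+x. ennreal \<bar>h \<bullet> ?N x\<bar> \<partial>lborel) \<partial>(lborel::real measure))"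
  proof (rule nn_integral_cong)
    fix s :: real
    have "(\<integral>\<^sup>+x. indicator {0..1} s * ennreal \<bar>h \<bullet> ?N (s *\<^sub>R h + x)\<bar> \<partial>lborel)
      = indicator {0..1} s * (\<integral>\<^sup>+x. ennreal \<bar>h \<bullet> ?N (s *\<^sub>R h + x)\<bar> \<partial>lborel)"
      by (rule nn_integral_cmult) measurable
    also have "(\<integral>\<^sup>+x. ennreal \<bar>h \<bullet> ?N (s *\<^sub>R h + x)\<bar> \<partial>lborel) = (\<integral>\<^sup>+x. ennreal \<bar>h \<bullet> ?N x\<bar> \<partial>lborel)"
      by (rule nn_integral_lborel_translate) measurable
    finally show "(\<integral>\<^sup>+x. indicator {0..1} s * ennreal \<bar>h \<bullet> ?N (s *\<^sub>R h + x)\<bar> \<partial>lborel)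
      = indicator {0..1} s * (\<integral>\<^sup>+x. ennreal \<bar>h \<bullet> ?N x\<bar> \<partial>lborel)" .
  qed
  also have "\<dots> = (\<integral>\<^sup>+x. ennreal \<bar>h \<bullet> ?N x\<bar> \<partial>lborel)"
    by (subst nn_integral_multc) auto
  finally show ?thesis .
qed

text \<open>Since the kernel has mass one, the difference is an average of the differences between
  translates by w and the indicator itself, with |w| < \<epsilon> on the support of the
  kernel.\<close>

lemma smoothed_L1_dist:
  assumes d: "\<And>w. norm w < \<epsilon> \<Longrightarrow> (\<integral>\<^sup>+x. ennreal \<bar>indicator \<Omega> (x + w) - indicator \<Omega> x\<bar> \<partial>lborel) \<le> e"
  shows "(\<integral>\<^sup>+x. ennreal \<bar>smoothed \<Omega> x - indicator \<Omega> x\<bar> \<partial>lborel) \<le> e"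
proof -
  have eta_int: "integrable lborel (\<lambda>z. \<eta> (z - x))" for x
  proof (rule integrableI_nonneg)
    have "(\<integral>\<^sup>+z. ennreal (\<eta> (- x + z)) \<partial>lborel) = 1"
      by (subst nn_integral_lborel_translate) (simp_all add: eta_mass)
    then show "(\<integral>\<^sup>+z. ennreal (\<eta> (z - x)) \<partial>lborel) < \<infinity>" by simp
  qed (use eta_nonneg in auto)
  have eta_one: "(\<integral>z. \<eta> (z - x) \<partial>lborel) = 1" for x
  proof -
    have "(\<integral>\<^sup>+z. ennreal (\<eta> (- x + z)) \<partial>lborel) = 1"
      by (subst nn_integral_lborel_translate) (simp_all add: eta_mass)
    then show ?thesis using eta_nonneg by (subst integral_eq_nn_integral) auto
  qed
  have ptw: "ennreal \<bar>smoothed \<Omega> x - indicator \<Omega> x\<bar>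
      \<le> (\<integral>\<^sup>+w. ennreal (\<eta> w) * ennreal \<bar>indicator \<Omega> (x + w) - indicator \<Omega> x\<bar> \<partial>lborel)" for x
  proof -
    have I: "integrable lborel (\<lambda>z. \<eta> (z - x) * indicator \<Omega> z)"
      using integrable_eta[OF integrable_indicator_\<Omega>, of x] by simp
    have "smoothed \<Omega> x - indicator \<Omega> x = (\<integral>z. \<eta> (z - x) * indicator \<Omega> z \<partial>lborel) - indicator \<Omega> x * (\<integral>z. \<eta> (z - x) \<partial>lborel)"
      by (simp add: smoothed_def eta_one)
    also have "\<dots> = (\<integral>z. \<eta> (z - x) * indicator \<Omega> z - indicator \<Omega> x * \<eta> (z - x) \<partial>lborel)"
      using I eta_int by simp
    finally have "ennreal (norm (smoothed \<Omega> x - indicator \<Omega> x)) = ennreal (norm (\<integral>z. \<eta> (z - x) * indicator \<Omega> z - indicator \<Omega> x * \<eta> (z - x) \<partial>lborel))"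
      by simp
    also have "\<dots> \<le> (\<integral>\<^sup>+z. ennreal (norm (\<eta> (z - x) * indicator \<Omega> z - indicator \<Omega> x * \<eta> (z - x))) \<partial>lborel)"
      by (rule integral_norm_bound_ennreal) (intro Bochner_Integration.integrable_diff I integrable_mult_right eta_int)
    also have "\<dots> = (\<integral>\<^sup>+z. ennreal (\<eta> (- x + z)) * ennreal \<bar>indicator \<Omega> (x + (- x + z)) - indicator \<Omega> x\<bar> \<partial>lborel)"
    proof (rule nn_integral_cong)
      fix z
      have "norm (\<eta> (z - x) * indicator \<Omega> z - indicator \<Omega> x * \<eta> (z - x)) = \<eta> (z - x) * \<bar>indicator \<Omega> z - indicator \<Omega> x\<bar>"
        using eta_nonneg[of "z - x"] by (auto simp: indicator_def)
      then show "ennreal (norm (\<eta> (z - x) * indicator \<Omega> z - indicator \<Omega> x * \<eta> (z - x)))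
        = ennreal (\<eta> (- x + z)) * ennreal \<bar>indicator \<Omega> (x + (- x + z)) - indicator \<Omega> x\<bar>"
        using eta_nonneg[of "z - x"] by (simp add: ennreal_mult')
    qed
    also have "\<dots> = (\<integral>\<^sup>+w. ennreal (\<eta> w) * ennreal \<bar>indicator \<Omega> (x + w) - indicator \<Omega> x\<bar> \<partial>lborel)"
      by (rule nn_integral_lborel_translate) measurable
    finally show ?thesis by simp
  qed
  have "(\<integral>\<^sup>+x. ennreal \<bar>smoothed \<Omega> x - indicator \<Omega> x\<bar> \<partial>lborel)
    \<le> (\<integral>\<^sup>+x. \<integral>\<^sup>+w. ennreal (\<eta> w) * ennreal \<bar>indicator \<Omega> (x + w) - indicator \<Omega> x\<bar> \<partial>lborel \<partial>lborel)"
    by (intro nn_integral_mono ptw)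
  also have "\<dots> = (\<integral>\<^sup>+w. \<integral>\<^sup>+x. ennreal (\<eta> w) * ennreal \<bar>indicator \<Omega> (x + w) - indicator \<Omega> x\<bar> \<partial>lborel \<partial>lborel)"
    by (rule lborel_pair.Fubini') (simp add: case_prod_beta)
  also have "\<dots> \<le> (\<integral>\<^sup>+w. ennreal (\<eta> w) * e \<partial>lborel)"
  proof (rule nn_integral_mono)
    fix w
    have "(\<integral>\<^sup>+x. ennreal (\<eta> w) * ennreal \<bar>indicator \<Omega> (x + w) - indicator \<Omega> x\<bar> \<partial>lborel)
      = ennreal (\<eta> w) * (\<integral>\<^sup>+x. ennreal \<bar>indicator \<Omega> (x + w) - indicator \<Omega> x\<bar> \<partial>lborel)"
      by (rule nn_integral_cmult) measurable
    also have "\<dots> \<le> ennreal (\<eta> w) * e"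
      using d[of w] eta_supp[of w] by (cases "norm w < \<epsilon>") (auto intro: mult_left_mono)
    finally show "(\<integral>\<^sup>+x. ennreal (\<eta> w) * ennreal \<bar>indicator \<Omega> (x + w) - indicator \<Omega> x\<bar> \<partial>lborel) \<le> ennreal (\<eta> w) * e" .
  qed
  also have "\<dots> = e" by (subst nn_integral_multc) (simp_all add: eta_mass)
  finally show ?thesis .
qed

end

end

text \<open>Replacing the indicator by its mollification costs \<open>e\<close> uniformly in h, and
  total mass at most 1 keeps that cost below \<open>e\<close> after integration against
  \<open>k\<close>. What remains is bounded by \<open>c\<close> times the L1 norm of the mollified
  gradient, hence by \<open>c\<close> times the perimeter, whatever the mollification radius; then e
  is arbitrary.\<close>

theorem nonlocal_variation_le_Per:
  fixes \<Omega> :: "'a::euclidean_space set" and k :: "'a \<Rightarrow> ennreal"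
  assumes \<Omega>[measurable]: "\<Omega> \<in> sets borel" and bd: "bounded \<Omega>" and per: "Per \<Omega> < \<infinity>"
    and [measurable]: "k \<in> borel_measurable borel" and k_fin: "(\<integral>\<^sup>+h. k h \<partial>lborel) \<le> 1"
    and moment: "\<And>v. (\<integral>\<^sup>+h. k h * ennreal \<bar>h \<bullet> v\<bar> \<partial>lborel) \<le> ennreal c * ennreal (norm v)"
  shows "(\<integral>\<^sup>+h. k h * (\<integral>\<^sup>+x. ennreal \<bar>indicator \<Omega> (x + h) - indicator \<Omega> x\<bar> \<partial>lborel) \<partial>lborel)
    \<le> ennreal c * ennreal (real_of_ereal (Per \<Omega>))"
proof (rule ennreal_le_epsilon)
  fix e :: real assume e: "0 < e"
  obtain d where d: "0 < d" "\<And>w. norm w < d \<Longrightarrow>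
      (\<integral>\<^sup>+x. ennreal \<bar>indicator \<Omega> (x + w) - indicator \<Omega> x\<bar> \<partial>lborel) \<le> ennreal (e / 2)"
    using indicator_translate_continuous[OF \<Omega> bd, of "e / 2"] e by auto
  obtain \<eta> :: "'a \<Rightarrow> real" and G B L where "smooth_kernel \<eta> G B L d"
    using smooth_kernel_exists[OF d(1)] by blast
  then interpret smooth_kernel \<eta> G B L d .
  note [measurable] = smoothed_measurable[OF \<Omega> bd] smoothed_grad_measurable[OF \<Omega> bd]
  let ?f = "smoothed \<Omega>" and ?N = "smoothed_grad \<Omega>" and ?P = "real_of_ereal (Per \<Omega>)"
  have L1: "(\<integral>\<^sup>+x. ennreal \<bar>?f x - indicator \<Omega> x\<bar> \<partial>lborel) \<le> ennreal (e / 2)"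
    by (rule smoothed_L1_dist[OF \<Omega> bd d(2)])
  have ptw: "(\<integral>\<^sup>+x. ennreal \<bar>indicator \<Omega> (x + h) - indicator \<Omega> x\<bar> \<partial>lborel)
    \<le> ennreal e + (\<integral>\<^sup>+x. ennreal \<bar>h \<bullet> ?N x\<bar> \<partial>lborel)" for h
  proof -
    have "(\<integral>\<^sup>+x. ennreal \<bar>indicator \<Omega> (x + h) - indicator \<Omega> x\<bar> \<partial>lborel)
      \<le> (\<integral>\<^sup>+x. ennreal \<bar>?f (h + x) - indicator \<Omega> (h + x)\<bar> + ennreal \<bar>?f x - indicator \<Omega> x\<bar> + ennreal \<bar>?f (x + h) - ?f x\<bar> \<partial>lborel)"
      by (rule nn_integral_mono) (simp add: ennreal_plus[symmetric] add.commute del: ennreal_plus)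
    also have "\<dots> = (\<integral>\<^sup>+x. ennreal \<bar>?f (h + x) - indicator \<Omega> (h + x)\<bar> \<partial>lborel) + (\<integral>\<^sup>+x. ennreal \<bar>?f x - indicator \<Omega> x\<bar> \<partial>lborel)
        + (\<integral>\<^sup>+x. ennreal \<bar>?f (x + h) - ?f x\<bar> \<partial>lborel)"
      by (subst nn_integral_add, measurable, subst nn_integral_add, measurable)
    also have "(\<integral>\<^sup>+x. ennreal \<bar>?f (h + x) - indicator \<Omega> (h + x)\<bar> \<partial>lborel) = (\<integral>\<^sup>+x. ennreal \<bar>?f x - indicator \<Omega> x\<bar> \<partial>lborel)"
      by (rule nn_integral_lborel_translate[where f="\<lambda>x. ennreal \<bar>?f x - indicator \<Omega> x\<bar>"]) measurable
    also have "(\<integral>\<^sup>+x. ennreal \<bar>?f x - indicator \<Omega> x\<bar> \<partial>lborel) + (\<integral>\<^sup>+x. ennreal \<bar>?f x - indicator \<Omega> x\<bar> \<partial>lborel)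
        + (\<integral>\<^sup>+x. ennreal \<bar>?f (x + h) - ?f x\<bar> \<partial>lborel) \<le> ennreal (e / 2) + ennreal (e / 2) + (\<integral>\<^sup>+x. ennreal \<bar>h \<bullet> ?N x\<bar> \<partial>lborel)"
      by (intro add_mono L1 smoothed_difference[OF \<Omega> bd])
    also have "ennreal (e / 2) + ennreal (e / 2) = ennreal e" using e by (simp add: ennreal_plus[symmetric] del: ennreal_plus)
    finally show ?thesis .
  qed
  have "(\<integral>\<^sup>+h. k h * (\<integral>\<^sup>+x. ennreal \<bar>indicator \<Omega> (x + h) - indicator \<Omega> x\<bar> \<partial>lborel) \<partial>lborel)
    \<le> (\<integral>\<^sup>+h. k h * ennreal e + (\<integral>\<^sup>+x. k h * ennreal \<bar>h \<bullet> ?N x\<bar> \<partial>lborel) \<partial>lborel)"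
  proof (rule nn_integral_mono)
    fix h
    have "(\<integral>\<^sup>+x. k h * ennreal \<bar>h \<bullet> ?N x\<bar> \<partial>lborel) = k h * (\<integral>\<^sup>+x. ennreal \<bar>h \<bullet> ?N x\<bar> \<partial>lborel)"
      by (rule nn_integral_cmult) measurable
    then show "k h * (\<integral>\<^sup>+x. ennreal \<bar>indicator \<Omega> (x + h) - indicator \<Omega> x\<bar> \<partial>lborel)
      \<le> k h * ennreal e + (\<integral>\<^sup>+x. k h * ennreal \<bar>h \<bullet> ?N x\<bar> \<partial>lborel)"
      using mult_left_mono[OF ptw[of h], of "k h"] by (simp add: distrib_left)
  qed
  also have "\<dots> = (\<integral>\<^sup>+h. k h * ennreal e \<partial>lborel) + (\<integral>\<^sup>+h. \<integral>\<^sup>+x. k h * ennreal \<bar>h \<bullet> ?N x\<bar> \<partial>lborel \<partial>lborel)"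
    by (rule nn_integral_add) measurable
  also have "\<dots> \<le> ennreal e + ennreal c * ennreal ?P"
  proof (rule add_mono)
    have "(\<integral>\<^sup>+h. k h * ennreal e \<partial>lborel) = (\<integral>\<^sup>+h. k h \<partial>lborel) * ennreal e"
      by (rule nn_integral_multc) measurable
    also have "\<dots> \<le> 1 * ennreal e" by (intro mult_right_mono k_fin) simp
    finally show "(\<integral>\<^sup>+h. k h * ennreal e \<partial>lborel) \<le> ennreal e" by simp
  next
    \<comment> \<open>With h innermost, \<open>moment\<close> applies at each x to the vector
      \<open>?N x\<close>, so only the length of the gradient survives.\<close>
    have "(\<integral>\<^sup>+h. \<integral>\<^sup>+x. k h * ennreal \<bar>h \<bullet> ?N x\<bar> \<partial>lborel \<partial>lborel) = (\<integral>\<^sup>+x. \<integral>\<^sup>+h. k h * ennreal \<bar>h \<bullet> ?N x\<bar> \<partial>lborel \<partial>lborel)"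
      by (rule lborel_pair.Fubini') (simp add: case_prod_beta)
    also have "\<dots> \<le> (\<integral>\<^sup>+x. ennreal c * ennreal (norm (?N x)) \<partial>lborel)"
      by (intro nn_integral_mono moment)
    also have "\<dots> = ennreal c * (\<integral>\<^sup>+x. ennreal (norm (?N x)) \<partial>lborel)"
      by (rule nn_integral_cmult) measurable
    also have "\<dots> = ennreal c * ennreal (\<integral>x. norm (?N x) \<partial>lborel)"
      by (simp only: smoothed_grad_L1(1)[OF \<Omega> bd])
    also have "\<dots> \<le> ennreal c * ennreal ?P"
    proof (intro mult_left_mono ennreal_leI)
      show "(\<integral>x. norm (?N x) \<partial>lborel) \<le> ?P"
        using smoothed_grad_L1(2)[OF \<Omega> bd] per by (cases "Per \<Omega>") auto
    qed simp
    finally show "(\<integral>\<^sup>+h. \<integral>\<^sup>+x. k h * ennreal \<bar>h \<bullet> ?N x\<bar> \<partial>lborel \<partial>lborel) \<le> ennreal c * ennreal ?P" .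
  qed
  finally show "(\<integral>\<^sup>+h. k h * (\<integral>\<^sup>+x. ennreal \<bar>indicator \<Omega> (x + h) - indicator \<Omega> x\<bar> \<partial>lborel) \<partial>lborel)
    \<le> ennreal c * ennreal ?P + ennreal e" by (simp only: add.commute)
qed

subsection \<open>Moments of the occupation time of the bridge\<close>

text \<open>Unnormalised, that is, still multiplied by the transition density from x to y: this
  avoids dividing by it, and it is the weight that \<open>Psi\<close> carries anyway. The same holds
  for \<open>two_times\<close>.\<close>

definition single_time :: "'a::euclidean_space set \<Rightarrow> real \<Rightarrow> 'a \<Rightarrow> 'a \<Rightarrow> real \<Rightarrow> ennreal" where
  "single_time A t x y s =
     (\<integral>\<^sup>+z. ennreal (cauchy_kernel s x z) * (indicator A z * ennreal (cauchy_kernel (t - s) z y)) \<partial>lborel)"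

definition two_times :: "'a::euclidean_space set \<Rightarrow> real \<Rightarrow> 'a \<Rightarrow> 'a \<Rightarrow> real \<Rightarrow> real \<Rightarrow> ennreal" where
  "two_times A t x y s u =
     (\<integral>\<^sup>+z. \<integral>\<^sup>+w. ennreal (cauchy_kernel s x z) * (indicator A z * (ennreal (cauchy_kernel (u - s) z w)
        * (indicator A w * ennreal (cauchy_kernel (t - u) w y)))) \<partial>lborel \<partial>lborel)"

lemma bridge_single_time:
  fixes x y :: "'a::euclidean_space"
  assumes bridge: "is_cauchy_bridge x y t M X" and s: "0 < s" "s < t" and A[measurable]: "A \<in> sets borel"
  shows "ennreal (cauchy_kernel t x y) * emeasure M {\<omega> \<in> space M. X s \<omega> \<in> A} = single_time A t x y s"
proof -
  interpret lb: product_sigma_finite "\<lambda>_::nat. lborel::'a measure" by standard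
  have I: "{..<1::nat} = {0}" by auto
  have "ennreal (cauchy_kernel t x y) * emeasure M {\<omega> \<in> space M. X s \<omega> \<in> A}
     = (\<integral>\<^sup>+z. ennreal ((\<Prod>i<1. indicator A (z i)) * bridge_chain x y t 1 (\<lambda>_. s) z) \<partial>PiM {..<1::nat} (\<lambda>_. lborel))"
  proof -
    have "\<forall>(k::nat) (s::nat \<Rightarrow> real) (A::nat \<Rightarrow> 'a set).
        1 \<le> k \<and> (\<forall>i<k. A i \<in> sets borel) \<and> 0 < s 0 \<and>
        (\<forall>i. Suc i < k \<longrightarrow> s i < s (Suc i)) \<and> s (k - 1) < t \<longrightarrow>
        ennreal (cauchy_kernel t x y) * emeasure M {\<omega> \<in> space M. \<forall>i<k. X (s i) \<omega> \<in> A i}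
        = (\<integral>\<^sup>+ z. ennreal ((\<Prod>i<k. indicator (A i) (z i)) * bridge_chain x y t k s z)
             \<partial>(PiM {..<k} (\<lambda>_. lborel)))"
      using bridge unfolding is_cauchy_bridge_def by (elim conjE)
    from this[rule_format, of 1 "\<lambda>_. A" "\<lambda>_. s"] s A show ?thesis by simp
  qed
  also have "\<dots> = (\<integral>\<^sup>+z. ennreal (indicator A (z 0) * (cauchy_kernel s x (z 0) * cauchy_kernel (t - s) (z 0) y)) \<partial>PiM {0::nat} (\<lambda>_. lborel))"
    unfolding I by (simp add: bridge_chain_def)
  also have "\<dots> = (\<integral>\<^sup>+z. ennreal (indicator A z * (cauchy_kernel s x z * cauchy_kernel (t - s) z y)) \<partial>lborel)"
    by (rule lb.product_nn_integral_singleton[where f="\<lambda>z. ennreal (indicator A z * (cauchy_kernel s x z * cauchy_kernel (t - s) z y))"]) measurable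
  also have "\<dots> = single_time A t x y s"
    unfolding single_time_def using s
    by (intro nn_integral_cong) (auto simp: indicator_def ennreal_mult cauchy_kernel_nonneg)
  finally show ?thesis .
qed

lemma bridge_two_times:
  fixes x y :: "'a::euclidean_space"
  assumes bridge: "is_cauchy_bridge x y t M X" and s: "0 < s" "s < u" "u < t" and A[measurable]: "A \<in> sets borel"
  shows "ennreal (cauchy_kernel t x y) * emeasure M {\<omega> \<in> space M. X s \<omega> \<in> A \<and> X u \<omega> \<in> A} = two_times A t x y s u"
proof -
  interpret lb: product_sigma_finite "\<lambda>_::nat. lborel::'a measure" by standard
  \<comment> \<open>Inserting 1 into \<open>{0}\<close>, rather than the reverse, makes the later
    position the inner variable, as in \<open>two_times\<close>.\<close>
  have I: "{..<2::nat} = insert 1 {0}" by auto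
  let ?s = "\<lambda>i::nat. if i = 0 then s else u"
  let ?F = "\<lambda>a b. ennreal (indicator A a * indicator A b * (cauchy_kernel s x a * cauchy_kernel (u - s) a b * cauchy_kernel (t - u) b y))"
  have "ennreal (cauchy_kernel t x y) * emeasure M {\<omega> \<in> space M. \<forall>i<2. X (?s i) \<omega> \<in> A}
     = (\<integral>\<^sup>+z. ennreal ((\<Prod>i<2. indicator A (z i)) * bridge_chain x y t 2 ?s z) \<partial>PiM {..<2::nat} (\<lambda>_. lborel))"
  proof -
    have fdd: "\<forall>(k::nat) (s::nat \<Rightarrow> real) (A::nat \<Rightarrow> 'a set).
        1 \<le> k \<and> (\<forall>i<k. A i \<in> sets borel) \<and> 0 < s 0 \<and>
        (\<forall>i. Suc i < k \<longrightarrow> s i < s (Suc i)) \<and> s (k - 1) < t \<longrightarrow>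
        ennreal (cauchy_kernel t x y) * emeasure M {\<omega> \<in> space M. \<forall>i<k. X (s i) \<omega> \<in> A i}
        = (\<integral>\<^sup>+ z. ennreal ((\<Prod>i<k. indicator (A i) (z i)) * bridge_chain x y t k s z)
             \<partial>(PiM {..<k} (\<lambda>_. lborel)))"
      using bridge unfolding is_cauchy_bridge_def by (elim conjE)
    have H: "1 \<le> (2::nat) \<and> (\<forall>i<2::nat. A \<in> sets borel) \<and> 0 < ?s 0 \<and>
        (\<forall>i. Suc i < 2 \<longrightarrow> ?s i < ?s (Suc i)) \<and> ?s (2 - 1) < t"
      using s A by auto
    from fdd[rule_format, of 2 "\<lambda>_. A" ?s, OF H] show ?thesis .
  qed
  also have "{\<omega> \<in> space M. \<forall>i<2. X (?s i) \<omega> \<in> A} = {\<omega> \<in> space M. X s \<omega> \<in> A \<and> X u \<omega> \<in> A}"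
    by (auto simp: less_2_cases_iff)
  also have "(\<integral>\<^sup>+z. ennreal ((\<Prod>i<2. indicator A (z i)) * bridge_chain x y t 2 ?s z) \<partial>PiM {..<2::nat} (\<lambda>_. lborel))
    = (\<integral>\<^sup>+z. ?F (z 0) (z 1) \<partial>PiM (insert 1 {0::nat}) (\<lambda>_. lborel))"
  proof -
    have 1: "(\<Prod>i<2. f i) = f 0 * f 1" for f :: "nat \<Rightarrow> real" by (simp add: numeral_2_eq_2)
    have 2: "bridge_chain x y t 2 ?s z = cauchy_kernel s x (z 0) * cauchy_kernel (u - s) (z 0) (z 1) * cauchy_kernel (t - u) (z 1) y" for z
      by (simp add: bridge_chain_def)
    show ?thesis unfolding I[symmetric] 1 2 ..
  qed
  also have "\<dots> = (\<integral>\<^sup>+z. (\<integral>\<^sup>+w. ?F ((z(1 := w)) 0) ((z(1 := w)) 1) \<partial>lborel) \<partial>PiM {0::nat} (\<lambda>_. lborel))"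
  proof (rule lb.product_nn_integral_insert)
    have [measurable]: "(\<lambda>z. z 0) \<in> measurable (PiM (insert 1 {0::nat}) (\<lambda>_. lborel)) (borel :: 'a measure)"
      "(\<lambda>z. z 1) \<in> measurable (PiM (insert 1 {0::nat}) (\<lambda>_. lborel)) (borel :: 'a measure)"
      by (simp_all add: measurable_component_singleton flip: measurable_lborel2)
    show "(\<lambda>z. ?F (z 0) (z 1)) \<in> borel_measurable (PiM (insert 1 {0::nat}) (\<lambda>_. lborel))"
      by measurable
  qed auto
  also have "\<dots> = (\<integral>\<^sup>+z. (\<integral>\<^sup>+w. ?F (z 0) w \<partial>lborel) \<partial>PiM {0::nat} (\<lambda>_. lborel))" by simp
  also have "\<dots> = (\<integral>\<^sup>+z. (\<integral>\<^sup>+w. ?F z w \<partial>lborel) \<partial>lborel)"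
    by (rule lb.product_nn_integral_singleton[where f="\<lambda>z. \<integral>\<^sup>+w. ?F z w \<partial>lborel"]) measurable
  also have "\<dots> = two_times A t x y s u"
    unfolding two_times_def using s
    by (intro nn_integral_cong) (auto simp: indicator_def ennreal_mult cauchy_kernel_nonneg mult_ac)
  finally show ?thesis .
qed

text \<open>The completion contains all subsets of null sets. Functionals of a merely Lebesgue
  measurable \<Omega> are measurable only in this sense.\<close>

lemma borel_measurable_completion_AE:
  fixes f g :: "'a \<Rightarrow> real"
  assumes [measurable]: "f \<in> borel_measurable M" and ae: "AE x in M. f x = g x"
  shows "g \<in> borel_measurable (completion M)"
proof -
  obtain N where N: "{x \<in> space M. f x \<noteq> g x} \<subseteq> N" "N \<in> null_sets M"
    using ae by (auto elim!: AE_E simp: null_sets_def)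
  show ?thesis
  proof (rule measurableI)
    fix S :: "real set" assume [measurable]: "S \<in> sets borel"
    have eq: "g -` S \<inter> space (completion M)
      = (f -` S \<inter> space M - N) \<union> (g -` S \<inter> space M \<inter> N)"
      using N(1) by auto
    have "g -` S \<inter> space M \<inter> N \<in> sets (completion M)"
      using N(2) by (intro null_setsD2 null_sets_completion_subset[OF _ null_sets_completionI]) auto
    moreover have "f -` S \<inter> space M - N \<in> sets (completion M)"
      using N(2) by (intro sets_completionI_sets) auto
    ultimately show "g -` S \<inter> space (completion M) \<in> sets (completion M)" unfolding eq by auto
  qed simp
qed

lemma indicator_interval_measurable[measurable (raw)]:
  fixes f g h :: "'z \<Rightarrow> real"
  assumes [measurable]: "f \<in> borel_measurable M" "g \<in> borel_measurable M" "h \<in> borel_measurable M"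
  shows "(\<lambda>p. indicator {f p<..<g p} (h p) :: ennreal) \<in> borel_measurable M"
  unfolding indicator_def greaterThanLessThan_iff by measurable

text \<open>Taylor expansion to third order, proved by integrating
  \<open>exp (- b) \<ge> 1 - b\<close> twice through \<open>f2\<close>, \<open>f1\<close>,
  \<open>f\<close>. The cubic term is traded for \<open>t\<^sup>2 / 6\<close> times
  \<open>a\<close>, so no third moment is needed. The square stands on the left so that the
  inequality transfers to \<open>ennreal\<close> without subtraction.\<close>

lemma exp_minus_bound:
  assumes "0 \<le> (a::real)" "a \<le> t"
  shows "1 - exp (- a) + a\<^sup>2 / 2 \<le> (1 + t\<^sup>2 / 6) * a"
proof -
  have "1 - a + a\<^sup>2 / 2 - a ^ 3 / 6 \<le> exp (- a)"
  proof -
    define f where "f a = exp (- a) - (1 - a + a\<^sup>2 / 2 - a ^ 3 / 6)" for a :: real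
    define f1 where "f1 a = 1 - a + a\<^sup>2 / 2 - exp (- a)" for a :: real
    define f2 where "f2 a = exp (- a) - 1 + a" for a :: real
    have 2: "0 \<le> f2 b" for b using exp_ge_add_one_self[of "- b"] by (simp add: f2_def)
    have 1: "0 \<le> f1 b" if "0 \<le> b" for b
    proof -
      have "f1 0 \<le> f1 b"
      proof (rule DERIV_nonneg_imp_nondecreasing[OF that])
        fix c :: real
        have "DERIV f1 c :> f2 c"
          unfolding f1_def[abs_def] f2_def by (auto intro!: derivative_eq_intros)
        then show "\<exists>y. DERIV f1 c :> y \<and> 0 \<le> y" using 2 by blast
      qed
      then show ?thesis by (simp add: f1_def)
    qed
    have "f 0 \<le> f a"
    proof (rule DERIV_nonneg_imp_nondecreasing[OF assms(1)])
      fix b :: real assume "0 \<le> b"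
      moreover have "DERIV f b :> f1 b"
        unfolding f_def[abs_def] f1_def by (auto intro!: derivative_eq_intros simp: power2_eq_square)
      ultimately show "\<exists>y. DERIV f b :> y \<and> 0 \<le> y" using 1 by blast
    qed
    then show ?thesis by (simp add: f_def)
  qed
  moreover have "a ^ 3 \<le> t\<^sup>2 * a"
  proof -
    have "a * a * a \<le> t * t * a" using assms by (intro mult_right_mono mult_mono) auto
    then show ?thesis by (simp add: power2_eq_square power3_eq_cube)
  qed
  ultimately show ?thesis by (simp add: algebra_simps)
qed

text \<open>The pointwise bound on \<open>1 - exp (- a)\<close> integrated over the paths of one
  bridge and multiplied by the transition density. The double time integral on the left is a lower
  bound for half the second moment of the occupation time.\<close>

lemma bridge_expect_bound:
  fixes x y :: "'a::euclidean_space"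
  assumes bridge: "is_cauchy_bridge x y t M X" and t: "0 < t"
    and A[measurable]: "A \<in> sets borel" and N: "N \<in> null_sets lborel" and \<Omega>: "A \<subseteq> \<Omega>" "\<Omega> \<subseteq> A \<union> N"
  shows "bridge_expect M X t \<Omega> \<le> 1"
    and "ennreal (cauchy_kernel t x y * (1 - bridge_expect M X t \<Omega>))
        + (\<integral>\<^sup>+u. \<integral>\<^sup>+s. indicator {0<..<t} u * (indicator {0<..<u} s * two_times A t x y s u) \<partial>lborel \<partial>lborel)
      \<le> ennreal (1 + t\<^sup>2 / 6) * (\<integral>\<^sup>+s. indicator {0<..<t} s * single_time A t x y s \<partial>lborel)"
proof -
  have prob: "prob_space M" and X: "(\<lambda>(s, \<omega>). X s \<omega>) \<in> borel_measurable (lborel \<Otimes>\<^sub>M M)"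
    using bridge by (auto simp: is_cauchy_bridge_def)
  interpret prob_space M by (rule prob)
  interpret LM: pair_sigma_finite lborel M ..
  interpret MT: pair_sigma_finite M lborel ..
  have [measurable]: "(\<lambda>z. X (f z) (g z)) \<in> borel_measurable P"
    if "f \<in> measurable P lborel" "g \<in> measurable P M" for f g and P :: "'z measure"
    using measurable_compose[OF measurable_Pair[OF that] X] by simp
  have [measurable]: "N \<in> sets borel" using N by auto
  let ?p = "cauchy_kernel t x y"
  have p: "0 < ?p" using t by (rule cauchy_kernel_pos)
  \<comment> \<open>The finite-dimensional distributions are prescribed only at times strictly
    between 0 and t; the open interval omits a null set of times.\<close>
  define I :: "real \<Rightarrow> ennreal" where "I = indicator {0<..<t}"
  have [measurable]: "I \<in> borel_measurable borel" by (simp add: I_def)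
  have N0: "single_time N t x y s = 0" for s
  proof -
    have "AE z in lborel. z \<notin> N" using N by (rule AE_not_in)
    then show ?thesis unfolding single_time_def
      by (subst nn_integral_0_iff_AE) (auto elim!: eventually_mono)
  qed
  \<comment> \<open>At each interior time the bridge has a density and so avoids the null set
    \<open>N\<close>; by Fubini almost every path spends zero time in \<open>N\<close>. Hence
    \<Omega> and \<open>A\<close> have the same occupation time almost surely.\<close>
  have "(\<integral>\<^sup>+\<omega>. \<integral>\<^sup>+s. I s * indicator N (X s \<omega>) \<partial>lborel \<partial>M) = (\<integral>\<^sup>+s. \<integral>\<^sup>+\<omega>. I s * indicator N (X s \<omega>) \<partial>M \<partial>lborel)"
    by (rule LM.Fubini') (simp add: case_prod_beta)
  also have "\<dots> = (\<integral>\<^sup>+s. 0 \<partial>(lborel :: real measure))"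
  proof (rule nn_integral_cong)
    fix s
    show "(\<integral>\<^sup>+\<omega>. I s * indicator N (X s \<omega>) \<partial>M) = 0"
    proof (cases "s \<in> {0<..<t}")
      case True
      have "(\<integral>\<^sup>+\<omega>. indicator N (X s \<omega>) \<partial>M) = (\<integral>\<^sup>+\<omega>. indicator {\<omega> \<in> space M. X s \<omega> \<in> N} \<omega> \<partial>M)"
        by (rule nn_integral_cong) (simp add: indicator_def)
      also have "\<dots> = emeasure M {\<omega> \<in> space M. X s \<omega> \<in> N}" by (rule nn_integral_indicator) measurable
      also have "\<dots> = 0"
        using bridge_single_time[OF bridge, of s N] True p by (simp add: N0 ennreal_eq_0_iff not_le)
      finally show ?thesis by (simp add: nn_integral_cmult)
    qed (simp add: I_def)
  qed
  finally have "(\<integral>\<^sup>+\<omega>. \<integral>\<^sup>+s. I s * indicator N (X s \<omega>) \<partial>lborel \<partial>M) = 0" by simp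
  then have aeN: "AE \<omega> in M. (\<integral>\<^sup>+s. I s * indicator N (X s \<omega>) \<partial>lborel) = 0"
    by (subst (asm) nn_integral_0_iff_AE) auto
  define occ where "occ \<omega> = (\<integral>\<^sup>+s. I s * indicator A (X s \<omega>) \<partial>lborel)" for \<omega>
  have [measurable]: "occ \<in> borel_measurable M" unfolding occ_def[abs_def] by measurable
  have occ_le: "occ \<omega> \<le> ennreal t" for \<omega>
  proof -
    have "occ \<omega> \<le> (\<integral>\<^sup>+s. I s \<partial>lborel)" unfolding occ_def
      by (intro nn_integral_mono) (auto simp: indicator_def)
    also have "\<dots> = ennreal t" using t by (simp add: I_def)
    finally show ?thesis .
  qed
  define a where "a \<omega> = enn2real (occ \<omega>)" for \<omega>
  have [measurable]: "a \<in> borel_measurable M" unfolding a_def[abs_def] by measurable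
  have occ_a: "occ \<omega> = ennreal (a \<omega>)" for \<omega>
    using occ_le[of \<omega>] unfolding a_def by (metis ennreal_enn2real ennreal_less_top le_less_trans)
  have a0: "0 \<le> a \<omega>" for \<omega> by (simp add: a_def)
  have at: "a \<omega> \<le> t" for \<omega> using occ_le[of \<omega>] t by (simp add: occ_a)
  have A_eq: "(LINT s:{0..t}|lebesgue. indicator \<Omega> (X s \<omega>)) = a \<omega>"
    if \<omega>: "\<omega> \<in> space M" and n: "(\<integral>\<^sup>+s. I s * indicator N (X s \<omega>) \<partial>lborel) = 0" for \<omega>
  proof -
    have [measurable]: "(\<lambda>s. X s \<omega>) \<in> borel_measurable borel"
      using measurable_Pair2[of "\<lambda>(s, \<omega>). X s \<omega>"] X \<omega> by (auto dest: measurable_Pair1)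
    have "AE s in lborel. I s * indicator N (X s \<omega>) = 0"
      using n by (subst (asm) nn_integral_0_iff_AE) auto
    moreover have "AE s in lborel. s \<noteq> 0" "AE s in lborel. s \<noteq> t" by (rule AE_lborel_singleton)+
    ultimately have ae: "AE s in lborel. indicator {0<..<t} s * indicator A (X s \<omega>) = indicator {0..t} s * (indicator \<Omega> (X s \<omega>) :: real)"
      by eventually_elim (use \<Omega> in \<open>auto simp: I_def indicator_def split: if_splits\<close>)
    have "(LINT s:{0..t}|lebesgue. indicator \<Omega> (X s \<omega>)) = (\<integral>s. indicator {0..t} s * (indicator \<Omega> (X s \<omega>) :: real) \<partial>lebesgue)"
      by (simp add: set_lebesgue_integral_def)
    also have "\<dots> = (\<integral>s. indicator {0<..<t} s * (indicator A (X s \<omega>) :: real) \<partial>lebesgue)"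
    proof (rule integral_cong_AE)
      show "(\<lambda>s. indicator {0..t} s * (indicator \<Omega> (X s \<omega>) :: real)) \<in> borel_measurable lebesgue"
        by (rule borel_measurable_completion_AE[OF _ ae]) measurable
      show "(\<lambda>s. indicator {0<..<t} s * (indicator A (X s \<omega>) :: real)) \<in> borel_measurable lebesgue"
        by (intro measurable_completion) measurable
      show "AE s in lebesgue. indicator {0..t} s * (indicator \<Omega> (X s \<omega>) :: real) = indicator {0<..<t} s * indicator A (X s \<omega>)"
        using AE_completion[OF ae] by eventually_elim simp
    qed
    also have "\<dots> = (\<integral>s. indicator {0<..<t} s * (indicator A (X s \<omega>) :: real) \<partial>lborel)"
      by (rule integral_completion) measurable
    also have "\<dots> = enn2real (\<integral>\<^sup>+s. ennreal (indicator {0<..<t} s * indicator A (X s \<omega>)) \<partial>lborel)"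
      by (rule integral_eq_nn_integral) auto
    also have "(\<integral>\<^sup>+s. ennreal (indicator {0<..<t} s * indicator A (X s \<omega>)) \<partial>lborel) = occ \<omega>"
      unfolding occ_def I_def by (intro nn_integral_cong) (auto simp: indicator_def)
    finally show ?thesis by (simp add: a_def)
  qed
  have ae: "AE \<omega> in M. exp (- a \<omega>) = exp (- (LINT s:{0..t}|lebesgue. indicator \<Omega> (X s \<omega>)))"
    using aeN AE_space by eventually_elim (simp add: A_eq)
  have "bridge_expect M X t \<Omega> = (\<integral>\<omega>. exp (- a \<omega>) \<partial>completion M)"
    unfolding bridge_expect_def
  proof (rule integral_cong_AE)
    show "(\<lambda>\<omega>. exp (- (LINT s:{0..t}|lebesgue. indicator \<Omega> (X s \<omega>))) :: real) \<in> borel_measurable (completion M)"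
    proof (rule borel_measurable_completion_AE)
      show "(\<lambda>\<omega>. exp (- a \<omega>)) \<in> borel_measurable M" by measurable
    qed (rule ae)
    show "(\<lambda>\<omega>. exp (- a \<omega>)) \<in> borel_measurable (completion M)" by (intro measurable_completion) measurable
    show "AE \<omega> in completion M. exp (- (LINT s:{0..t}|lebesgue. indicator \<Omega> (X s \<omega>))) = exp (- a \<omega>)"
      using AE_completion[OF ae] by eventually_elim simp
  qed
  also have "\<dots> = (\<integral>\<omega>. exp (- a \<omega>) \<partial>M)" by (rule integral_completion) measurable
  finally have E: "bridge_expect M X t \<Omega> = (\<integral>\<omega>. exp (- a \<omega>) \<partial>M)" .
  have int_exp: "integrable M (\<lambda>\<omega>. exp (- a \<omega>))"
    by (rule integrable_const_bound[where B=1]) (use a0 in auto)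
  have E1: "1 - bridge_expect M X t \<Omega> = (\<integral>\<omega>. 1 - exp (- a \<omega>) \<partial>M)"
    unfolding E using int_exp by (simp add: prob_space)
  have pos: "0 \<le> 1 - exp (- a \<omega>)" for \<omega> using a0 by simp
  show "bridge_expect M X t \<Omega> \<le> 1"
  proof -
    have "0 \<le> (\<integral>\<omega>. 1 - exp (- a \<omega>) \<partial>M)" by (rule Bochner_Integration.integral_nonneg) (rule pos)
    then show ?thesis using E1 by linarith
  qed
  have E2: "ennreal (1 - bridge_expect M X t \<Omega>) = (\<integral>\<^sup>+\<omega>. ennreal (1 - exp (- a \<omega>)) \<partial>M)"
    unfolding E1 using int_exp pos by (intro nn_integral_eq_integral[symmetric]) auto
  have "(\<integral>\<^sup>+\<omega>. ennreal (1 - exp (- a \<omega>)) + ennreal (1/2) * (occ \<omega> * occ \<omega>) \<partial>M) \<le> (\<integral>\<^sup>+\<omega>. ennreal (1 + t\<^sup>2 / 6) * occ \<omega> \<partial>M)"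
  proof (rule nn_integral_mono)
    fix \<omega>
    have "ennreal (1 - exp (- a \<omega>)) + ennreal (1/2) * (occ \<omega> * occ \<omega>) = ennreal (1 - exp (- a \<omega>) + (a \<omega>)\<^sup>2 / 2)"
    proof -
      have "ennreal ((a \<omega>)\<^sup>2 / 2) = ennreal (1/2 * (a \<omega> * a \<omega>))" by (simp add: power2_eq_square)
      also have "\<dots> = ennreal (1/2) * ennreal (a \<omega> * a \<omega>)" by (rule ennreal_mult) (use a0 in auto)
      also have "ennreal (a \<omega> * a \<omega>) = occ \<omega> * occ \<omega>" unfolding occ_a by (rule ennreal_mult) (use a0 in auto)
      finally show ?thesis using pos[of \<omega>] by (subst ennreal_plus) auto
    qed
    also have "\<dots> \<le> ennreal ((1 + t\<^sup>2 / 6) * a \<omega>)" by (intro ennreal_leI exp_minus_bound a0 at)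
    also have "\<dots> = ennreal (1 + t\<^sup>2 / 6) * occ \<omega>" unfolding occ_a by (rule ennreal_mult) (auto simp: a0)
    finally show "ennreal (1 - exp (- a \<omega>)) + ennreal (1/2) * (occ \<omega> * occ \<omega>) \<le> ennreal (1 + t\<^sup>2 / 6) * occ \<omega>" .
  qed
  also have "(\<integral>\<^sup>+\<omega>. ennreal (1 - exp (- a \<omega>)) + ennreal (1/2) * (occ \<omega> * occ \<omega>) \<partial>M)
    = ennreal (1 - bridge_expect M X t \<Omega>) + ennreal (1/2) * (\<integral>\<^sup>+\<omega>. occ \<omega> * occ \<omega> \<partial>M)"
    unfolding E2 by (simp add: nn_integral_add nn_integral_cmult)
  also have "(\<integral>\<^sup>+\<omega>. ennreal (1 + t\<^sup>2 / 6) * occ \<omega> \<partial>M) = ennreal (1 + t\<^sup>2 / 6) * (\<integral>\<^sup>+\<omega>. occ \<omega> \<partial>M)"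
    by (rule nn_integral_cmult) measurable
  finally have main: "ennreal (1 - bridge_expect M X t \<Omega>) + ennreal (1/2) * (\<integral>\<^sup>+\<omega>. occ \<omega> * occ \<omega> \<partial>M)
     \<le> ennreal (1 + t\<^sup>2 / 6) * (\<integral>\<^sup>+\<omega>. occ \<omega> \<partial>M)" .
  have first: "ennreal ?p * (\<integral>\<^sup>+\<omega>. occ \<omega> \<partial>M) = (\<integral>\<^sup>+s. indicator {0<..<t} s * single_time A t x y s \<partial>lborel)"
  proof -
    have "(\<integral>\<^sup>+\<omega>. occ \<omega> \<partial>M) = (\<integral>\<^sup>+s. \<integral>\<^sup>+\<omega>. I s * indicator A (X s \<omega>) \<partial>M \<partial>lborel)"
      unfolding occ_def by (rule LM.Fubini') (simp add: case_prod_beta)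
    also have "ennreal ?p * \<dots> = (\<integral>\<^sup>+s. ennreal ?p * (\<integral>\<^sup>+\<omega>. I s * indicator A (X s \<omega>) \<partial>M) \<partial>lborel)"
      by (rule nn_integral_cmult[symmetric]) measurable
    also have "\<dots> = (\<integral>\<^sup>+s. indicator {0<..<t} s * single_time A t x y s \<partial>lborel)"
    proof (rule nn_integral_cong)
      fix s
      show "ennreal ?p * (\<integral>\<^sup>+\<omega>. I s * indicator A (X s \<omega>) \<partial>M) = indicator {0<..<t} s * single_time A t x y s"
      proof (cases "s \<in> {0<..<t}")
        case True
        have "(\<integral>\<^sup>+\<omega>. I s * indicator A (X s \<omega>) \<partial>M) = (\<integral>\<^sup>+\<omega>. indicator {\<omega> \<in> space M. X s \<omega> \<in> A} \<omega> \<partial>M)"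
          using True by (intro nn_integral_cong) (simp add: indicator_def I_def)
        also have "\<dots> = emeasure M {\<omega> \<in> space M. X s \<omega> \<in> A}" by (rule nn_integral_indicator) measurable
        finally show ?thesis using bridge_single_time[OF bridge _ _ A, of s] True by simp
      qed (simp add: I_def)
    qed
    finally show ?thesis .
  qed
  let ?J = "\<integral>\<^sup>+u. \<integral>\<^sup>+s. indicator {0<..<t} u * (indicator {0<..<u} s * two_times A t x y s u) \<partial>lborel \<partial>lborel"
  have second: "?J \<le> ennreal ?p * (ennreal (1/2) * (\<integral>\<^sup>+\<omega>. occ \<omega> * occ \<omega> \<partial>M))"
  proof -
    let ?g = "\<lambda>\<omega> u s. I u * (indicator {0<..<u} s * (indicator A (X s \<omega>) * indicator A (X u \<omega>))) :: ennreal"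
    \<comment> \<open>The regions s < u and u < s are disjoint in the square and carry equal
      integrals by symmetry, so twice one of them is at most the squared occupation time. Only this
      direction is required.\<close>
    have half: "(\<integral>\<^sup>+u. \<integral>\<^sup>+s. ?g \<omega> u s \<partial>lborel \<partial>lborel) \<le> ennreal (1/2) * (occ \<omega> * occ \<omega>)" if \<omega>: "\<omega> \<in> space M" for \<omega>
    proof -
      have [measurable]: "(\<lambda>s. X s \<omega>) \<in> borel_measurable borel"
        using X \<omega> by (auto dest: measurable_Pair1)
      have gm: "(\<lambda>p. ?g \<omega> (fst p) (snd p)) \<in> borel_measurable (lborel \<Otimes>\<^sub>M lborel)"
        "(\<lambda>p. ?g \<omega> (snd p) (fst p)) \<in> borel_measurable (lborel \<Otimes>\<^sub>M lborel)" by measurable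
      have swap: "(\<integral>\<^sup>+u. \<integral>\<^sup>+s. ?g \<omega> u s \<partial>lborel \<partial>lborel) = (\<integral>\<^sup>+u. \<integral>\<^sup>+s. ?g \<omega> s u \<partial>lborel \<partial>lborel)"
        by (rule lborel_pair.Fubini') (use gm in \<open>simp add: case_prod_beta\<close>)
      have "(\<integral>\<^sup>+u. \<integral>\<^sup>+s. ?g \<omega> u s \<partial>lborel \<partial>lborel) + (\<integral>\<^sup>+u. \<integral>\<^sup>+s. ?g \<omega> u s \<partial>lborel \<partial>lborel)
        = (\<integral>\<^sup>+u. \<integral>\<^sup>+s. ?g \<omega> u s \<partial>lborel \<partial>lborel) + (\<integral>\<^sup>+u. \<integral>\<^sup>+s. ?g \<omega> s u \<partial>lborel \<partial>lborel)" by (simp only: swap)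
      also have "\<dots> = (\<integral>\<^sup>+u. (\<integral>\<^sup>+s. ?g \<omega> u s \<partial>lborel) + (\<integral>\<^sup>+s. ?g \<omega> s u \<partial>lborel) \<partial>lborel)"
        using gm by (intro nn_integral_add[symmetric] lborel.borel_measurable_nn_integral) (simp_all add: case_prod_beta)
      also have "\<dots> = (\<integral>\<^sup>+u. \<integral>\<^sup>+s. ?g \<omega> u s + ?g \<omega> s u \<partial>lborel \<partial>lborel)"
        by (intro nn_integral_cong nn_integral_add[symmetric]) measurable
      also have "\<dots> \<le> (\<integral>\<^sup>+u. \<integral>\<^sup>+s. (I u * indicator A (X u \<omega>)) * (I s * indicator A (X s \<omega>)) \<partial>lborel \<partial>lborel)"
        by (intro nn_integral_mono) (auto simp: I_def indicator_def)
      also have "\<dots> = (\<integral>\<^sup>+u. (I u * indicator A (X u \<omega>)) * occ \<omega> \<partial>lborel)"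
        unfolding occ_def by (intro nn_integral_cong nn_integral_cmult) measurable
      also have "\<dots> = occ \<omega> * occ \<omega>"
        by (subst nn_integral_multc) (auto simp: occ_def)
      finally have le: "(\<integral>\<^sup>+u. \<integral>\<^sup>+s. ?g \<omega> u s \<partial>lborel \<partial>lborel) + (\<integral>\<^sup>+u. \<integral>\<^sup>+s. ?g \<omega> u s \<partial>lborel \<partial>lborel) \<le> occ \<omega> * occ \<omega>" .
      have "(\<integral>\<^sup>+u. \<integral>\<^sup>+s. ?g \<omega> u s \<partial>lborel \<partial>lborel) = ennreal (1/2) * ((\<integral>\<^sup>+u. \<integral>\<^sup>+s. ?g \<omega> u s \<partial>lborel \<partial>lborel) + (\<integral>\<^sup>+u. \<integral>\<^sup>+s. ?g \<omega> u s \<partial>lborel \<partial>lborel))"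
      proof -
        have "ennreal (1/2) * (c + c) = c" for c
        proof -
          have "ennreal (1/2) * (c + c) = (ennreal (1/2) + ennreal (1/2)) * c" by (simp only: distrib_left distrib_right)
          also have "ennreal (1/2) + ennreal (1/2) = 1" by (subst ennreal_plus[symmetric]) auto
          finally show ?thesis by simp
        qed
        then show ?thesis by simp
      qed
      also have "\<dots> \<le> ennreal (1/2) * (occ \<omega> * occ \<omega>)" by (intro mult_left_mono le) simp
      finally show ?thesis .
    qed
    have "?J = (\<integral>\<^sup>+u. \<integral>\<^sup>+s. ennreal ?p * (\<integral>\<^sup>+\<omega>. ?g \<omega> u s \<partial>M) \<partial>lborel \<partial>lborel)"
    proof (intro nn_integral_cong)
      fix u s :: real
      show "indicator {0<..<t} u * (indicator {0<..<u} s * two_times A t x y s u) = ennreal ?p * (\<integral>\<^sup>+\<omega>. ?g \<omega> u s \<partial>M)"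
      proof (cases "u \<in> {0<..<t} \<and> s \<in> {0<..<u}")
        case True
        have "(\<integral>\<^sup>+\<omega>. ?g \<omega> u s \<partial>M) = (\<integral>\<^sup>+\<omega>. indicator {\<omega> \<in> space M. X s \<omega> \<in> A \<and> X u \<omega> \<in> A} \<omega> \<partial>M)"
          using True by (intro nn_integral_cong) (auto simp add: indicator_def I_def)
        also have "\<dots> = emeasure M {\<omega> \<in> space M. X s \<omega> \<in> A \<and> X u \<omega> \<in> A}" by (rule nn_integral_indicator) measurable
        finally show ?thesis using bridge_two_times[OF bridge _ _ _ A, of s u] True by simp
      qed (auto simp: I_def indicator_def)
    qed
    also have "\<dots> = (\<integral>\<^sup>+u. ennreal ?p * (\<integral>\<^sup>+s. \<integral>\<^sup>+\<omega>. ?g \<omega> u s \<partial>M \<partial>lborel) \<partial>lborel)"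
      by (intro nn_integral_cong nn_integral_cmult) measurable
    also have "\<dots> = ennreal ?p * (\<integral>\<^sup>+u. \<integral>\<^sup>+s. \<integral>\<^sup>+\<omega>. ?g \<omega> u s \<partial>M \<partial>lborel \<partial>lborel)"
      by (rule nn_integral_cmult) measurable
    also have "(\<integral>\<^sup>+u. \<integral>\<^sup>+s. \<integral>\<^sup>+\<omega>. ?g \<omega> u s \<partial>M \<partial>lborel \<partial>lborel) = (\<integral>\<^sup>+u. \<integral>\<^sup>+\<omega>. \<integral>\<^sup>+s. ?g \<omega> u s \<partial>lborel \<partial>M \<partial>lborel)"
      by (intro nn_integral_cong MT.Fubini') (simp add: case_prod_beta)
    also have "\<dots> = (\<integral>\<^sup>+\<omega>. \<integral>\<^sup>+u. \<integral>\<^sup>+s. ?g \<omega> u s \<partial>lborel \<partial>lborel \<partial>M)"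
      by (rule MT.Fubini') (simp add: case_prod_beta)
    also have "ennreal ?p * \<dots> \<le> ennreal ?p * (\<integral>\<^sup>+\<omega>. ennreal (1/2) * (occ \<omega> * occ \<omega>) \<partial>M)"
      by (intro mult_left_mono nn_integral_mono half) auto
    also have "(\<integral>\<^sup>+\<omega>. ennreal (1/2) * (occ \<omega> * occ \<omega>) \<partial>M) = ennreal (1/2) * (\<integral>\<^sup>+\<omega>. occ \<omega> * occ \<omega> \<partial>M)"
      by (rule nn_integral_cmult) measurable
    finally show ?thesis .
  qed
  have "ennreal (?p * (1 - bridge_expect M X t \<Omega>)) + ?J
    \<le> ennreal ?p * ennreal (1 - bridge_expect M X t \<Omega>) + ennreal ?p * (ennreal (1/2) * (\<integral>\<^sup>+\<omega>. occ \<omega> * occ \<omega> \<partial>M))"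
    using p by (intro add_mono second) (simp add: ennreal_mult')
  also have "\<dots> \<le> ennreal ?p * (ennreal (1 + t\<^sup>2 / 6) * (\<integral>\<^sup>+\<omega>. occ \<omega> \<partial>M))"
    unfolding distrib_left[symmetric] by (intro mult_left_mono main) simp
  also have "\<dots> = ennreal (1 + t\<^sup>2 / 6) * (\<integral>\<^sup>+s. indicator {0<..<t} s * single_time A t x y s \<partial>lborel)"
    unfolding first[symmetric] by (simp only: mult.left_commute)
  finally show "ennreal (?p * (1 - bridge_expect M X t \<Omega>)) + ?J
    \<le> ennreal (1 + t\<^sup>2 / 6) * (\<integral>\<^sup>+s. indicator {0<..<t} s * single_time A t x y s \<partial>lborel)" .
qed

subsection \<open>Integration over the endpoints and the heat content\<close>

lemma single_time_measurable[measurable (raw)]: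
  assumes [measurable]: "A \<in> sets borel" "f \<in> borel_measurable M" "g \<in> borel_measurable M" "h \<in> borel_measurable M"
  shows "(\<lambda>v. single_time A t (f v) (g v) (h v)) \<in> borel_measurable M"
  unfolding single_time_def by measurable

lemma two_times_measurable[measurable (raw)]:
  assumes [measurable]: "A \<in> sets borel" "f \<in> borel_measurable M" "g \<in> borel_measurable M"
    "h \<in> borel_measurable M" "k \<in> borel_measurable M"
  shows "(\<lambda>v. two_times A t (f v) (g v) (h v) (k v)) \<in> borel_measurable M"
  unfolding two_times_def by measurable

text \<open>Both kernels have mass one in the end point, so integrating y and then x leaves only the
  indicator.\<close>

lemma nn_integral_single_time:
  fixes A :: "'a::euclidean_space set"
  assumes s: "0 < s" "s < t" and A[measurable]: "A \<in> sets borel"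
  shows "(\<integral>\<^sup>+x. \<integral>\<^sup>+y. single_time A t x y s \<partial>lborel \<partial>lborel) = emeasure lborel A"
proof -
  have "(\<integral>\<^sup>+y. single_time A t x y s \<partial>lborel) = (\<integral>\<^sup>+z. ennreal (cauchy_kernel s x z) * indicator A z \<partial>lborel)" for x :: 'a
  proof -
    have "(\<integral>\<^sup>+y. single_time A t x y s \<partial>lborel)
      = (\<integral>\<^sup>+z. \<integral>\<^sup>+y. ennreal (cauchy_kernel s x z) * (indicator A z * ennreal (cauchy_kernel (t - s) z y)) \<partial>lborel \<partial>lborel)"
      unfolding single_time_def by (rule lborel_pair.Fubini') (simp add: case_prod_beta)
    also have "\<dots> = (\<integral>\<^sup>+z. ennreal (cauchy_kernel s x z) * indicator A z \<partial>lborel)"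
    proof (rule nn_integral_cong)
      fix z
      have "(\<integral>\<^sup>+y. ennreal (cauchy_kernel s x z) * indicator A z * ennreal (cauchy_kernel (t - s) z y) \<partial>lborel)
         = ennreal (cauchy_kernel s x z) * indicator A z * (\<integral>\<^sup>+y. ennreal (cauchy_kernel (t - s) z y) \<partial>lborel)"
        by (rule nn_integral_cmult) measurable
      then show "(\<integral>\<^sup>+y. ennreal (cauchy_kernel s x z) * (indicator A z * ennreal (cauchy_kernel (t - s) z y)) \<partial>lborel)
         = ennreal (cauchy_kernel s x z) * indicator A z"
        using s by (simp add: nn_integral_cauchy_kernel mult.assoc)
    qed
    finally show ?thesis .
  qed
  then have "(\<integral>\<^sup>+x. \<integral>\<^sup>+y. single_time A t x y s \<partial>lborel \<partial>lborel)
     = (\<integral>\<^sup>+x. \<integral>\<^sup>+z. ennreal (cauchy_kernel s x z) * indicator A z \<partial>lborel \<partial>(lborel::'a measure))" by simp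
  also have "\<dots> = (\<integral>\<^sup>+z. \<integral>\<^sup>+x. ennreal (cauchy_kernel s x z) * indicator A z \<partial>(lborel::'a measure) \<partial>lborel)"
    by (rule lborel_pair.Fubini') (simp add: case_prod_beta)
  also have "\<dots> = (\<integral>\<^sup>+z. indicator A z \<partial>lborel)"
  proof (rule nn_integral_cong)
    fix z
    have "(\<integral>\<^sup>+x. ennreal (cauchy_kernel s x z) * indicator A z \<partial>lborel) = (\<integral>\<^sup>+x. ennreal (cauchy_kernel s x z) \<partial>lborel) * indicator A z"
      by (rule nn_integral_multc) measurable
    then show "(\<integral>\<^sup>+x. ennreal (cauchy_kernel s x z) * indicator A z \<partial>lborel) = indicator A z"
      using s by (simp add: nn_integral_cauchy_kernel)
  qed
  finally show ?thesis by simp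
qed

definition heat_content :: "'a::euclidean_space set \<Rightarrow> real \<Rightarrow> ennreal" where
  "heat_content A r = (\<integral>\<^sup>+z. \<integral>\<^sup>+w. indicator A z * (ennreal (cauchy_kernel r z w) * indicator A w) \<partial>lborel \<partial>lborel)"

text \<open>The first and last kernels integrate to one; the middle one remains, and it depends on
  the time lag only.\<close>

lemma nn_integral_two_times:
  fixes A :: "'a::euclidean_space set"
  assumes s: "0 < s" "s < u" "u < t" and A[measurable]: "A \<in> sets borel"
  shows "(\<integral>\<^sup>+x. \<integral>\<^sup>+y. two_times A t x y s u \<partial>lborel \<partial>lborel) = heat_content A (u - s)"
proof -
  let ?T = "\<lambda>x z. ennreal (cauchy_kernel s x z)"
  let ?V = "\<lambda>z w. indicator A z * (ennreal (cauchy_kernel (u - s) z w) * indicator A w)"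
  have y: "(\<integral>\<^sup>+y. two_times A t x y s u \<partial>lborel) = (\<integral>\<^sup>+z. \<integral>\<^sup>+w. ?T x z * ?V z w \<partial>lborel \<partial>lborel)" for x :: 'a
  proof -
    have "(\<integral>\<^sup>+y. two_times A t x y s u \<partial>lborel) = (\<integral>\<^sup>+y. \<integral>\<^sup>+z. \<integral>\<^sup>+w. ?T x z * ?V z w * ennreal (cauchy_kernel (t - u) w y) \<partial>lborel \<partial>lborel \<partial>lborel)"
      unfolding two_times_def by (simp only: mult.assoc)
    also have "\<dots> = (\<integral>\<^sup>+z. \<integral>\<^sup>+y. \<integral>\<^sup>+w. ?T x z * ?V z w * ennreal (cauchy_kernel (t - u) w y) \<partial>lborel \<partial>lborel \<partial>lborel)"
      by (rule lborel_pair.Fubini') (simp add: case_prod_beta)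
    also have "\<dots> = (\<integral>\<^sup>+z. \<integral>\<^sup>+w. \<integral>\<^sup>+y. ?T x z * ?V z w * ennreal (cauchy_kernel (t - u) w y) \<partial>lborel \<partial>lborel \<partial>lborel)"
      by (intro nn_integral_cong lborel_pair.Fubini') (simp add: case_prod_beta)
    also have "\<dots> = (\<integral>\<^sup>+z. \<integral>\<^sup>+w. ?T x z * ?V z w \<partial>lborel \<partial>lborel)"
    proof (intro nn_integral_cong)
      fix z w :: 'a
      have "(\<integral>\<^sup>+y. ?T x z * ?V z w * ennreal (cauchy_kernel (t - u) w y) \<partial>lborel)
         = ?T x z * ?V z w * (\<integral>\<^sup>+y. ennreal (cauchy_kernel (t - u) w y) \<partial>lborel)"
        by (rule nn_integral_cmult) measurable
      then show "(\<integral>\<^sup>+y. ?T x z * ?V z w * ennreal (cauchy_kernel (t - u) w y) \<partial>lborel) = ?T x z * ?V z w"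
        using s by (simp add: nn_integral_cauchy_kernel)
    qed
    finally show ?thesis .
  qed
  have "(\<integral>\<^sup>+x. \<integral>\<^sup>+y. two_times A t x y s u \<partial>lborel \<partial>lborel)
    = (\<integral>\<^sup>+x. \<integral>\<^sup>+z. \<integral>\<^sup>+w. ?T x z * ?V z w \<partial>lborel \<partial>lborel \<partial>lborel)" by (simp only: y)
  also have "\<dots> = (\<integral>\<^sup>+z. \<integral>\<^sup>+x. \<integral>\<^sup>+w. ?T x z * ?V z w \<partial>lborel \<partial>lborel \<partial>lborel)"
    by (rule lborel_pair.Fubini') (simp add: case_prod_beta)
  also have "\<dots> = (\<integral>\<^sup>+z. \<integral>\<^sup>+w. \<integral>\<^sup>+x. ?T x z * ?V z w \<partial>lborel \<partial>lborel \<partial>lborel)"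
    by (intro nn_integral_cong lborel_pair.Fubini') (simp add: case_prod_beta)
  also have "\<dots> = heat_content A (u - s)"
    unfolding heat_content_def
  proof (intro nn_integral_cong)
    fix z w :: 'a
    have "(\<integral>\<^sup>+x. ?T x z * ?V z w \<partial>lborel) = (\<integral>\<^sup>+x. ?T x z \<partial>lborel) * ?V z w"
      by (rule nn_integral_multc) measurable
    then show "(\<integral>\<^sup>+x. ?T x z * ?V z w \<partial>lborel) = ?V z w"
      using s by (simp add: nn_integral_cauchy_kernel)
  qed
  finally show ?thesis .
qed

text \<open>Pulls a time integral out of both end point integrals, so that the mass-one identities
  can be used at fixed times.\<close>

lemma nn_integral_triple_swap:
  fixes f :: "real \<Rightarrow> 'a::euclidean_space \<Rightarrow> 'a \<Rightarrow> ennreal"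
  assumes [measurable]: "(\<lambda>(s, x, y). f s x y) \<in> borel_measurable (lborel \<Otimes>\<^sub>M lborel \<Otimes>\<^sub>M lborel)"
  shows "(\<integral>\<^sup>+x. \<integral>\<^sup>+y. \<integral>\<^sup>+s. f s x y \<partial>lborel \<partial>lborel \<partial>lborel) = (\<integral>\<^sup>+s. \<integral>\<^sup>+x. \<integral>\<^sup>+y. f s x y \<partial>lborel \<partial>lborel \<partial>lborel)"
proof -
  have [measurable]: "(\<lambda>p. f (g p) (h p) (k p)) \<in> borel_measurable M"
    if [measurable]: "g \<in> borel_measurable M" "h \<in> borel_measurable M" "k \<in> borel_measurable M" for g h k and M :: "'z measure"
    using measurable_compose[of "\<lambda>p. (g p, h p, k p)" M "lborel \<Otimes>\<^sub>M lborel \<Otimes>\<^sub>M lborel" "\<lambda>(s, x, y). f s x y" borel] assms by simp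
  have "(\<integral>\<^sup>+x. \<integral>\<^sup>+y. \<integral>\<^sup>+s. f s x y \<partial>lborel \<partial>lborel \<partial>lborel) = (\<integral>\<^sup>+x. \<integral>\<^sup>+s. \<integral>\<^sup>+y. f s x y \<partial>lborel \<partial>lborel \<partial>lborel)"
    by (intro nn_integral_cong lborel_pair.Fubini') (simp add: case_prod_beta)
  also have "\<dots> = (\<integral>\<^sup>+s. \<integral>\<^sup>+x. \<integral>\<^sup>+y. f s x y \<partial>lborel \<partial>lborel \<partial>lborel)"
    by (rule lborel_pair.Fubini') (simp add: case_prod_beta)
  finally show ?thesis .
qed

lemma nn_integral_occupation_first:
  fixes A :: "'a::euclidean_space set"
  assumes t: "0 < t" and A[measurable]: "A \<in> sets borel"
  shows "(\<integral>\<^sup>+x. \<integral>\<^sup>+y. \<integral>\<^sup>+s. indicator {0<..<t} s * single_time A t x y s \<partial>lborel \<partial>lborel \<partial>lborel)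
    = ennreal t * emeasure lborel A"
proof -
  have "(\<integral>\<^sup>+x. \<integral>\<^sup>+y. \<integral>\<^sup>+s. indicator {0<..<t} s * single_time A t x y s \<partial>lborel \<partial>lborel \<partial>lborel)
    = (\<integral>\<^sup>+s. \<integral>\<^sup>+x. \<integral>\<^sup>+y. indicator {0<..<t} s * single_time A t x y s \<partial>lborel \<partial>lborel \<partial>lborel)"
    by (rule nn_integral_triple_swap) (simp add: case_prod_beta)
  also have "\<dots> = (\<integral>\<^sup>+s. indicator {0<..<t} s * emeasure lborel A \<partial>(lborel :: real measure))"
  proof (rule nn_integral_cong)
    fix s :: real
    show "(\<integral>\<^sup>+x. \<integral>\<^sup>+y. indicator {0<..<t} s * single_time A t x y s \<partial>lborel \<partial>lborel) = indicator {0<..<t} s * emeasure lborel A"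
      by (cases "s \<in> {0<..<t}") (simp_all add: nn_integral_single_time)
  qed
  also have "\<dots> = ennreal t * emeasure lborel A"
    using t by (subst nn_integral_multc) auto
  finally show ?thesis .
qed

lemma nn_integral_occupation_second:
  fixes A :: "'a::euclidean_space set"
  assumes A[measurable]: "A \<in> sets borel"
  shows "(\<integral>\<^sup>+x. \<integral>\<^sup>+y. \<integral>\<^sup>+u. \<integral>\<^sup>+s. indicator {0<..<t} u * (indicator {0<..<u} s * two_times A t x y s u) \<partial>lborel \<partial>lborel \<partial>lborel \<partial>lborel)
    = (\<integral>\<^sup>+u. \<integral>\<^sup>+s. indicator {0<..<t} u * (indicator {0<..<u} s * heat_content A (u - s)) \<partial>lborel \<partial>lborel)"
proof -
  let ?f = "\<lambda>u s x y. indicator {0<..<t} u * (indicator {0<..<u} s * two_times A t x y s u)"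
  have "(\<integral>\<^sup>+x. \<integral>\<^sup>+y. \<integral>\<^sup>+u. \<integral>\<^sup>+s. ?f u s x y \<partial>lborel \<partial>lborel \<partial>lborel \<partial>lborel)
    = (\<integral>\<^sup>+u. \<integral>\<^sup>+x. \<integral>\<^sup>+y. \<integral>\<^sup>+s. ?f u s x y \<partial>lborel \<partial>lborel \<partial>lborel \<partial>lborel)"
    by (rule nn_integral_triple_swap) (simp add: case_prod_beta)
  also have "\<dots> = (\<integral>\<^sup>+u. \<integral>\<^sup>+s. \<integral>\<^sup>+x. \<integral>\<^sup>+y. ?f u s x y \<partial>lborel \<partial>lborel \<partial>lborel \<partial>lborel)"
    by (intro nn_integral_cong nn_integral_triple_swap) (simp add: case_prod_beta)
  also have "\<dots> = (\<integral>\<^sup>+u. \<integral>\<^sup>+s. indicator {0<..<t} u * (indicator {0<..<u} s * heat_content A (u - s)) \<partial>lborel \<partial>lborel)"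
  proof (intro nn_integral_cong)
    fix u s :: real
    show "(\<integral>\<^sup>+x. \<integral>\<^sup>+y. ?f u s x y \<partial>lborel \<partial>lborel) = indicator {0<..<t} u * (indicator {0<..<u} s * heat_content A (u - s))"
      by (cases "u \<in> {0<..<t} \<and> s \<in> {0<..<u}") (auto simp add: nn_integral_two_times)
  qed
  finally show ?thesis .
qed

text \<open>Rests on an identity for two 0-1 values p and q, namely 2 p q + |q - p| = p + q, taken
  at z and z + h: both terms on the right integrate to |A|, and the kernel has mass one. The
  additive form is valid in \<open>ennreal\<close> even if |A| is infinite.\<close>

lemma heat_content_deficit:
  fixes A :: "'a::euclidean_space set"
  assumes r: "0 < r" and A[measurable]: "A \<in> sets borel"
  shows "2 * heat_content A r
     + (\<integral>\<^sup>+h. ennreal (cauchy_kernel r 0 h) * (\<integral>\<^sup>+x. ennreal \<bar>indicator A (x + h) - indicator A x\<bar> \<partial>lborel) \<partial>lborel)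
     = 2 * emeasure lborel A"
proof -
  let ?k = "\<lambda>h::'a. ennreal (cauchy_kernel r 0 h)"
  let ?D = "\<lambda>h::'a. \<integral>\<^sup>+x. ennreal \<bar>indicator A (x + h) - indicator A x\<bar> \<partial>lborel"
  let ?P = "\<lambda>h::'a. \<integral>\<^sup>+z. (indicator A z * indicator A (z + h)) \<partial>lborel"
  have "heat_content A r = (\<integral>\<^sup>+z. \<integral>\<^sup>+h. ?k h * (indicator A z * indicator A (z + h)) \<partial>lborel \<partial>lborel)"
    unfolding heat_content_def
  proof (rule nn_integral_cong)
    fix z
    have "(\<integral>\<^sup>+w. ennreal (cauchy_kernel r z w) * (indicator A z * indicator A w) \<partial>lborel)
       = (\<integral>\<^sup>+h. ?k h * (indicator A z * indicator A (z + h)) \<partial>lborel)"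
      by (rule nn_integral_cauchy_kernel_translate) measurable
    then show "(\<integral>\<^sup>+w. indicator A z * (ennreal (cauchy_kernel r z w) * indicator A w) \<partial>lborel)
       = (\<integral>\<^sup>+h. ?k h * (indicator A z * indicator A (z + h)) \<partial>lborel)"
      by (simp only: mult.left_commute)
  qed
  also have "\<dots> = (\<integral>\<^sup>+h. \<integral>\<^sup>+z. ?k h * (indicator A z * indicator A (z + h)) \<partial>lborel \<partial>lborel)"
    by (rule lborel_pair.Fubini') (simp add: case_prod_beta)
  also have "\<dots> = (\<integral>\<^sup>+h. ?k h * ?P h \<partial>lborel)"
    by (intro nn_integral_cong nn_integral_cmult) measurable
  finally have "2 * heat_content A r = (\<integral>\<^sup>+h. 2 * (?k h * ?P h) \<partial>lborel)"
    by (simp add: nn_integral_cmult)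
  then have "2 * heat_content A r + (\<integral>\<^sup>+h. ?k h * ?D h \<partial>lborel) = (\<integral>\<^sup>+h. 2 * (?k h * ?P h) + ?k h * ?D h \<partial>lborel)"
    by (simp add: nn_integral_add)
  also have "\<dots> = (\<integral>\<^sup>+h. ?k h * (2 * emeasure lborel A) \<partial>lborel)"
  proof (rule nn_integral_cong)
    fix h :: 'a
    have "2 * ?P h + ?D h = (\<integral>\<^sup>+z. 2 * (indicator A z * indicator A (z + h)) + ennreal \<bar>indicator A (z + h) - indicator A z\<bar> \<partial>lborel)"
      by (simp add: nn_integral_add nn_integral_cmult)
    also have "\<dots> = (\<integral>\<^sup>+z. indicator A z + indicator A (h + z) \<partial>lborel)"
      by (rule nn_integral_cong) (auto simp: indicator_def add.commute)
    also have "\<dots> = (\<integral>\<^sup>+z. indicator A z \<partial>lborel) + (\<integral>\<^sup>+z. indicator A (h + z) \<partial>lborel)"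
      by (rule nn_integral_add) measurable
    also have "(\<integral>\<^sup>+z. indicator A (h + z) \<partial>lborel) = (\<integral>\<^sup>+z. indicator A z \<partial>lborel)"
      by (rule nn_integral_lborel_translate) measurable
    finally have *: "2 * emeasure lborel A = 2 * ?P h + ?D h" by (simp add: mult_2)
    show "2 * (?k h * ?P h) + ?k h * ?D h = ?k h * (2 * emeasure lborel A)"
      unfolding * distrib_left by (simp only: mult.left_commute)
  qed
  also have "\<dots> = (\<integral>\<^sup>+(h::'a). ?k h \<partial>lborel) * (2 * emeasure lborel A)"
    by (rule nn_integral_multc) measurable
  also have "\<dots> = 2 * emeasure lborel A" by (simp add: nn_integral_cauchy_kernel_0[OF r])
  finally show ?thesis .
qed

lemma Per_nonneg: "0 \<le> Per (A :: 'a::euclidean_space set)"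
proof -
  have "(\<lambda>_::'a. 0::'a) \<in> C1c_unit_fields" by (simp add: C1c_unit_fields_def)
  then have "ereal (LINT x:A|lebesgue. divergence (\<lambda>_::'a. 0::'a) x) \<le> Per A" unfolding Per_def by (rule SUP_upper)
  then show ?thesis by (simp add: divergence_def set_lebesgue_integral_def zero_ereal_def)
qed

text \<open>Splits the deficit at |h| = 1. Inside, the truncated kernel has mass at most 1 and the
  first moment above, so the perimeter estimate applies; outside, the L1 modulus is at most 2|A| and
  the tail is at most 2 d r, which gives 4 d |A| r.\<close>

lemma heat_content_lower:
  fixes A :: "'a::euclidean_space set"
  assumes r: "0 < r" "r \<le> 1" and A[measurable]: "A \<in> sets borel" and bd: "bounded A" and per: "Per A < \<infinity>"
  shows "2 * emeasure lborel A \<le> 2 * heat_content A r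
     + ennreal (r / pi * (2 * ln (1 / r) + ln 2) * real_of_ereal (Per A) + 4 * real DIM('a) * measure lborel A * r)"
proof -
  let ?k = "\<lambda>h::'a. ennreal (cauchy_kernel r 0 h)"
  let ?k1 = "\<lambda>h::'a. ennreal (cauchy_kernel r 0 h * indicator (ball 0 1) h)"
  let ?D = "\<lambda>h::'a. \<integral>\<^sup>+x. ennreal \<bar>indicator A (x + h) - indicator A x\<bar> \<partial>lborel"
  let ?c = "r / pi * (2 * ln (1 / r) + ln 2)"
  let ?a = "measure lborel A"
  have [measurable]: "ball (0::'a) 1 \<in> sets borel" "{h::'a. 1 \<le> norm h} \<in> sets borel"
    by (auto intro!: borel_closed closed_Collect_le continuous_intros)
  have fin: "emeasure lborel A < \<infinity>" using bd by (rule emeasure_bounded_finite)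
  then have a: "emeasure lborel A = ennreal ?a" by (intro emeasure_eq_ennreal_measure) auto
  have D: "?D h \<le> 2 * emeasure lborel A" for h
  proof -
    have "?D h \<le> (\<integral>\<^sup>+z. indicator A z + indicator A (h + z) \<partial>lborel)"
      by (rule nn_integral_mono) (auto simp: indicator_def add.commute)
    also have "\<dots> = (\<integral>\<^sup>+z. indicator A z \<partial>lborel) + (\<integral>\<^sup>+z. indicator A (h + z) \<partial>lborel)"
      by (rule nn_integral_add) measurable
    also have "(\<integral>\<^sup>+z. indicator A (h + z) \<partial>lborel) = (\<integral>\<^sup>+z. indicator A z \<partial>lborel)"
      by (rule nn_integral_lborel_translate) measurable
    finally show ?thesis by (simp add: mult_2)
  qed
  have "(\<integral>\<^sup>+h. ?k h * ?D h \<partial>lborel) \<le> (\<integral>\<^sup>+h. ?k1 h * ?D h + ?k h * indicator {h. 1 \<le> norm h} h * (2 * emeasure lborel A) \<partial>lborel)"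
  proof (rule nn_integral_mono)
    fix h :: 'a
    show "?k h * ?D h \<le> ?k1 h * ?D h + ?k h * indicator {h. 1 \<le> norm h} h * (2 * emeasure lborel A)"
      using D[of h] by (cases "norm h < 1") (auto simp: not_less intro!: mult_left_mono)
  qed
  also have "\<dots> = (\<integral>\<^sup>+h. ?k1 h * ?D h \<partial>lborel) + (\<integral>\<^sup>+h. ?k h * indicator {h. 1 \<le> norm h} h * (2 * emeasure lborel A) \<partial>lborel)"
    by (rule nn_integral_add) measurable
  also have "\<dots> \<le> ennreal ?c * ennreal (real_of_ereal (Per A)) + ennreal (4 * real DIM('a) * ?a * r)"
  proof (rule add_mono)
    show "(\<integral>\<^sup>+h. ?k1 h * ?D h \<partial>lborel) \<le> ennreal ?c * ennreal (real_of_ereal (Per A))"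
    proof (rule nonlocal_variation_le_Per[OF A bd per])
      have "(\<integral>\<^sup>+h. ?k1 h \<partial>lborel) \<le> (\<integral>\<^sup>+h. ?k h \<partial>lborel)"
        using r by (intro nn_integral_mono ennreal_leI) (simp add: indicator_def cauchy_kernel_nonneg)
      then show "(\<integral>\<^sup>+h. ?k1 h \<partial>lborel) \<le> 1" by (simp add: nn_integral_cauchy_kernel_0[OF r(1)])
      show "(\<integral>\<^sup>+h. ?k1 h * ennreal \<bar>h \<bullet> v\<bar> \<partial>lborel) \<le> ennreal ?c * ennreal (norm v)" for v
        by (rule cauchy_kernel_first_moment[OF r])
    qed measurable
    have "(\<integral>\<^sup>+(h::'a). ?k h * indicator {h. 1 \<le> norm h} h * (2 * emeasure lborel A) \<partial>lborel)
       = (\<integral>\<^sup>+(h::'a). ?k h * indicator {h. 1 \<le> norm h} h \<partial>lborel) * (2 * emeasure lborel A)"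
      by (rule nn_integral_multc) measurable
    also have "\<dots> \<le> ennreal (2 * real DIM('a) * r) * (2 * emeasure lborel A)"
      by (intro mult_right_mono cauchy_kernel_tail r) simp
    also have "\<dots> = ennreal (2 * real DIM('a) * r) * ennreal (2 * ?a)" unfolding a by (simp add: ennreal_mult')
    also have "\<dots> = ennreal (4 * real DIM('a) * ?a * r)"
      using r by (subst ennreal_mult'[symmetric]) (auto simp: mult_ac)
    finally show "(\<integral>\<^sup>+(h::'a). ?k h * indicator {h. 1 \<le> norm h} h * (2 * emeasure lborel A) \<partial>lborel) \<le> ennreal (4 * real DIM('a) * ?a * r)" .
  qed
  also have "\<dots> = ennreal (?c * real_of_ereal (Per A) + 4 * real DIM('a) * ?a * r)"
  proof -
    have "0 \<le> Per A" by (rule Per_nonneg)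
    moreover have "0 \<le> ?c" using r by simp
    ultimately show ?thesis using r
      by (subst ennreal_mult'[symmetric]) (auto simp: real_of_ereal_pos intro!: ennreal_plus[symmetric])
  qed
  finally have Q: "(\<integral>\<^sup>+h. ?k h * ?D h \<partial>lborel) \<le> ennreal (?c * real_of_ereal (Per A) + 4 * real DIM('a) * ?a * r)" .
  show ?thesis
    unfolding heat_content_deficit[OF r(1) A, symmetric] by (intro add_left_mono Q)
qed

subsection \<open>The upper bound\<close>

text \<open>
  F need not be measurable, since the Bochner integral of a non-integrable function is 0. This is
  what makes the bound applicable to the bridge expectation, whose dependence on the end points
  comes from an arbitrary choice of realisations.
\<close>

lemma ennreal_integral_le_nn_integral:
  fixes F :: "'a \<Rightarrow> real"
  assumes "\<And>x. 0 \<le> F x" "\<And>x. ennreal (F x) \<le> g x"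
  shows "ennreal (\<integral>x. F x \<partial>M) \<le> (\<integral>\<^sup>+x. g x \<partial>M)"
proof (cases "integrable M F")
  case True
  then have "ennreal (\<integral>x. F x \<partial>M) = (\<integral>\<^sup>+x. ennreal (F x) \<partial>M)"
    using assms(1) by (intro nn_integral_eq_integral[symmetric]) auto
  also have "\<dots> \<le> (\<integral>\<^sup>+x. g x \<partial>M)" by (intro nn_integral_mono assms(2))
  finally show ?thesis .
qed (simp add: not_integrable_integral_eq)

text \<open>In terms of the lag r = u - s this is the integral of (t - r)(c r + d) over 0 < r < t.
  The coefficient 1/6 of c is the source of 1/3! in the result. Open intervals are exchanged for
  closed ones, off null sets, to apply the fundamental theorem.\<close>

lemma nn_integral_triangle:
  assumes c: "0 \<le> c" "0 \<le> d" and t: "0 < (t::real)"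
  shows "(\<integral>\<^sup>+u. \<integral>\<^sup>+s. indicator {0<..<t} u * (indicator {0<..<u} s * ennreal (c * (u - s) + d)) \<partial>lborel \<partial>lborel)
    = ennreal (c * t ^ 3 / 6 + d * t\<^sup>2 / 2)"
proof -
  have inner: "(\<integral>\<^sup>+s. indicator {0<..<u} s * ennreal (c * (u - s) + d) \<partial>lborel) = ennreal (c * u\<^sup>2 / 2 + d * u)"
    if u: "0 < u" for u
  proof -
    have "AE s in lborel. s \<noteq> 0 \<and> s \<noteq> u" by (intro AE_conjI AE_lborel_singleton)
    then have "AE s in lborel. indicator {0<..<u} s * ennreal (c * (u - s) + d) = ennreal (c * (u - s) + d) * indicator {0..u} s"
      by (rule eventually_mono) (auto simp: indicator_def)
    then have "(\<integral>\<^sup>+s. indicator {0<..<u} s * ennreal (c * (u - s) + d) \<partial>lborel)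
        = (\<integral>\<^sup>+s. ennreal (c * (u - s) + d) * indicator {0..u} s \<partial>lborel)"
      by (rule nn_integral_cong_AE)
    also have "\<dots> = ennreal ((- c * (u - u)\<^sup>2 / 2 + d * u) - (- c * (u - 0)\<^sup>2 / 2 + d * 0))"
    proof (rule nn_integral_FTC_Icc[where F="\<lambda>s. - c * (u - s)\<^sup>2 / 2 + d * s"])
      show "((\<lambda>s. - c * (u - s)\<^sup>2 / 2 + d * s) has_real_derivative c * (u - s) + d) (at s)" for s
        by (auto intro!: derivative_eq_intros simp: field_simps)
    qed (use c u in auto)
    finally show ?thesis by (simp add: add.commute)
  qed
  have "AE u in lborel. u \<noteq> 0 \<and> u \<noteq> t" by (intro AE_conjI AE_lborel_singleton)
  then have "AE u in lborel. (\<integral>\<^sup>+s. indicator {0<..<t} u * (indicator {0<..<u} s * ennreal (c * (u - s) + d)) \<partial>lborel)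
      = ennreal (c * u\<^sup>2 / 2 + d * u) * indicator {0..t} u"
  proof (rule eventually_mono)
    fix u assume u: "u \<noteq> 0 \<and> u \<noteq> t"
    show "(\<integral>\<^sup>+s. indicator {0<..<t} u * (indicator {0<..<u} s * ennreal (c * (u - s) + d)) \<partial>lborel)
      = ennreal (c * u\<^sup>2 / 2 + d * u) * indicator {0..t} u"
    proof (cases "u \<in> {0<..<t}")
      case True
      then show ?thesis using inner[of u] by simp
    next
      case False
      with u have "u \<notin> {0..t}" by auto
      then show ?thesis using False by simp
    qed
  qed
  then have "(\<integral>\<^sup>+u. \<integral>\<^sup>+s. indicator {0<..<t} u * (indicator {0<..<u} s * ennreal (c * (u - s) + d)) \<partial>lborel \<partial>lborel)
    = (\<integral>\<^sup>+u. ennreal (c * u\<^sup>2 / 2 + d * u) * indicator {0..t} u \<partial>lborel)"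
    by (rule nn_integral_cong_AE)
  also have "\<dots> = ennreal ((c * t ^ 3 / 6 + d * t\<^sup>2 / 2) - (c * 0 ^ 3 / 6 + d * 0\<^sup>2 / 2))"
    using c t by (intro nn_integral_FTC_Icc) (auto intro!: derivative_eq_intros simp: power2_eq_square field_simps)
  finally show ?thesis by simp
qed

text \<open>The divergence of an admissible field is continuous, hence measurable, so its integral
  ignores the difference of the two sets, which lies in \<open>N\<close>.\<close>

lemma Per_cong_null:
  fixes \<Omega> :: "'a::euclidean_space set"
  assumes "\<Omega> \<in> sets lebesgue" "A \<in> sets borel" "N \<in> null_sets lborel" "A \<subseteq> \<Omega>" "\<Omega> \<subseteq> A \<union> N"
  shows "Per \<Omega> = Per A"
proof -
  have "(LINT x:\<Omega>|lebesgue. divergence \<phi> x) = (LINT x:A|lebesgue. divergence \<phi> x)" if \<phi>: "\<phi> \<in> C1c_unit_fields" for \<phi>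
  proof -
    have "continuous_on UNIV (divergence \<phi>)"
      using \<phi> unfolding C1c_unit_fields_def divergence_def[abs_def] by (auto intro!: continuous_intros)
    then have "divergence \<phi> \<in> borel_measurable lborel" by (simp add: borel_measurable_continuous_onI)
    then have [measurable]: "divergence \<phi> \<in> borel_measurable lebesgue" by (rule measurable_completion)
    have [measurable]: "\<Omega> \<in> sets lebesgue" "A \<in> sets lebesgue" using assms by auto
    have "AE x in lebesgue. x \<notin> N" using AE_completion[OF AE_not_in[OF assms(3)]] .
    then show ?thesis unfolding set_lebesgue_integral_def
      by (intro integral_cong_AE) (use assms(4,5) in \<open>auto elim!: eventually_mono simp: indicator_def\<close>)
  qed
  then show ?thesis unfolding Per_def by (intro SUP_cong) auto
qed

text \<open>The four cubic constants come, in order, from the cubic Taylor term, from ln 2 in the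
  first moment, from the tail of the kernel, and from the error \<open>D\<close> of replacing the
  logarithm in the deficit by its value at t.\<close>

lemma Psi_bound_borel:
  fixes \<Omega> A :: "'a::euclidean_space set"
    and B :: "'a \<Rightarrow> 'a \<Rightarrow> real \<Rightarrow> 'w measure \<times> (real \<Rightarrow> 'w \<Rightarrow> 'a)"
  assumes bridge: "\<And>x y. is_cauchy_bridge x y t (fst (B x y t)) (snd (B x y t))"
    and A[measurable]: "A \<in> sets borel" and N: "N \<in> null_sets lborel" and \<Omega>: "A \<subseteq> \<Omega>" "\<Omega> \<subseteq> A \<union> N"
    and bd: "bounded A" and per: "Per A < \<infinity>" and t: "0 < t" "t < 1"
  shows "Psi B \<Omega> t + t * (t / 2 - 1) * measure lborel A
    \<le> (measure lborel A / 6 + real_of_ereal (Per A) * ln 2 / (12 * pi) + real DIM('a) * measure lborel A / 3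
        + real_of_ereal (Per A) / (2 * pi)) * t ^ 3
      + real_of_ereal (Per A) / (6 * pi) * t ^ 3 * ln (1 / t)"
proof -
  let ?a = "measure lborel A" and ?P = "real_of_ereal (Per A)"
  have fin: "emeasure lborel A < \<infinity>" using bd by (rule emeasure_bounded_finite)
  then have a: "emeasure lborel A = ennreal ?a" by (intro emeasure_eq_ennreal_measure) auto
  have P: "0 \<le> ?P" using Per_nonneg by (rule real_of_ereal_pos)
  let ?m = "\<lambda>x y. ennreal (1 + t\<^sup>2 / 6) * (\<integral>\<^sup>+s. indicator {0<..<t} s * single_time A t x y s \<partial>lborel)"
  let ?J = "\<lambda>x y. \<integral>\<^sup>+u. \<integral>\<^sup>+s. indicator {0<..<t} u * (indicator {0<..<u} s * two_times A t x y s u) \<partial>lborel \<partial>lborel"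
  let ?F = "\<lambda>x y. cauchy_kernel t x y * (1 - bridge_expect (fst (B x y t)) (snd (B x y t)) t \<Omega>)"
  have F0: "0 \<le> ?F x y" for x y
    using bridge_expect_bound(1)[OF bridge t(1) A N \<Omega>] t by (simp add: cauchy_kernel_nonneg)
  have FJ: "ennreal (?F x y) + ?J x y \<le> ?m x y" for x y
    by (rule bridge_expect_bound(2)[OF bridge t(1) A N \<Omega>])
  \<comment> \<open>\<open>?F\<close> may fail to be measurable, so its integral cannot be added to
    that of \<open>?J\<close>. Instead \<open>?J\<close> is subtracted first, the measurable
    difference is integrated, and \<open>?J\<close> is added back afterwards. If \<open>?J\<close>
    is infinite then so is \<open>?m\<close>, and \<open>top - top = top\<close> keeps the bound
    true.\<close>
  have F_le: "ennreal (?F x y) \<le> ?m x y - ?J x y" for x y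
  proof (cases "?J x y = \<infinity>")
    case True
    then show ?thesis using FJ[of x y] by (simp add: top_unique)
  next
    case False
    then show ?thesis using FJ[of x y] by (simp add: ennreal_le_minus_iff less_top)
  qed
  have J_le: "?J x y \<le> ?m x y" for x y
    by (rule order_trans[OF _ FJ]) simp
  have "ennreal (Psi B \<Omega> t) \<le> (\<integral>\<^sup>+x. \<integral>\<^sup>+y. ?m x y - ?J x y \<partial>lborel \<partial>lborel)"
    unfolding Psi_def
    by (intro ennreal_integral_le_nn_integral Bochner_Integration.integral_nonneg F0 F_le)
  then have "ennreal (Psi B \<Omega> t) + (\<integral>\<^sup>+x. \<integral>\<^sup>+y. ?J x y \<partial>lborel \<partial>lborel)
     \<le> (\<integral>\<^sup>+x. \<integral>\<^sup>+y. ?m x y - ?J x y \<partial>lborel \<partial>lborel) + (\<integral>\<^sup>+x. \<integral>\<^sup>+y. ?J x y \<partial>lborel \<partial>lborel)"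
    by (rule add_right_mono)
  also have "\<dots> = (\<integral>\<^sup>+x. (\<integral>\<^sup>+y. ?m x y - ?J x y \<partial>lborel) + (\<integral>\<^sup>+y. ?J x y \<partial>lborel) \<partial>lborel)"
    by (rule nn_integral_add[symmetric]) measurable
  also have "\<dots> = (\<integral>\<^sup>+x. \<integral>\<^sup>+y. (?m x y - ?J x y) + ?J x y \<partial>lborel \<partial>lborel)"
    by (intro nn_integral_cong nn_integral_add[symmetric]) measurable
  also have "\<dots> = (\<integral>\<^sup>+x. \<integral>\<^sup>+y. ?m x y \<partial>lborel \<partial>lborel)"
    by (intro nn_integral_cong diff_add_cancel_ennreal J_le)
  also have "\<dots> = (\<integral>\<^sup>+x. ennreal (1 + t\<^sup>2 / 6) * (\<integral>\<^sup>+y. \<integral>\<^sup>+s. indicator {0<..<t} s * single_time A t x y s \<partial>lborel \<partial>lborel) \<partial>lborel)"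
    by (intro nn_integral_cong nn_integral_cmult) measurable
  also have "\<dots> = ennreal (1 + t\<^sup>2 / 6) * (\<integral>\<^sup>+x. \<integral>\<^sup>+y. \<integral>\<^sup>+s. indicator {0<..<t} s * single_time A t x y s \<partial>lborel \<partial>lborel \<partial>lborel)"
    by (rule nn_integral_cmult) measurable
  also have "\<dots> = ennreal ((1 + t\<^sup>2 / 6) * (t * ?a))"
    unfolding nn_integral_occupation_first[OF t(1) A] a using t by (simp add: ennreal_mult)
  finally have upper: "ennreal (Psi B \<Omega> t) + (\<integral>\<^sup>+x. \<integral>\<^sup>+y. ?J x y \<partial>lborel \<partial>lborel) \<le> ennreal ((1 + t\<^sup>2 / 6) * (t * ?a))" .
  define H where "H = (\<integral>\<^sup>+u. \<integral>\<^sup>+s. indicator {0<..<t} u * (indicator {0<..<u} s * heat_content A (u - s)) \<partial>lborel \<partial>lborel)"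
  have upper: "ennreal (Psi B \<Omega> t) + H \<le> ennreal ((1 + t\<^sup>2 / 6) * (t * ?a))"
    using upper unfolding nn_integral_occupation_second[OF A] H_def .
  \<comment> \<open>\<open>C * r + D\<close> majorises the bound on twice the heat content deficit
    by an affine function of the lag r. \<open>D\<close> is of order t, so its contribution over the
    triangle is of order t^3 and carries no logarithm.\<close>
  define C where "C = ?P / pi * (2 * ln (1 / t) + ln 2) + 4 * real DIM('a) * ?a"
  define D where "D = 2 * t * ?P / pi"
  have lnt: "0 < ln (1 / t)" using t by simp
  have C: "0 \<le> C" using P lnt by (auto simp: C_def intro!: add_nonneg_nonneg mult_nonneg_nonneg)
  have D: "0 \<le> D" using P t by (simp add: D_def)
  have q: "r / pi * (2 * ln (1 / r) + ln 2) * ?P + 4 * real DIM('a) * ?a * r \<le> C * r + D" if r: "0 < r" "r < t" for r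
  proof -
    \<comment> \<open>keeps the sharp coefficient of \<open>ln (1 / t)\<close> without integrating a logarithm\<close>
    have "ln (1 / r) = ln (1 / t) + ln (t / r)" using r t by (simp add: ln_div)
    also have "ln (t / r) \<le> t / r - 1" using r t by (intro ln_le_minus_one) simp
    finally have "r * ln (1 / r) \<le> r * (ln (1 / t) + (t / r - 1))" using r by (intro mult_left_mono) auto
    also have "\<dots> = r * ln (1 / t) + t - r" using r by (simp add: field_simps)
    finally have "r * ln (1 / r) \<le> r * ln (1 / t) + t" using r by simp
    then have "?P / pi * (2 * (r * ln (1 / r)) + r * ln 2) \<le> ?P / pi * (2 * (r * ln (1 / t) + t) + r * ln 2)"
      using P by (intro mult_left_mono) auto
    then show ?thesis by (simp add: C_def D_def algebra_simps)
  qed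
  have hm[measurable]: "(\<lambda>v. heat_content A (f v)) \<in> borel_measurable M" if [measurable]: "f \<in> borel_measurable M" for f :: "'z \<Rightarrow> real" and M
    unfolding heat_content_def by measurable
  \<comment> \<open>The constant 2|A| integrated over the triangle of area t^2/2; comparing it
    pointwise with the heat content yields the lower bound for \<open>H\<close>.\<close>
  have "ennreal (?a * t\<^sup>2) = (\<integral>\<^sup>+u. \<integral>\<^sup>+s. indicator {0<..<t} u * (indicator {0<..<u} s * ennreal (0 * (u - s) + 2 * ?a)) \<partial>lborel \<partial>lborel)"
    using nn_integral_triangle[of 0 "2 * ?a" t] t by simp
  also have "\<dots> \<le> (\<integral>\<^sup>+u. \<integral>\<^sup>+s. 2 * (indicator {0<..<t} u * (indicator {0<..<u} s * heat_content A (u - s)))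
      + indicator {0<..<t} u * (indicator {0<..<u} s * ennreal (C * (u - s) + D)) \<partial>lborel \<partial>lborel)"
  proof (intro nn_integral_mono)
    fix u s :: real
    show "indicator {0<..<t} u * (indicator {0<..<u} s * ennreal (0 * (u - s) + 2 * ?a))
      \<le> 2 * (indicator {0<..<t} u * (indicator {0<..<u} s * heat_content A (u - s)))
      + indicator {0<..<t} u * (indicator {0<..<u} s * ennreal (C * (u - s) + D))"
    proof (cases "u \<in> {0<..<t} \<and> s \<in> {0<..<u}")
      case True
      then have r: "0 < u - s" "u - s \<le> 1" "u - s < t" using t by auto
      have "ennreal (2 * ?a) = 2 * emeasure lborel A" unfolding a by (simp add: ennreal_mult')
      also have "\<dots> \<le> 2 * heat_content A (u - s) + ennreal ((u - s) / pi * (2 * ln (1 / (u - s)) + ln 2) * ?P + 4 * real DIM('a) * ?a * (u - s))"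
        by (rule heat_content_lower[OF r(1,2) A bd per])
      also have "\<dots> \<le> 2 * heat_content A (u - s) + ennreal (C * (u - s) + D)"
        by (intro add_left_mono ennreal_leI q r)
      finally show ?thesis using True by simp
    qed (auto simp: indicator_def)
  qed
  also have "\<dots> = (\<integral>\<^sup>+u. (\<integral>\<^sup>+s. 2 * (indicator {0<..<t} u * (indicator {0<..<u} s * heat_content A (u - s))) \<partial>lborel)
      + (\<integral>\<^sup>+s. indicator {0<..<t} u * (indicator {0<..<u} s * ennreal (C * (u - s) + D)) \<partial>lborel) \<partial>lborel)"
    by (intro nn_integral_cong nn_integral_add) measurable
  also have "\<dots> = (\<integral>\<^sup>+u. \<integral>\<^sup>+s. 2 * (indicator {0<..<t} u * (indicator {0<..<u} s * heat_content A (u - s))) \<partial>lborel \<partial>lborel)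
      + (\<integral>\<^sup>+u. \<integral>\<^sup>+s. indicator {0<..<t} u * (indicator {0<..<u} s * ennreal (C * (u - s) + D)) \<partial>lborel \<partial>lborel)"
    by (rule nn_integral_add) measurable
  also have "(\<integral>\<^sup>+u. \<integral>\<^sup>+s. 2 * (indicator {0<..<t} u * (indicator {0<..<u} s * heat_content A (u - s))) \<partial>lborel \<partial>lborel)
      = (\<integral>\<^sup>+u. 2 * (\<integral>\<^sup>+s. indicator {0<..<t} u * (indicator {0<..<u} s * heat_content A (u - s)) \<partial>lborel) \<partial>lborel)"
    by (intro nn_integral_cong nn_integral_cmult) measurable
  also have "\<dots> = 2 * H" unfolding H_def by (rule nn_integral_cmult) measurable
  also have "(\<integral>\<^sup>+u. \<integral>\<^sup>+s. indicator {0<..<t} u * (indicator {0<..<u} s * ennreal (C * (u - s) + D)) \<partial>lborel \<partial>lborel)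
      = ennreal (C * t ^ 3 / 6 + D * t\<^sup>2 / 2)" by (rule nn_integral_triangle[OF C D t(1)])
  finally have lower: "ennreal (?a * t\<^sup>2) \<le> 2 * H + ennreal (C * t ^ 3 / 6 + D * t\<^sup>2 / 2)" .
  have "H \<le> ennreal ((1 + t\<^sup>2 / 6) * (t * ?a))" using upper by (rule order_trans[rotated]) simp
  \<comment> \<open>Finiteness allows the remaining subtraction to take place in the reals.\<close>
  then have "H < top" by (rule le_less_trans) simp
  then obtain h where h: "0 \<le> h" "H = ennreal h" by (cases H) auto
  have Psi0: "0 \<le> Psi B \<Omega> t" unfolding Psi_def by (intro Bochner_Integration.integral_nonneg F0)
  have 1: "Psi B \<Omega> t + h \<le> (1 + t\<^sup>2 / 6) * (t * ?a)"
    using upper Psi0 h t by (simp add: ennreal_plus[symmetric] del: ennreal_plus)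
  have "ennreal (?a * t\<^sup>2) \<le> ennreal (2 * h + (C * t ^ 3 / 6 + D * t\<^sup>2 / 2))"
  proof -
    have "0 \<le> C * t ^ 3 / 6 + D * t\<^sup>2 / 2" using C D t by simp
    then show ?thesis using lower h by (simp add: ennreal_mult')
  qed
  then have 2: "?a * t\<^sup>2 \<le> 2 * h + (C * t ^ 3 / 6 + D * t\<^sup>2 / 2)"
    using h C D t by (subst (asm) ennreal_le_iff) auto
  have "Psi B \<Omega> t + t * (t / 2 - 1) * ?a \<le> (1 + t\<^sup>2 / 6) * (t * ?a) - h + t * (t / 2 - 1) * ?a" using 1 by simp
  also have "\<dots> \<le> (1 + t\<^sup>2 / 6) * (t * ?a) - (?a * t\<^sup>2 - (C * t ^ 3 / 6 + D * t\<^sup>2 / 2)) / 2 + t * (t / 2 - 1) * ?a"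
    using 2 by simp
  \<comment> \<open>The terms of order t and t^2 in |A| cancel against
    \<open>t * (t / 2 - 1) * ?a\<close>; only cubic terms and the logarithm survive.\<close>
  also have "\<dots> = (?a / 6 + ?P * ln 2 / (12 * pi) + real DIM('a) * ?a / 3 + ?P / (2 * pi)) * t ^ 3 + ?P / (6 * pi) * t ^ 3 * ln (1 / t)"
  proof -
    have "(1 + t\<^sup>2 / 6) * (t * a) - (a * t\<^sup>2 - ((X * (2 * L + l) + 4 * n * a) * t ^ 3 / 6 + 2 * t * X * t\<^sup>2 / 2)) / 2 + t * (t / 2 - 1) * a
      = (a / 6 + X * l / 12 + n * a / 3 + X / 2) * t ^ 3 + X / 6 * t ^ 3 * L" for X L l n a :: real
      by (simp add: field_simps power2_eq_square power3_eq_cube)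
    from this[of ?a "?P / pi" "ln (1 / t)" "ln 2" "real DIM('a)"]
    show ?thesis unfolding C_def D_def by (simp add: mult.commute)
  qed
  finally show ?thesis .
qed

theorem theorem1p1:
  fixes \<Omega> :: "'a::euclidean_space set"
    and B :: "'a \<Rightarrow> 'a \<Rightarrow> real \<Rightarrow> 'w measure \<times> (real \<Rightarrow> 'w \<Rightarrow> 'a)"
  assumes "DIM('a) \<ge> 2"
    and "\<forall>x y t. 0 < t \<longrightarrow> is_cauchy_bridge x y t (fst (B x y t)) (snd (B x y t))"
    and "\<Omega> \<in> sets lebesgue" and "bounded \<Omega>" and "interior \<Omega> \<noteq> {}"
    and "Per \<Omega> < \<infinity>"
  shows "(\<exists>\<gamma>>0. \<forall>t. 0 < t \<and> t < min (diameter \<Omega>) (exp (-1)) \<longrightarrow>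
            Psi B \<Omega> t + t * (t / 2 - 1) * measure lebesgue \<Omega>
              \<le> \<gamma> * t ^ 3 + real_of_ereal (Per \<Omega>) / (fact 3 * pi) * t ^ 3 * ln (1 / t))
       \<and> Limsup (at_right 0)
           (\<lambda>t. ereal ((Psi B \<Omega> t + t * (t / 2 - 1) * measure lebesgue \<Omega>) / (t ^ 3 * ln (1 / t))))
         \<le> ereal (real_of_ereal (Per \<Omega>) / (fact 3 * pi))"
proof -
  \<comment> \<open>The finite-dimensional distributions speak of Borel sets only, so \<Omega> is
    replaced by an F-sigma subset \<open>A\<close>; the Lebesgue null remainder is enlarged to the
    Borel null set \<open>N\<close>.\<close>
  obtain A T where A: "fsigma A" and T: "T \<in> null_sets lebesgue" and AT: "A \<union> T = \<Omega>" "disjnt A T"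
    by (rule lebesgue_set_almost_fsigma[OF assms(3)])
  have [measurable]: "A \<in> sets borel" using A by cases (auto intro!: sets.countable_UN borel_closed)
  obtain N where N: "N \<in> null_sets lborel" "T \<subseteq> N"
    using T by (auto simp: null_sets_completion_iff2)
  have \<Omega>: "A \<subseteq> \<Omega>" "\<Omega> \<subseteq> A \<union> N" using AT N(2) by auto
  have bd: "bounded A" using assms(4) \<Omega>(1) by (rule bounded_subset)
  have perA: "Per \<Omega> = Per A" by (rule Per_cong_null[OF assms(3) _ N(1) \<Omega>]) measurable
  have per: "Per A < \<infinity>" using assms(6) by (simp add: perA)
  have meas: "measure lebesgue \<Omega> = measure lborel A"
  proof -
    have "measure lebesgue (A \<union> T) = measure lebesgue A"
      using T by (intro measure_Un_null_set) auto
    then show ?thesis by (simp add: AT)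
  qed
  let ?a = "measure lborel A" and ?P = "real_of_ereal (Per A)"
  \<comment> \<open>The cubic constant of \<open>Psi_bound_borel\<close>; the summand 1 makes strict
    positivity immediate.\<close>
  define \<gamma> where "\<gamma> = ?a / 6 + ?P * ln 2 / (12 * pi) + real DIM('a) * ?a / 3 + ?P / (2 * pi) + 1"
  have P: "0 \<le> ?P" using Per_nonneg by (rule real_of_ereal_pos)
  have \<gamma>: "0 < \<gamma>" unfolding \<gamma>_def using P by (intro add_nonneg_pos add_nonneg_nonneg) auto
  have bound: "Psi B \<Omega> t + t * (t / 2 - 1) * measure lebesgue \<Omega> \<le> \<gamma> * t ^ 3 + ?P / (fact 3 * pi) * t ^ 3 * ln (1 / t)"
    if t: "0 < t" "t < 1" for t
  proof -
    have "Psi B \<Omega> t + t * (t / 2 - 1) * ?a \<le> (\<gamma> - 1) * t ^ 3 + ?P / (6 * pi) * t ^ 3 * ln (1 / t)"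
      using Psi_bound_borel[where B=B and \<Omega>=\<Omega>, OF _ _ N(1) \<Omega> bd per t] assms(2) t by (simp add: \<gamma>_def)
    also have "\<dots> \<le> \<gamma> * t ^ 3 + ?P / (6 * pi) * t ^ 3 * ln (1 / t)"
      using t by (intro add_right_mono mult_right_mono) auto
    finally show ?thesis by (simp add: meas fact_numeral)
  qed
  have e1: "exp (-1) < (1::real)" by simp
  show ?thesis
    unfolding perA
  proof (intro conjI exI[of _ \<gamma>] allI impI \<gamma>)
    fix t assume "0 < t \<and> t < min (diameter \<Omega>) (exp (-1))"
    then have "0 < t" "t < 1" using less_trans[OF _ e1] by auto
    then show "Psi B \<Omega> t + t * (t / 2 - 1) * measure lebesgue \<Omega> \<le> \<gamma> * t ^ 3 + ?P / (fact 3 * pi) * t ^ 3 * ln (1 / t)"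
      by (rule bound)
  next
    let ?q = "\<lambda>t. (Psi B \<Omega> t + t * (t / 2 - 1) * measure lebesgue \<Omega>) / (t ^ 3 * ln (1 / t))"
    have ev: "eventually (\<lambda>t::real. 0 < t \<and> t < 1) (at_right 0)"
      using eventually_at_right_real[of 0 1] by (auto elim: eventually_mono)
    \<comment> \<open>After division by t^3 ln(1/t) the cubic term becomes \<gamma> / ln(1/t), which
      vanishes as t tends to 0, and the perimeter term is already constant.\<close>
    have "Limsup (at_right 0) (\<lambda>t. ereal (?q t)) \<le> Limsup (at_right 0) (\<lambda>t. ereal (\<gamma> / ln (1 / t) + ?P / (fact 3 * pi)))"
    proof (rule Limsup_mono, use ev in eventually_elim)
      case (elim t)
      have l: "0 < ln (1 / t)" using elim by simp
      have "?q t \<le> (\<gamma> * t ^ 3 + ?P / (fact 3 * pi) * t ^ 3 * ln (1 / t)) / (t ^ 3 * ln (1 / t))"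
        using elim l by (intro divide_right_mono bound) auto
      also have "\<dots> = \<gamma> / ln (1 / t) + ?P / (fact 3 * pi)"
        using elim l by (simp add: add_divide_distrib)
      finally show ?case by simp
    qed
    also have "\<dots> = ereal (?P / (fact 3 * pi))"
    proof (rule lim_imp_Limsup)
      have "filterlim (\<lambda>t::real. ln (1 / t)) at_top (at_right 0)"
        by (rule filterlim_compose[OF ln_at_top]) (simp add: divide_inverse filterlim_inverse_at_top_right)
      then have "((\<lambda>t. \<gamma> / ln (1 / t)) \<longlongrightarrow> 0) (at_right 0)"
        by (intro tendsto_divide_0[OF tendsto_const] filterlim_at_top_imp_at_infinity)
      then have "((\<lambda>t. \<gamma> / ln (1 / t) + ?P / (fact 3 * pi)) \<longlongrightarrow> 0 + ?P / (fact 3 * pi)) (at_right 0)"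
        by (intro tendsto_intros)
      then show "((\<lambda>t. ereal (\<gamma> / ln (1 / t) + ?P / (fact 3 * pi))) \<longlongrightarrow> ereal (?P / (fact 3 * pi))) (at_right 0)" by simp
    qed simp
    finally show "Limsup (at_right 0) (\<lambda>t. ereal (?q t)) \<le> ereal (?P / (fact 3 * pi))" .
  qed
qed

end
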